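(* Let $\mathbf{D}$ be the node-arc incidence matrix of a directed graph $H=(V,A)$, let $d\in\mathbb{Z}_+$, let $\mathbf{H}\in\mathbb{Z}^{d\times d}$ be an invertible matrix with $\Delta=|\det\mathbf{H}|$, let $\mathbf{W}\in\mathbb{Z}^{d\times A}$, and let $\mathbf{f}\in\mathbb{Z}^d$. Consider $$\mathcal{S}:=\operatorname{conv}\left\{\mathbf{y}\in\mathbb{Z}_+^A : \mathbf{D}\mathbf{y}=\mathbf{0}\ \text{ and }\ \mathbf{W}\mathbf{y}\equiv\mathbf{f} \bmod \mathbf{H}\mathbb{Z}^d\right\},$$ which is the convex hull of nonnegative integer circulations in $H$ with a congruency constraint over $\mathbf{H}\mathbb{Z}^d$. Then $\mathcal{S}$ admits an extended formulation of size in $O(\Delta^{\Delta+1}|A|\cdot|V|^{\Delta-1})$ that can be constructed in polynomial time.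
   Context: $\mathbb{Z}_+$ denotes the nonnegative integers. The italic $H$ is a directed graph with node set $V$ and arc set $A$, while the bold $\mathbf{H}$ is a matrix; $\mathbb{Z}^{d\times A}$ denotes integer matrices with $d$ rows and columns indexed by $A$. The node-arc incidence matrix has rows indexed by nodes and columns indexed by arcs, the column of an arc being the difference of the unit vectors of its two end nodes (one entry $+1$, one entry $-1$, consistently with the direction of the arc). For an invertible integer matrix $\mathbf{H}\in\mathbb{Z}^{d\times d}$ and $\mathbf{u},\mathbf{v}\in\mathbb{Z}^d$, write $\mathbf{u}\equiv\mathbf{v} \bmod \mathbf{H}\mathbb{Z}^d$ if $\mathbf{u}-\mathbf{v}\in\mathbf{H}\mathbb{Z}^d$. An extended formulation of a polyhedron $\mathcal{E}\subseteq\mathbb{R}^p$ is a description $\mathcal{E}=\{\mathbf{x}\in\mathbb{R}^p : \exists\, \mathbf{z}\in\mathbb{R}^k \text{ such that } \mathbf{B}\mathbf{x}+\mathbf{C}\mathbf{z}\le\mathbf{e}\}$ with $\mathbf{B}\in\mathbb{R}^{\ell\times p}$, $\mathbf{C}\in\mathbb{R}^{\ell\times k}$, $\mathbf{e}\in\mathbb{R}^\ell$; its size is $\ell$. *)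

theory Defs
  imports
    "HOL-Analysis.Convex"
    "HOL-Library.Function_Algebras"
    "HOL-Library.Log_Nat"
    "HOL-Computational_Algebra.Polynomial"
    "Jordan_Normal_Form.Determinant"
    "Graph_Theory.Digraph"
begin

section \<open>Vectors indexed by a finite set\<close>

text \<open>A vector of \<open>\<real>\<^sup>A\<close>, for a finite set \<open>A :: 'a set\<close>, is a function \<open>'a \<Rightarrow> real\<close> that vanishes
  outside \<open>A\<close>. The pointwise vector space structure makes \<open>convex hull\<close> available for them.\<close>

instantiation "fun" :: (type, real_vector) real_vector
begin

definition scaleR_fun :: "real \<Rightarrow> ('a \<Rightarrow> 'b) \<Rightarrow> 'a \<Rightarrow> 'b" where
  "scaleR_fun r x = (\<lambda>a. r *\<^sub>R x a)"

instance
  by standard (simp_all add: scaleR_fun_def fun_eq_iff scaleR_add_right scaleR_add_left)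

end


section \<open>Circulations with a congruency constraint\<close>

text \<open>Loops are excluded where this is used; otherwise a loop would get a zero column.\<close>

definition incidence :: "('v, 'a) pre_digraph \<Rightarrow> 'v \<Rightarrow> 'a \<Rightarrow> int" where
  "incidence G v a = of_bool (v = head G a) - of_bool (v = tail G a)"

definition lattice_cong :: "int mat \<Rightarrow> int vec \<Rightarrow> int vec \<Rightarrow> bool" where
  "lattice_cong H u v \<longleftrightarrow> (\<exists>z \<in> carrier_vec (dim_col H). u - v = H *\<^sub>v z)"

definition congruency_circulations ::
    "('v, 'a) pre_digraph \<Rightarrow> nat \<Rightarrow> int mat \<Rightarrow> (nat \<Rightarrow> 'a \<Rightarrow> int) \<Rightarrow> int vec \<Rightarrow> ('a \<Rightarrow> nat) set" where
  "congruency_circulations G d H W f =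
     {y. (\<forall>a. a \<notin> arcs G \<longrightarrow> y a = 0) \<and>
         (\<forall>v \<in> verts G. (\<Sum>a \<in> arcs G. incidence G v a * int (y a)) = 0) \<and>
         lattice_cong H (vec d (\<lambda>i. \<Sum>a \<in> arcs G. W i a * int (y a))) f}"

definition circulation_hull ::
    "('v, 'a) pre_digraph \<Rightarrow> nat \<Rightarrow> int mat \<Rightarrow> (nat \<Rightarrow> 'a \<Rightarrow> int) \<Rightarrow> int vec \<Rightarrow> ('a \<Rightarrow> real) set" where
  "circulation_hull G d H W f =
     convex hull ((\<lambda>y a. real (y a)) ` congruency_circulations G d H W f)"


section \<open>Extended formulations\<close>

text \<open>\<open>B\<close> is an \<open>l \<times> A\<close> matrix, \<open>C\<close> an \<open>l \<times> k\<close> matrix and \<open>e\<close> a vector of length \<open>l\<close>; entries outside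
  these index ranges are irrelevant. The size is the number \<open>l\<close> of inequalities.\<close>

definition extended_formulation ::
    "'a set \<Rightarrow> ('a \<Rightarrow> real) set \<Rightarrow> nat \<Rightarrow> nat \<Rightarrow>
     (nat \<Rightarrow> 'a \<Rightarrow> real) \<Rightarrow> (nat \<Rightarrow> nat \<Rightarrow> real) \<Rightarrow> (nat \<Rightarrow> real) \<Rightarrow> bool" where
  "extended_formulation A E l k B C e \<longleftrightarrow>
     E = {x. (\<forall>a. a \<notin> A \<longrightarrow> x a = 0) \<and>
             (\<exists>z :: nat \<Rightarrow> real. \<forall>i<l. (\<Sum>a \<in> A. B i a * x a) + (\<Sum>j<k. C i j * z j) \<le> e i)}"


section \<open>A model of computation for polynomial time\<close>

text \<open>
  The programs are those of a deterministic first-order functional language (pure Lisp) over binary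
  trees with integer leaves. Every step has unit cost, except that an arithmetic operation is charged
  the bit lengths of its operands (logarithmic cost). Cells are passed by reference. An evaluation of
  cost \<open>t\<close> creates at most \<open>t\<close> cells and integers, of total bit length polynomial in \<open>t\<close> and the bit
  length of the input, so Turing machines simulate the language with polynomial overhead; the
  converse simulation is immediate. As shared cells could make the output exponentially larger
  than \<open>t\<close>, the tree size of the output is charged in addition (\<open>computes_within\<close>).
\<close>

datatype val = Num int | Cell val val

definition int_bits :: "int \<Rightarrow> nat" where
  "int_bits i = nat (bitlen \<bar>i\<bar>) + 1"

primrec val_size :: "val \<Rightarrow> nat" where
  "val_size (Num i) = int_bits i"
| "val_size (Cell u v) = 1 + val_size u + val_size v"

datatype arith = Add | Sub | Mul | Div | Mod | Less

primrec arith_op :: "arith \<Rightarrow> int \<Rightarrow> int \<Rightarrow> int" where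
  "arith_op Add i j = i + j"
| "arith_op Sub i j = i - j"
| "arith_op Mul i j = i * j"
| "arith_op Div i j = i div j"
| "arith_op Mod i j = i mod j"
| "arith_op Less i j = of_bool (i < j)"

text \<open>\<open>Var n\<close> refers to the \<open>n\<close>-th entry of the environment, \<open>Call n es\<close> to the \<open>n\<close>-th function of
  the program, whose body is evaluated in the environment of the argument values; functions may be
  mutually recursive.\<close>

datatype expr =
    Var nat
  | Lit int
  | Arith arith expr expr
  | Cond expr expr expr
  | MkCell expr expr
  | First expr
  | Second expr
  | IsCell expr
  | LetIn expr expr
  | Call nat "expr list"

text \<open>\<open>eval fs \<rho> e v t\<close>: with function bodies \<open>fs\<close> and environment \<open>\<rho>\<close>, the expression \<open>e\<close> evaluates
  to \<open>v\<close> at cost \<open>t\<close>.\<close>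

inductive eval :: "expr list \<Rightarrow> val list \<Rightarrow> expr \<Rightarrow> val \<Rightarrow> nat \<Rightarrow> bool"
  and evals :: "expr list \<Rightarrow> val list \<Rightarrow> expr list \<Rightarrow> val list \<Rightarrow> nat \<Rightarrow> bool"
  for fs :: "expr list" where
  Var: "n < length \<rho> \<Longrightarrow> eval fs \<rho> (Var n) (\<rho> ! n) 1"
| Lit: "eval fs \<rho> (Lit i) (Num i) 1"
| Arith: "\<lbrakk>eval fs \<rho> e1 (Num i) t1; eval fs \<rho> e2 (Num j) t2\<rbrakk> \<Longrightarrow>
    eval fs \<rho> (Arith f e1 e2) (Num (arith_op f i j)) (t1 + t2 + int_bits i + int_bits j)"
| Cond_True: "\<lbrakk>eval fs \<rho> e (Num i) t; i \<noteq> 0; eval fs \<rho> e1 v t1\<rbrakk> \<Longrightarrow>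
    eval fs \<rho> (Cond e e1 e2) v (t + t1 + 1)"
| Cond_False: "\<lbrakk>eval fs \<rho> e (Num 0) t; eval fs \<rho> e2 v t2\<rbrakk> \<Longrightarrow>
    eval fs \<rho> (Cond e e1 e2) v (t + t2 + 1)"
| MkCell: "\<lbrakk>eval fs \<rho> e1 v1 t1; eval fs \<rho> e2 v2 t2\<rbrakk> \<Longrightarrow>
    eval fs \<rho> (MkCell e1 e2) (Cell v1 v2) (t1 + t2 + 1)"
| First: "eval fs \<rho> e (Cell v1 v2) t \<Longrightarrow> eval fs \<rho> (First e) v1 (t + 1)"
| Second: "eval fs \<rho> e (Cell v1 v2) t \<Longrightarrow> eval fs \<rho> (Second e) v2 (t + 1)"
| IsCell_True: "eval fs \<rho> e (Cell v1 v2) t \<Longrightarrow> eval fs \<rho> (IsCell e) (Num 1) (t + 1)"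
| IsCell_False: "eval fs \<rho> e (Num i) t \<Longrightarrow> eval fs \<rho> (IsCell e) (Num 0) (t + 1)"
| LetIn: "\<lbrakk>eval fs \<rho> e1 v1 t1; eval fs (v1 # \<rho>) e2 v2 t2\<rbrakk> \<Longrightarrow>
    eval fs \<rho> (LetIn e1 e2) v2 (t1 + t2 + 1)"
| Call: "\<lbrakk>n < length fs; evals fs \<rho> es vs t1; eval fs vs (fs ! n) v t2\<rbrakk> \<Longrightarrow>
    eval fs \<rho> (Call n es) v (t1 + t2 + 1)"
| Nil: "evals fs \<rho> [] [] 0"
| Cons: "\<lbrakk>eval fs \<rho> e v t1; evals fs \<rho> es vs t2\<rbrakk> \<Longrightarrow> evals fs \<rho> (e # es) (v # vs) (t1 + t2)"

inductive_cases eval_elims: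
  "eval fs \<rho> (Var n) v t" "eval fs \<rho> (Lit i) v t" "eval fs \<rho> (Arith f e1 e2) v t"
  "eval fs \<rho> (Cond e e1 e2) v t" "eval fs \<rho> (MkCell e1 e2) v t" "eval fs \<rho> (First e) v t"
  "eval fs \<rho> (Second e) v t" "eval fs \<rho> (IsCell e) v t" "eval fs \<rho> (LetIn e1 e2) v t"
  "eval fs \<rho> (Call n es) v t" "evals fs \<rho> [] vs t" "evals fs \<rho> (e # es) vs t"

lemma eval_deterministic:
  "eval fs \<rho> e v t \<Longrightarrow> \<forall>v' t'. eval fs \<rho> e v' t' \<longrightarrow> v' = v \<and> t' = t"
  "evals fs \<rho> es vs t \<Longrightarrow> \<forall>vs' t'. evals fs \<rho> es vs' t' \<longrightarrow> vs' = vs \<and> t' = t"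
  by (induction rule: eval_evals.inducts)
     (intro allI impI, (erule eval_elims; metis val.inject val.distinct(1) Suc_eq_plus1 One_nat_def))+

text \<open>A program consists of function bodies \<open>fs\<close> and an expression \<open>e\<close> whose only variable \<open>Var 0\<close>
  is the input.\<close>

definition computes_within :: "expr list \<Rightarrow> expr \<Rightarrow> val \<Rightarrow> val \<Rightarrow> nat \<Rightarrow> bool" where
  "computes_within fs e inp out n \<longleftrightarrow> (\<exists>t. eval fs [inp] e out t \<and> t + val_size out \<le> n)"


section \<open>Encoding of the input and the output\<close>

definition enc_list :: "('b \<Rightarrow> val) \<Rightarrow> 'b list \<Rightarrow> val" where
  "enc_list g xs = foldr (\<lambda>x. Cell (g x)) xs (Num 0)"

definition enc_vector :: "'i list \<Rightarrow> ('i \<Rightarrow> int) \<Rightarrow> val" where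
  "enc_vector is u = enc_list (\<lambda>i. Num (u i)) is"

definition enc_matrix :: "'i list \<Rightarrow> 'j list \<Rightarrow> ('i \<Rightarrow> 'j \<Rightarrow> int) \<Rightarrow> val" where
  "enc_matrix is js M = enc_list (\<lambda>i. enc_vector js (M i)) is"

text \<open>The lists \<open>vl\<close> and \<open>al\<close> enumerate the nodes and the arcs; the digraph is given by its incidence
  matrix.\<close>

definition enc_instance ::
    "'v list \<Rightarrow> 'a list \<Rightarrow> ('v, 'a) pre_digraph \<Rightarrow> nat \<Rightarrow> int mat \<Rightarrow> (nat \<Rightarrow> 'a \<Rightarrow> int) \<Rightarrow> int vec \<Rightarrow> val" where
  "enc_instance vl al G d H W f =
     enc_list id
       [enc_matrix vl al (incidence G),
        enc_matrix [0..<d] [0..<d] (\<lambda>i j. H $$ (i, j)),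
        enc_matrix [0..<d] al W,
        enc_vector [0..<d] (\<lambda>i. f $ i)]"

definition enc_formulation ::
    "'a list \<Rightarrow> nat \<Rightarrow> nat \<Rightarrow> (nat \<Rightarrow> 'a \<Rightarrow> int) \<Rightarrow> (nat \<Rightarrow> nat \<Rightarrow> int) \<Rightarrow> (nat \<Rightarrow> int) \<Rightarrow> val" where
  "enc_formulation al l k B C e =
     enc_list id
       [enc_matrix [0..<l] al B,
        enc_matrix [0..<l] [0..<k] C,
        enc_vector [0..<l] e]"

end

theory Submission
  imports
    Defs
    "HOL-Library.Sublist"
    "HOL-Combinatorics.List_Permutation"
begin

text \<open>
  \<^bold>\<open>The formulation.\<close> An integer circulation is a sum of directed cycles, and the congruence depends only
  on the sum of the classes of these cycles in the group \<open>\<int>\<^sup>d / H \<int>\<^sup>d\<close>, which has \<open>\<Delta>\<close> elements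
  (\<open>lattice_representatives\<close>). Traversing the cycles one after the other is therefore a walk through the
  following network. It has a hub for each class, which records the sum of the classes of the cycles
  traversed so far. For each node \<open>v\<close> of the digraph it has a copy of the digraph in which the nodes carry a
  class in addition, and in which \<open>v\<close> at class \<open>g\<close> is identified with the hub of \<open>g\<close>. A cycle through \<open>v\<close>
  leads from hub to hub in the copy of \<open>v\<close>. Thus a feasible circulation lifts to a flow of value one from the
  hub of \<open>0\<close> to the hub of \<open>f\<close> (\<open>circulation_solution\<close>).

  Conversely, decompose such a flow, closed by a return arc, into closed trails. A trail through the return
  arc projects to a feasible circulation: in each copy it is conserved outside the hub, hence also at \<open>v\<close>
  (\<open>projection_circulation\<close>), and the classes along it add up to that of \<open>f\<close>. These trails have total weight
  one. The remaining trails project to circulations, and \<open>\<Delta>\<close> times a circulation has class zero, so they are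
  directions in which the hull is unbounded (\<open>stable_circulation\<close>). This proves \<open>solutions_eq_hull\<close>. The
  linear program has size \<open>O(\<Delta> |V| |A|)\<close>, which is within the bound if \<open>\<Delta> \<ge> 2\<close>. If \<open>\<Delta> = 1\<close>, a single copy
  without hub is enough and the size is \<open>O(|A|)\<close>.

  \<^bold>\<open>The algorithm.\<close> It needs the classes of vectors. Let \<open>N\<close> be an integer matrix and \<open>\<delta> = \<plusminus>\<Delta>\<close> with \<open>H N = \<delta> I\<close>.
  Then the residues of \<open>N w\<close> modulo \<open>\<delta>\<close> identify the class of \<open>w\<close> (\<open>lattice_cong_iff\<close>). Replacing the rows of
  the identity matrix by those of \<open>H\<close>, one at a time, and updating the multiple of the inverse gives \<open>N\<close>. At
  each step that multiple is the adjugate up to sign, so all divisions are exact and all numbers are minors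
  (\<open>elim_step\<close>, \<open>elim_inv_bound\<close>). The classes that are sums of classes of arcs are found by closing the set
  \<open>{0}\<close> under adding the class of an arc; this takes at most \<open>\<Delta>\<close> rounds.

  \<^bold>\<open>The running time.\<close> The program is not written down. The predicate \<open>PT\<close> says that some expression computes
  a given value in polynomial time, uniformly in a set of contexts. It is closed under the operations of the
  language and under folding over lists, if the intermediate values are bounded (\<open>PT_foldr\<close>). So it suffices
  to state the algorithm as a function on lists and to bound the accumulators of its loops. All bounds are
  powers, with a fixed exponent, of the size of the input plus \<open>\<Delta>\<close> plus 2; hence one program serves all \<open>\<Delta>\<close>.
\<close>

section \<open>Polynomial bounds\<close>

definition poly_bounded :: "'c set \<Rightarrow> ('c \<Rightarrow> nat) \<Rightarrow> ('c \<Rightarrow> nat) \<Rightarrow> bool" where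
  "poly_bounded I N T \<longleftrightarrow> (\<exists>k. \<forall>c\<in>I. T c \<le> (N c + 2) ^ k)"

lemma poly_bounded_mono:
  assumes "poly_bounded I N T" "J \<subseteq> I" "\<And>c. c \<in> J \<Longrightarrow> S c \<le> T c"
  shows "poly_bounded J N S"
  using assms unfolding poly_bounded_def by (meson order_trans subsetD)

lemma poly_bounded_add:
  assumes "poly_bounded I N S" "poly_bounded I N T"
  shows "poly_bounded I N (\<lambda>c. S c + T c)"
proof -
  obtain k l where k: "\<forall>c\<in>I. S c \<le> (N c + 2) ^ k" and l: "\<forall>c\<in>I. T c \<le> (N c + 2) ^ l"
    using assms unfolding poly_bounded_def by blast
  have "S c + T c \<le> (N c + 2) ^ (k + l + 1)" if c: "c \<in> I" for c
  proof -
    have "S c \<le> (N c + 2) ^ (k + l)" "T c \<le> (N c + 2) ^ (k + l)"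
      by (rule order_trans[OF bspec[OF k c]] order_trans[OF bspec[OF l c]], rule power_increasing; simp)+
    then have "S c + T c \<le> 2 * (N c + 2) ^ (k + l)" by simp
    also have "\<dots> \<le> (N c + 2) ^ (k + l + 1)" by simp
    finally show ?thesis .
  qed
  then show ?thesis unfolding poly_bounded_def by blast
qed

lemma poly_bounded_mult:
  assumes "poly_bounded I N S" "poly_bounded I N T"
  shows "poly_bounded I N (\<lambda>c. S c * T c)"
proof -
  obtain k l where k: "\<forall>c\<in>I. S c \<le> (N c + 2) ^ k" and l: "\<forall>c\<in>I. T c \<le> (N c + 2) ^ l"
    using assms unfolding poly_bounded_def by blast
  then have "\<forall>c\<in>I. S c * T c \<le> (N c + 2) ^ (k + l)"
    by (simp add: power_add mult_le_mono)
  then show ?thesis unfolding poly_bounded_def by blast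
qed

lemma poly_bounded_const: "poly_bounded I N (\<lambda>c. n)"
proof -
  have "n \<le> (m + 2) ^ n" for m :: nat
    using less_exp[of n] power_mono[of 2 "m + 2" n] by linarith
  then show ?thesis unfolding poly_bounded_def by blast
qed

lemma poly_bounded_param: "poly_bounded I N N"
  unfolding poly_bounded_def by (rule exI[of _ 1]) simp

lemmas poly_bounded_rules =
  poly_bounded_add poly_bounded_mult poly_bounded_const poly_bounded_param

lemma poly_bounded_subset: "poly_bounded I N T \<Longrightarrow> J \<subseteq> I \<Longrightarrow> poly_bounded J N T"
  by (rule poly_bounded_mono[of I N T J T]) simp_all

lemma poly_bounded_reindex:
  assumes "poly_bounded I N T" "\<And>c. c \<in> J \<Longrightarrow> h c \<in> I \<and> N (h c) = M c"
  shows "poly_bounded J M (\<lambda>c. T (h c))"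
  using assms unfolding poly_bounded_def by metis

lemma poly_boundedE:
  assumes "poly_bounded I N T"
  obtains k where "\<And>c. c \<in> I \<Longrightarrow> T c \<le> (N c + 2) ^ k"
  using assms unfolding poly_bounded_def by blast


section \<open>Uniform evaluation of expressions\<close>

text \<open>A program is never written down. A context \<open>c\<close> stands for the values of all variables in scope, \<open>\<rho> c\<close>
  for the environment that holds their encodings, and \<open>F c\<close> for the value to be computed; \<open>N c\<close> is the
  parameter in which everything is polynomial. Bound variables of loops extend the context.\<close>

definition env_ok :: "'c set \<Rightarrow> ('c \<Rightarrow> nat) \<Rightarrow> ('c \<Rightarrow> val list) \<Rightarrow> bool" where
  "env_ok I N \<rho> \<longleftrightarrow>
     (\<exists>m. \<forall>c\<in>I. length (\<rho> c) = m) \<and> poly_bounded I N (\<lambda>c. sum_list (map val_size (\<rho> c)))"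

text \<open>One expression has to work for all contexts. It may call functions, which are placed in the program
  from position \<open>n\<close> on. As \<open>n\<close> is arbitrary and the rest of the program is irrelevant, the functions of
  several expressions can be put side by side without renumbering their calls. The size of the value is
  bounded as well, since the cost of an evaluation does not bound it: reading a variable costs 1.\<close>

definition runs :: "'c set \<Rightarrow> ('c \<Rightarrow> nat) \<Rightarrow> ('c \<Rightarrow> val list) \<Rightarrow> ('c \<Rightarrow> val list) \<Rightarrow> bool" where
  "runs I N \<rho> vs \<longleftrightarrow> env_ok I N vs \<and>
     (\<forall>n. \<exists>gs es T. poly_bounded I N T \<and>
        (\<forall>c\<in>I. \<forall>pre post. length pre = n \<longrightarrow> (\<exists>t\<le>T c. evals (pre @ gs @ post) (\<rho> c) es (vs c) t)))"

definition run :: "'c set \<Rightarrow> ('c \<Rightarrow> nat) \<Rightarrow> ('c \<Rightarrow> val list) \<Rightarrow> ('c \<Rightarrow> val) \<Rightarrow> bool" where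
  "run I N \<rho> F \<longleftrightarrow> poly_bounded I N (\<lambda>c. val_size (F c)) \<and>
     (\<forall>n. \<exists>gs e T. poly_bounded I N T \<and>
        (\<forall>c\<in>I. \<forall>pre post. length pre = n \<longrightarrow> (\<exists>t\<le>T c. eval (pre @ gs @ post) (\<rho> c) e (F c) t)))"

text \<open>Polynomial time. The environment is bounded by assumption, so that variables satisfy the predicate
  without side conditions. Being hereditary in the set of contexts, it allows a case distinction or a loop
  body to restrict or transform that set, which is how the rules compose.\<close>

definition PT :: "'c set \<Rightarrow> ('c \<Rightarrow> nat) \<Rightarrow> ('c \<Rightarrow> val list) \<Rightarrow> ('c \<Rightarrow> val) \<Rightarrow> bool" where
  "PT I N \<rho> F \<longleftrightarrow> (\<forall>J\<subseteq>I. env_ok J N \<rho> \<longrightarrow> run J N \<rho> F)"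

lemma env_ok_Nil: "env_ok I N (\<lambda>_. [])"
  by (auto simp: env_ok_def intro: poly_bounded_const)

lemma env_ok_Cons:
  assumes "poly_bounded I N (\<lambda>c. val_size (F c))" "env_ok I N \<rho>"
  shows "env_ok I N (\<lambda>c. F c # \<rho> c)"
  using assms by (auto simp: env_ok_def intro!: poly_bounded_add)

lemma env_ok_tl:
  assumes "env_ok I N (\<lambda>c. F c # \<rho> c)"
  shows "poly_bounded I N (\<lambda>c. val_size (F c))" "env_ok I N \<rho>"
proof -
  from assms obtain m where m: "\<forall>c\<in>I. Suc (length (\<rho> c)) = m"
    and b: "poly_bounded I N (\<lambda>c. val_size (F c) + sum_list (map val_size (\<rho> c)))"
    by (auto simp: env_ok_def)
  have "\<forall>c\<in>I. length (\<rho> c) = m - 1" using m by auto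
  then show "env_ok I N \<rho>" unfolding env_ok_def
    using poly_bounded_mono[OF b, of I] by auto
  show "poly_bounded I N (\<lambda>c. val_size (F c))" by (rule poly_bounded_mono[OF b]) auto
qed

lemma env_ok_reindex:
  assumes "env_ok I N \<rho>" "\<And>c. c \<in> J \<Longrightarrow> h c \<in> I \<and> N (h c) = M c"
  shows "env_ok J M (\<lambda>c. \<rho> (h c))"
proof -
  obtain m where m: "\<forall>c\<in>I. length (\<rho> c) = m"
    and b: "poly_bounded I N (\<lambda>c. sum_list (map val_size (\<rho> c)))"
    using assms(1) unfolding env_ok_def by blast
  show ?thesis unfolding env_ok_def
    by (intro conjI exI[of _ m] poly_bounded_reindex[OF b assms(2)]) (use m assms(2) in auto)
qed

lemma env_ok_subset:
  assumes "env_ok I N \<rho>" "J \<subseteq> I"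
  shows "env_ok J N \<rho>"
  by (rule env_ok_reindex[OF assms(1), of J "\<lambda>c. c"]) (use assms(2) in auto)

lemma env_ok_image:
  assumes "env_ok J M (\<lambda>c. \<rho> (h c))" and N: "\<And>c. c \<in> J \<Longrightarrow> N (h c) = M c"
  shows "env_ok (h ` J) N \<rho>"
proof -
  obtain m where m: "\<forall>c\<in>J. length (\<rho> (h c)) = m"
    and b: "poly_bounded J M (\<lambda>c. sum_list (map val_size (\<rho> (h c))))"
    using assms(1) unfolding env_ok_def by blast
  obtain k where k: "\<And>c. c \<in> J \<Longrightarrow> sum_list (map val_size (\<rho> (h c))) \<le> (M c + 2) ^ k"
    using poly_boundedE[OF b] by blast
  have "poly_bounded (h ` J) N (\<lambda>c. sum_list (map val_size (\<rho> c)))"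
    unfolding poly_bounded_def by (rule exI[of _ k]) (use k N in auto)
  then show ?thesis unfolding env_ok_def using m by auto
qed

lemma runI:
  assumes "poly_bounded I N (\<lambda>c. val_size (F c))"
    and "\<And>n. \<exists>gs e T. poly_bounded I N T \<and>
        (\<forall>c\<in>I. \<forall>pre post. length pre = n \<longrightarrow> (\<exists>t\<le>T c. eval (pre @ gs @ post) (\<rho> c) e (F c) t))"
  shows "run I N \<rho> F"
  unfolding run_def by (intro conjI allI assms)

lemma runE:
  assumes "run I N \<rho> F"
  obtains gs e T where "poly_bounded I N T"
    "\<And>c pre post. c \<in> I \<Longrightarrow> length pre = n \<Longrightarrow> \<exists>t\<le>T c. eval (pre @ gs @ post) (\<rho> c) e (F c) t"
proof -
  from assms have "\<exists>gs e T. poly_bounded I N T \<and>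
        (\<forall>c\<in>I. \<forall>pre post. length pre = n \<longrightarrow> (\<exists>t\<le>T c. eval (pre @ gs @ post) (\<rho> c) e (F c) t))"
    unfolding run_def by (elim conjE allE[of _ n])
  then obtain gs e T where "poly_bounded I N T"
    "\<forall>c\<in>I. \<forall>pre post. length pre = n \<longrightarrow> (\<exists>t\<le>T c. eval (pre @ gs @ post) (\<rho> c) e (F c) t)"
    by (elim exE conjE)
  then show thesis by (intro that[of T gs e]) simp_all
qed

lemma run_size: "run I N \<rho> F \<Longrightarrow> poly_bounded I N (\<lambda>c. val_size (F c))"
  unfolding run_def by (elim conjE)

lemma runsE:
  assumes "runs I N \<rho> F"
  obtains gs e T where "poly_bounded I N T"
    "\<And>c pre post. c \<in> I \<Longrightarrow> length pre = n \<Longrightarrow> \<exists>t\<le>T c. evals (pre @ gs @ post) (\<rho> c) e (F c) t"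
proof -
  from assms have "\<exists>gs e T. poly_bounded I N T \<and>
        (\<forall>c\<in>I. \<forall>pre post. length pre = n \<longrightarrow> (\<exists>t\<le>T c. evals (pre @ gs @ post) (\<rho> c) e (F c) t))"
    unfolding runs_def by (elim conjE allE[of _ n])
  then obtain gs e T where "poly_bounded I N T"
    "\<forall>c\<in>I. \<forall>pre post. length pre = n \<longrightarrow> (\<exists>t\<le>T c. evals (pre @ gs @ post) (\<rho> c) e (F c) t)"
    by (elim exE conjE)
  then show thesis by (intro that[of T gs e]) simp_all
qed

lemma run_reindex:
  assumes "run I N \<rho> F" "\<And>c. c \<in> J \<Longrightarrow> h c \<in> I \<and> N (h c) = M c"
  shows "run J M (\<lambda>c. \<rho> (h c)) (\<lambda>c. F (h c))"
proof (rule runI)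
  show "poly_bounded J M (\<lambda>c. val_size (F (h c)))"
    by (rule poly_bounded_reindex[OF run_size[OF assms(1)] assms(2)])
  fix n
  obtain gs e T where T: "poly_bounded I N T"
    "\<And>c pre post. c \<in> I \<Longrightarrow> length pre = n \<Longrightarrow> \<exists>t\<le>T c. eval (pre @ gs @ post) (\<rho> c) e (F c) t"
    by (rule runE[OF assms(1), where n = "n"]) (rule that)
  show "\<exists>gs e T. poly_bounded J M T \<and>
        (\<forall>c\<in>J. \<forall>pre post. length pre = n \<longrightarrow> (\<exists>t\<le>T c. eval (pre @ gs @ post) (\<rho> (h c)) e (F (h c)) t))"
    by (rule exI[of _ gs], rule exI[of _ e], rule exI[of _ "\<lambda>c. T (h c)"])
       (use T(2) assms(2) poly_bounded_reindex[OF T(1) assms(2)] in simp)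
qed

lemma run_subset: "run I N \<rho> F \<Longrightarrow> J \<subseteq> I \<Longrightarrow> run J N \<rho> F"
  by (rule run_reindex[of I N \<rho> F J "\<lambda>c. c" N]) auto

lemma run_cong:
  assumes "run I N \<rho> F" "\<And>c. c \<in> I \<Longrightarrow> \<rho> c = \<rho>' c" "\<And>c. c \<in> I \<Longrightarrow> F c = F' c"
  shows "run I N \<rho>' F'"
proof -
  have 1: "(\<forall>c\<in>I. Q c (\<rho>' c) (F' c)) = (\<forall>c\<in>I. Q c (\<rho> c) (F c))" for Q
    using assms(2,3) by (intro ball_cong) auto
  show ?thesis
    using assms(1) unfolding run_def poly_bounded_def
    unfolding 1[of "\<lambda>c _ v. val_size v \<le> (N c + 2) ^ _"]
      1[of "\<lambda>c r v. \<forall>pre post. length pre = _ \<longrightarrow> (\<exists>t\<le>_ c. eval (pre @ _ @ post) r _ v t)"] .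
qed

lemma runs_Nil: "runs I N \<rho> (\<lambda>_. [])"
  unfolding runs_def
  by (intro conjI allI env_ok_Nil exI[of _ "[]"] exI[of _ "\<lambda>_. 0"])
     (auto intro: poly_bounded_const eval_evals.Nil)

lemma runs_Cons:
  assumes "run I N \<rho> F" "runs I N \<rho> vs"
  shows "runs I N \<rho> (\<lambda>c. F c # vs c)"
  unfolding runs_def
proof (intro conjI allI)
  show "env_ok I N (\<lambda>c. F c # vs c)"
    using assms(2) by (intro env_ok_Cons run_size[OF assms(1)]) (simp add: runs_def)
  fix n
  obtain gs e T where 1: "poly_bounded I N T"
    "\<And>c pre post. c \<in> I \<Longrightarrow> length pre = n \<Longrightarrow> \<exists>t\<le>T c. eval (pre @ gs @ post) (\<rho> c) e (F c) t"
    by (rule runE[OF assms(1), where n = "n"]) (rule that)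
  obtain gs' es T' where 2: "poly_bounded I N T'"
    "\<And>c pre post. c \<in> I \<Longrightarrow> length pre = n + length gs \<Longrightarrow> \<exists>t\<le>T' c. evals (pre @ gs' @ post) (\<rho> c) es (vs c) t"
    by (rule runsE[OF assms(2), where n = "n + length gs"]) (rule that)
  have "\<exists>t\<le>T c + T' c. evals (pre @ (gs @ gs') @ post) (\<rho> c) (e # es) (F c # vs c) t"
    if c: "c \<in> I" and pre: "length pre = n" for c pre post
  proof -
    obtain t where t: "t \<le> T c" "eval (pre @ (gs @ gs') @ post) (\<rho> c) e (F c) t"
      using 1(2)[OF c pre, of "gs' @ post"] by auto
    obtain t' where t': "t' \<le> T' c" "evals (pre @ (gs @ gs') @ post) (\<rho> c) es (vs c) t'"
      using 2(2)[OF c, of "pre @ gs" post] pre by auto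
    show ?thesis
      by (rule exI[of _ "t + t'"]) (use t t' in \<open>auto intro: eval_evals.Cons\<close>)
  qed
  then show "\<exists>gs es T. poly_bounded I N T \<and>
        (\<forall>c\<in>I. \<forall>pre post. length pre = n \<longrightarrow> (\<exists>t\<le>T c. evals (pre @ gs @ post) (\<rho> c) es (F c # vs c) t))"
    by (intro exI[of _ "gs @ gs'"] exI[of _ "e # es"] exI[of _ "\<lambda>c. T c + T' c"] conjI
          poly_bounded_add[OF 1(1) 2(1)]) simp
qed

text \<open>A call evaluates the body in the environment of the argument values only. This makes it the tool for
  discarding, reordering and binding variables.\<close>

lemma run_call:
  assumes "runs I N \<rho> vs" "run I N vs F"
  shows "run I N \<rho> F"
proof (rule runI)
  show "poly_bounded I N (\<lambda>c. val_size (F c))" by (rule run_size[OF assms(2)])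
  fix n
  obtain gs es T where 1: "poly_bounded I N T"
    "\<And>c pre post. c \<in> I \<Longrightarrow> length pre = n \<Longrightarrow> \<exists>t\<le>T c. evals (pre @ gs @ post) (\<rho> c) es (vs c) t"
    by (rule runsE[OF assms(1), where n = "n"]) (rule that)
  obtain gs' e T' where 2: "poly_bounded I N T'"
    "\<And>c pre post. c \<in> I \<Longrightarrow> length pre = n + length gs + 1 \<Longrightarrow>
        \<exists>t\<le>T' c. eval (pre @ gs' @ post) (vs c) e (F c) t"
    by (rule runE[OF assms(2), where n = "n + length gs + 1"]) (rule that)
  let ?gs = "gs @ [e] @ gs'"
  let ?e = "Call (n + length gs) es"
  have "\<exists>t\<le>T c + T' c + 1. eval (pre @ ?gs @ post) (\<rho> c) ?e (F c) t"
    if c: "c \<in> I" and pre: "length pre = n" for c pre post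
  proof -
    obtain t where t: "t \<le> T c" "evals (pre @ ?gs @ post) (\<rho> c) es (vs c) t"
      using 1(2)[OF c pre, of "[e] @ gs' @ post"] by auto
    obtain t' where t': "t' \<le> T' c" "eval (pre @ ?gs @ post) (vs c) e (F c) t'"
      using 2(2)[OF c, of "pre @ gs @ [e]" post] pre by auto
    have "eval (pre @ ?gs @ post) (\<rho> c) ?e (F c) (t + t' + 1)"
      by (rule eval_evals.Call[OF _ t(2)]) (use t' pre in \<open>auto simp: nth_append\<close>)
    then show ?thesis using t t' by (intro exI[of _ "t + t' + 1"]) auto
  qed
  moreover have "poly_bounded I N (\<lambda>c. T c + T' c + 1)"
    by (intro poly_bounded_rules 1 2)
  ultimately show "\<exists>gs e T. poly_bounded I N T \<and>
        (\<forall>c\<in>I. \<forall>pre post. length pre = n \<longrightarrow> (\<exists>t\<le>T c. eval (pre @ gs @ post) (\<rho> c) e (F c) t))"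
    by (intro exI[of _ ?gs] exI[of _ ?e] exI[of _ "\<lambda>c. T c + T' c + 1"]) simp
qed

lemma evals_vars_drop:
  "n \<le> length \<rho> \<Longrightarrow> evals fs \<rho> (map Var [n..<length \<rho>]) (drop n \<rho>) (length \<rho> - n)"
proof (induction n rule: inc_induct)
  case base
  then show ?case by (simp add: eval_evals.Nil)
next
  case (step n)
  have "evals fs \<rho> (Var n # map Var [Suc n..<length \<rho>]) (\<rho> ! n # drop (Suc n) \<rho>) (1 + (length \<rho> - Suc n))"
    by (intro eval_evals.Cons eval_evals.Var step)
  with step(2) show ?case by (simp add: upt_conv_Cons Cons_nth_drop_Suc Suc_diff_Suc)
qed

lemma evals_vars: "length \<rho> = m \<Longrightarrow> evals fs \<rho> (map Var [0..<m]) \<rho> m"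
  using evals_vars_drop[of 0 \<rho> fs] by simp

lemma runs_id:
  assumes "env_ok I N \<rho>"
  shows "runs I N \<rho> \<rho>"
proof -
  obtain m where m: "\<forall>c\<in>I. length (\<rho> c) = m" using assms unfolding env_ok_def by blast
  show ?thesis
    unfolding runs_def using m evals_vars
    by (intro conjI assms allI exI[of _ "[]"] exI[of _ "map Var [0..<m]"] exI[of _ "\<lambda>_. m"])
       (auto intro: poly_bounded_const)
qed

text \<open>Every recursive function of the program has this form: test \<open>p\<close>; if it holds, return a value that
  needs no recursion; otherwise call the function once on the environment of the next context \<open>nx c\<close> and
  finish from its result. The measure \<open>\<mu>\<close> bounds the depth, so polynomial depth and polynomial cost per
  call give polynomial cost. The bound on \<open>r\<close> cannot be derived: repeated squaring has the same form.\<close>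

lemma run_rec:
  assumes ok: "env_ok I N \<rho>"
    and p: "run I N \<rho> (\<lambda>c. Num (of_bool (p c)))"
    and base: "run {c \<in> I. p c} N \<rho> r"
    and args: "runs {c \<in> I. \<not> p c} N \<rho> (\<lambda>c. \<rho> (nx c))"
    and step: "run {c \<in> I. \<not> p c} N (\<lambda>c. r (nx c) # \<rho> c) r"
    and nx: "\<And>c. c \<in> I \<Longrightarrow> \<not> p c \<Longrightarrow> nx c \<in> I \<and> N (nx c) = N c \<and> \<mu> (nx c) < \<mu> c"
    and \<mu>: "poly_bounded I N \<mu>"
    and r: "poly_bounded I N (\<lambda>c. val_size (r c))"
  shows "run I N \<rho> r"
proof (rule runI[OF r])
  fix n
  obtain m where m: "\<And>c. c \<in> I \<Longrightarrow> length (\<rho> c) = m" using ok unfolding env_ok_def by blast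
  let ?P = "{c \<in> I. p c}" and ?Q = "{c \<in> I. \<not> p c}"
  obtain gp ep Tp where 1: "poly_bounded I N Tp"
    "\<And>c pre post. c \<in> I \<Longrightarrow> length pre = n + 1 \<Longrightarrow>
      \<exists>t\<le>Tp c. eval (pre @ gp @ post) (\<rho> c) ep (Num (of_bool (p c))) t"
    by (rule runE[OF p, where n = "n + 1"]) (rule that)
  obtain gb eb Tb where 2: "poly_bounded ?P N Tb"
    "\<And>c pre post. c \<in> ?P \<Longrightarrow> length pre = n + 1 + length gp \<Longrightarrow>
      \<exists>t\<le>Tb c. eval (pre @ gb @ post) (\<rho> c) eb (r c) t"
    by (rule runE[OF base, where n = "n + 1 + length gp"]) (rule that)
  obtain ga ea Ta where 3: "poly_bounded ?Q N Ta"
    "\<And>c pre post. c \<in> ?Q \<Longrightarrow> length pre = n + 1 + length gp + length gb \<Longrightarrow>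
      \<exists>t\<le>Ta c. evals (pre @ ga @ post) (\<rho> c) ea (\<rho> (nx c)) t"
    by (rule runsE[OF args, where n = "n + 1 + length gp + length gb"]) (rule that)
  obtain gs es Ts where 4: "poly_bounded ?Q N Ts"
    "\<And>c pre post. c \<in> ?Q \<Longrightarrow> length pre = n + 1 + length gp + length gb + length ga \<Longrightarrow>
      \<exists>t\<le>Ts c. eval (pre @ gs @ post) (r (nx c) # \<rho> c) es (r c) t"
    by (rule runE[OF step, where n = "n + 1 + length gp + length gb + length ga"]) (rule that)
  obtain k1 k2 k3 k4 where k: "\<And>c. c \<in> I \<Longrightarrow> Tp c \<le> (N c + 2) ^ k1"
    "\<And>c. c \<in> ?P \<Longrightarrow> Tb c \<le> (N c + 2) ^ k2"
    "\<And>c. c \<in> ?Q \<Longrightarrow> Ta c \<le> (N c + 2) ^ k3"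
    "\<And>c. c \<in> ?Q \<Longrightarrow> Ts c \<le> (N c + 2) ^ k4"
    using 1(1) 2(1) 3(1) 4(1) unfolding poly_bounded_def by (elim exE) (rule that; blast)
  define u where "u x = (x + 2) ^ k1 + (x + 2) ^ k2 + (x + 2) ^ k3 + (x + 2) ^ k4 + (3::nat)" for x
  define body where "body = Cond ep eb (LetIn (Call n ea) es)"
  let ?gs = "[body] @ gp @ gb @ ga @ gs"
  let ?e = "Call n (map Var [0..<m])"
  have body: "\<exists>t\<le>(\<mu> c + 1) * u (N c). eval (pre @ ?gs @ post) (\<rho> c) body (r c) t"
    if c: "c \<in> I" and pre: "length pre = n" for c pre post
    using c
  proof (induction "\<mu> c" arbitrary: c rule: less_induct)
    case less
    let ?fs = "pre @ ?gs @ post"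
    obtain tp where tp: "tp \<le> Tp c" "eval ?fs (\<rho> c) ep (Num (of_bool (p c))) tp"
      using 1(2)[OF less.prems, of "pre @ [body]" "gb @ ga @ gs @ post"] pre by auto
    show ?case
    proof (cases "p c")
      case True
      then have c: "c \<in> ?P" using less.prems by simp
      obtain tb where tb: "tb \<le> Tb c" "eval ?fs (\<rho> c) eb (r c) tb"
        using 2(2)[OF c, of "pre @ [body] @ gp" "ga @ gs @ post"] pre by auto
      have "eval ?fs (\<rho> c) body (r c) (tp + tb + 1)"
        using eval_evals.Cond_True[OF tp(2) _ tb(2)] True by (simp add: body_def)
      moreover have "tp + tb + 1 \<le> u (N c)"
        using tp(1) tb(1) k(1)[OF less.prems] k(2)[OF c] by (simp add: u_def)
      then have "tp + tb + 1 \<le> (\<mu> c + 1) * u (N c)" by simp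
      ultimately show ?thesis by blast
    next
      case False
      then have c: "c \<in> ?Q" using less.prems by simp
      note nx = nx[OF less.prems False]
      obtain ta where ta: "ta \<le> Ta c" "evals ?fs (\<rho> c) ea (\<rho> (nx c)) ta"
        using 3(2)[OF c, of "pre @ [body] @ gp @ gb" "gs @ post"] pre by auto
      obtain ts where ts: "ts \<le> Ts c" "eval ?fs (r (nx c) # \<rho> c) es (r c) ts"
        using 4(2)[OF c, of "pre @ [body] @ gp @ gb @ ga" "post"] pre by auto
      obtain tr where tr: "tr \<le> (\<mu> (nx c) + 1) * u (N (nx c))" "eval ?fs (\<rho> (nx c)) body (r (nx c)) tr"
        using less.hyps[of "nx c"] nx by blast
      have "eval ?fs (\<rho> c) (Call n ea) (r (nx c)) (ta + tr + 1)"
        by (rule eval_evals.Call[OF _ ta(2)]) (use tr pre in \<open>auto simp: nth_append\<close>)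
      then have "eval ?fs (\<rho> c) (LetIn (Call n ea) es) (r c) (ta + tr + 1 + ts + 1)"
        by (rule eval_evals.LetIn[OF _ ts(2)])
      moreover have "eval ?fs (\<rho> c) ep (Num 0) tp" using tp(2) False by simp
      ultimately have "eval ?fs (\<rho> c) (Cond ep eb (LetIn (Call n ea) es)) (r c)
          (tp + (ta + tr + 1 + ts + 1) + 1)"
        by (intro eval_evals.Cond_False)
      then have "eval ?fs (\<rho> c) body (r c) (tp + (ta + tr + 1 + ts + 1) + 1)"
        by (simp only: body_def)
      moreover have "tr \<le> \<mu> c * u (N c)"
        using tr(1) nx mult_le_mono1[of "\<mu> (nx c) + 1" "\<mu> c" "u (N c)"] by simp
      then have "tp + (ta + tr + 1 + ts + 1) + 1 \<le> (\<mu> c + 1) * u (N c)"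
        using tp(1) ta(1) ts(1) k(1)[OF less.prems] k(3)[OF c] k(4)[OF c] by (simp add: u_def)
      ultimately show ?thesis by blast
    qed
  qed
  have "\<exists>t\<le>m + (\<mu> c + 1) * u (N c) + 1. eval (pre @ ?gs @ post) (\<rho> c) ?e (r c) t"
    if c: "c \<in> I" and pre: "length pre = n" for c pre post
  proof -
    obtain t where t: "t \<le> (\<mu> c + 1) * u (N c)" "eval (pre @ ?gs @ post) (\<rho> c) body (r c) t"
      using body[OF c pre] by blast
    have "eval (pre @ ?gs @ post) (\<rho> c) ?e (r c) (m + t + 1)"
      by (rule eval_evals.Call[OF _ evals_vars[OF m[OF c]]]) (use t pre in \<open>auto simp: nth_append\<close>)
    then show ?thesis using t(1) by (intro exI[of _ "m + t + 1"]) auto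
  qed
  moreover have pb: "poly_bounded I N (\<lambda>c. (N c + 2) ^ k)" for k
    unfolding poly_bounded_def by (rule exI[of _ k]) simp
  have "poly_bounded I N (\<lambda>c. m + (\<mu> c + 1) * u (N c) + 1)"
    unfolding u_def by (intro poly_bounded_rules \<mu> pb)
  ultimately show "\<exists>gs e T. poly_bounded I N T \<and>
        (\<forall>c\<in>I. \<forall>pre post. length pre = n \<longrightarrow> (\<exists>t\<le>T c. eval (pre @ gs @ post) (\<rho> c) e (r c) t))"
    by (intro exI[of _ ?gs] exI[of _ ?e] exI[of _ "\<lambda>c. m + (\<mu> c + 1) * u (N c) + 1"]) simp
qed


section \<open>Running expressions in polynomial time\<close>

lemma run_op1:
  assumes F: "run I N \<rho> F"
    and op: "\<And>fs c e t. c \<in> I \<Longrightarrow> eval fs (\<rho> c) e (F c) t \<Longrightarrow> eval fs (\<rho> c) (g e) (G c) (t + 1)"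
    and size: "poly_bounded I N (\<lambda>c. val_size (G c))"
  shows "run I N \<rho> G"
proof (rule runI[OF size])
  fix n
  obtain gs e T where 1: "poly_bounded I N T"
    "\<And>c pre post. c \<in> I \<Longrightarrow> length pre = n \<Longrightarrow> \<exists>t\<le>T c. eval (pre @ gs @ post) (\<rho> c) e (F c) t"
    by (rule runE[OF F, where n = n]) (rule that)
  have "\<exists>t\<le>T c + 1. eval (pre @ gs @ post) (\<rho> c) (g e) (G c) t"
    if c: "c \<in> I" and pre: "length pre = n" for c pre post
  proof -
    obtain t where "t \<le> T c" "eval (pre @ gs @ post) (\<rho> c) e (F c) t"
      using 1(2)[OF c pre] by blast
    then show ?thesis by (intro exI[of _ "t + 1"]) (simp add: op[OF c, simplified])
  qed
  moreover have "poly_bounded I N (\<lambda>c. T c + 1)" by (intro poly_bounded_rules 1)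
  ultimately show "\<exists>gs e T. poly_bounded I N T \<and>
        (\<forall>c\<in>I. \<forall>pre post. length pre = n \<longrightarrow> (\<exists>t\<le>T c. eval (pre @ gs @ post) (\<rho> c) e (G c) t))"
    by (intro exI[of _ gs] exI[of _ "g e"] exI[of _ "\<lambda>c. T c + 1"]) simp
qed

lemma run_op2:
  assumes F1: "run I N \<rho> F1" and F2: "run I N \<rho> F2"
    and op: "\<And>fs c e1 t1 e2 t2. c \<in> I \<Longrightarrow> eval fs (\<rho> c) e1 (F1 c) t1 \<Longrightarrow> eval fs (\<rho> c) e2 (F2 c) t2 \<Longrightarrow>
      eval fs (\<rho> c) (g e1 e2) (G c) (t1 + t2 + U c)"
    and U: "poly_bounded I N U"
    and size: "poly_bounded I N (\<lambda>c. val_size (G c))"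
  shows "run I N \<rho> G"
proof (rule runI[OF size])
  fix n
  obtain gs e T where 1: "poly_bounded I N T"
    "\<And>c pre post. c \<in> I \<Longrightarrow> length pre = n \<Longrightarrow> \<exists>t\<le>T c. eval (pre @ gs @ post) (\<rho> c) e (F1 c) t"
    by (rule runE[OF F1, where n = n]) (rule that)
  obtain gs' e' T' where 2: "poly_bounded I N T'"
    "\<And>c pre post. c \<in> I \<Longrightarrow> length pre = n + length gs \<Longrightarrow>
      \<exists>t\<le>T' c. eval (pre @ gs' @ post) (\<rho> c) e' (F2 c) t"
    by (rule runE[OF F2, where n = "n + length gs"]) (rule that)
  have "\<exists>t\<le>T c + T' c + U c. eval (pre @ (gs @ gs') @ post) (\<rho> c) (g e e') (G c) t"
    if c: "c \<in> I" and pre: "length pre = n" for c pre post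
  proof -
    obtain t where t: "t \<le> T c" "eval (pre @ (gs @ gs') @ post) (\<rho> c) e (F1 c) t"
      using 1(2)[OF c pre, of "gs' @ post"] by auto
    obtain t' where t': "t' \<le> T' c" "eval (pre @ (gs @ gs') @ post) (\<rho> c) e' (F2 c) t'"
      using 2(2)[OF c, of "pre @ gs" post] pre by auto
    show ?thesis
      by (rule exI[of _ "t + t' + U c"]) (use t t' op[OF c t(2) t'(2)] in simp)
  qed
  moreover have "poly_bounded I N (\<lambda>c. T c + T' c + U c)" by (intro poly_bounded_rules 1 2 U)
  ultimately show "\<exists>gs e T. poly_bounded I N T \<and>
        (\<forall>c\<in>I. \<forall>pre post. length pre = n \<longrightarrow> (\<exists>t\<le>T c. eval (pre @ gs @ post) (\<rho> c) e (G c) t))"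
    by (intro exI[of _ "gs @ gs'"] exI[of _ "g e e'"] exI[of _ "\<lambda>c. T c + T' c + U c"]) simp
qed

lemma run_Lit: "run I N \<rho> (\<lambda>_. Num i)"
proof (rule runI)
  show "\<exists>gs e T. poly_bounded I N T \<and>
        (\<forall>c\<in>I. \<forall>pre post. length pre = n \<longrightarrow> (\<exists>t\<le>T c. eval (pre @ gs @ post) (\<rho> c) e (Num i) t))" for n
    by (rule exI[of _ "[]"], rule exI[of _ "Lit i"], rule exI[of _ "\<lambda>_. 1"])
       (intro conjI ballI allI impI exI[of _ 1] poly_bounded_const eval_evals.Lit; simp)
qed (rule poly_bounded_const)

lemma env_ok_nth:
  assumes "env_ok I N \<rho>" "\<And>c. c \<in> I \<Longrightarrow> n < length (\<rho> c)"
  shows "poly_bounded I N (\<lambda>c. val_size (\<rho> c ! n))"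
proof -
  have b: "poly_bounded I N (\<lambda>c. sum_list (map val_size (\<rho> c)))"
    using assms(1) unfolding env_ok_def by blast
  show ?thesis
    by (rule poly_bounded_mono[OF b order_refl]) (use assms(2) in \<open>auto intro!: member_le_sum_list\<close>)
qed

lemma run_nth:
  assumes ok: "env_ok I N \<rho>" and n: "\<And>c. c \<in> I \<Longrightarrow> n < length (\<rho> c)"
  shows "run I N \<rho> (\<lambda>c. \<rho> c ! n)"
proof (rule runI[OF env_ok_nth[OF ok n]])
  show "\<exists>gs e T. poly_bounded I N T \<and>
        (\<forall>c\<in>I. \<forall>pre post. length pre = m \<longrightarrow> (\<exists>t\<le>T c. eval (pre @ gs @ post) (\<rho> c) e (\<rho> c ! n) t))" for m
    by (rule exI[of _ "[]"], rule exI[of _ "Var n"], rule exI[of _ "\<lambda>_. 1"])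
       (intro conjI ballI allI impI exI[of _ 1] poly_bounded_const eval_evals.Var n; simp)
qed

lemma bitlen_mono: "0 \<le> a \<Longrightarrow> a \<le> b \<Longrightarrow> bitlen a \<le> bitlen b"
  by (simp add: bitlen_def floorlog_mono nat_mono)

lemma int_bits_mono: "\<bar>i\<bar> \<le> \<bar>j\<bar> \<Longrightarrow> int_bits i \<le> int_bits j"
  unfolding int_bits_def by (simp add: bitlen_mono nat_mono)

lemma abs_less_two_power_int_bits: "\<bar>i\<bar> < 2 ^ (int_bits i - 1)"
  using bitlen_bounds[of "\<bar>i\<bar>"] by (cases "i = 0") (auto simp: int_bits_def)

lemma int_bits_le: "\<bar>i\<bar> < 2 ^ n \<Longrightarrow> int_bits i \<le> n + 1"
  unfolding int_bits_def using bitlen_le_iff_power[of "\<bar>i\<bar>" n] by (simp add: nat_le_iff)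

lemma int_bits_pos: "1 \<le> int_bits i"
  by (simp add: int_bits_def)

lemma abs_div_le: "\<bar>i div j\<bar> \<le> \<bar>i :: int\<bar>"
proof -
  have pos: "\<bar>i div j\<bar> \<le> \<bar>i\<bar>" if "0 < j" for i j :: int
  proof (cases "0 \<le> i")
    case True
    then have "i div j \<le> i div 1" "0 \<le> i div j"
      using zdiv_mono2[of i 1 j] that by (simp_all add: pos_imp_zdiv_nonneg_iff)
    then show ?thesis using True by simp
  next
    case False
    then have "i div 1 \<le> i div j" "i div j < 0"
      using zdiv_mono2_neg[of i 1 j] that by (simp_all add: pos_imp_zdiv_neg_iff)
    then show ?thesis using False by simp
  qed
  consider "0 < j" | "j = 0" | "j < 0" by linarith
  then show ?thesis
    by cases (use pos[of j i] pos[of "- j" "- i"] in auto)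
qed

lemma abs_mod_le: "\<bar>i mod j\<bar> \<le> \<bar>i\<bar> + \<bar>j :: int\<bar>"
proof -
  consider "0 < j" | "j = 0" | "j < 0" by linarith
  then show ?thesis
  proof cases
    case 1
    then show ?thesis using pos_mod_bound[of j i] pos_mod_sign[of j i] by linarith
  next
    case 3
    then show ?thesis using neg_mod_bound[of j i] neg_mod_sign[of j i] by linarith
  qed simp
qed

lemma int_bits_arith_op: "int_bits (arith_op f i j) \<le> int_bits i + int_bits j + 1"
proof -
  define a b where "a = int_bits i - 1" and "b = int_bits j - 1"
  define A B :: int where "A = 2 ^ a" and "B = 2 ^ b"
  have i: "\<bar>i\<bar> < A" and j: "\<bar>j\<bar> < B"
    unfolding a_def b_def A_def B_def by (rule abs_less_two_power_int_bits)+
  have AB: "1 \<le> A" "1 \<le> B" by (simp_all add: A_def B_def)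
  have le: "A \<le> A * B" "B \<le> A * B" using AB by simp_all
  have mul: "\<bar>i * j\<bar> < A * B" unfolding abs_mult by (intro mult_strict_mono i j) (use AB in auto)
  define P where "P = A * B"
  have "1 \<le> P" using le AB unfolding P_def by linarith
  then have P: "1 \<le> P" "A \<le> P" "B \<le> P" "\<bar>i * j\<bar> < P" using le mul by (simp_all add: P_def)
  have "\<bar>arith_op f i j\<bar> \<le> \<bar>i\<bar> + \<bar>j\<bar> \<or> \<bar>arith_op f i j\<bar> \<le> \<bar>i * j\<bar> \<or> \<bar>arith_op f i j\<bar> \<le> 1"
    using abs_triangle_ineq[of i j] abs_triangle_ineq4[of i j] abs_mod_le[of i j]
      order_trans[OF abs_div_le[of i j], of "\<bar>i\<bar> + \<bar>j\<bar>"]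
    by (cases f) (simp_all only: arith_op.simps, simp_all)
  then have "\<bar>arith_op f i j\<bar> < 2 * P"
    using i j P by linarith
  also have "\<dots> = 2 ^ (a + b + 1)" by (simp add: P_def A_def B_def power_add)
  finally have "int_bits (arith_op f i j) \<le> a + b + 1 + 1" by (rule int_bits_le)
  then show ?thesis unfolding a_def b_def using int_bits_pos[of i] int_bits_pos[of j] by simp
qed

lemma run_arith:
  assumes f: "run I N \<rho> (\<lambda>c. Num (f c))" and g: "run I N \<rho> (\<lambda>c. Num (g c))"
  shows "run I N \<rho> (\<lambda>c. Num (arith_op op (f c) (g c)))"
proof (rule run_op2[OF f g, where U = "\<lambda>c. int_bits (f c) + int_bits (g c)"])
  have b: "poly_bounded I N (\<lambda>c. int_bits (f c))" "poly_bounded I N (\<lambda>c. int_bits (g c))"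
    using run_size[OF f] run_size[OF g] by simp_all
  then show "poly_bounded I N (\<lambda>c. int_bits (f c) + int_bits (g c))" by (intro poly_bounded_rules)
  have "poly_bounded I N (\<lambda>c. int_bits (f c) + int_bits (g c) + 1)" by (intro poly_bounded_rules b)
  then show "poly_bounded I N (\<lambda>c. val_size (Num (arith_op op (f c) (g c))))"
    by (rule poly_bounded_mono) (use int_bits_arith_op in auto)
  show "eval fs (\<rho> c) (Arith op e1 e2) (Num (arith_op op (f c) (g c)))
      (t1 + t2 + (int_bits (f c) + int_bits (g c)))"
    if "eval fs (\<rho> c) e1 (Num (f c)) t1" "eval fs (\<rho> c) e2 (Num (g c)) t2" for fs c e1 t1 e2 t2
    using eval_evals.Arith[OF that] by (simp add: add.assoc)
qed

lemma run_Cell: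
  assumes f: "run I N \<rho> F" and g: "run I N \<rho> G"
  shows "run I N \<rho> (\<lambda>c. Cell (F c) (G c))"
proof (rule run_op2[OF f g, where g = MkCell and U = "\<lambda>_. 1"])
  have "poly_bounded I N (\<lambda>c. 1 + val_size (F c) + val_size (G c))"
    by (intro poly_bounded_rules run_size[OF f] run_size[OF g])
  then show "poly_bounded I N (\<lambda>c. val_size (Cell (F c) (G c)))" by simp
qed (rule eval_evals.MkCell poly_bounded_const; assumption?)+

lemma run_First:
  assumes f: "run I N \<rho> (\<lambda>c. Cell (F c) (G c))"
  shows "run I N \<rho> F"
  by (rule run_op1[OF f, where g = First], rule eval_evals.First, assumption,
      rule poly_bounded_mono[OF run_size[OF f] order_refl]) simp

lemma run_Second:
  assumes f: "run I N \<rho> (\<lambda>c. Cell (F c) (G c))"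
  shows "run I N \<rho> G"
  by (rule run_op1[OF f, where g = Second], rule eval_evals.Second, assumption,
      rule poly_bounded_mono[OF run_size[OF f] order_refl]) simp

lemma enc_list_simps [simp]:
  "enc_list g [] = Num 0"
  "enc_list g (x # xs) = Cell (g x) (enc_list g xs)"
  by (simp_all add: enc_list_def)

lemma run_nonempty:
  assumes f: "run I N \<rho> (\<lambda>c. enc_list g (xs c))"
  shows "run I N \<rho> (\<lambda>c. Num (of_bool (xs c \<noteq> [])))"
proof (rule run_op1[OF f, where g = IsCell])
  show "eval fs (\<rho> c) (IsCell e) (Num (of_bool (xs c \<noteq> []))) (t + 1)"
    if "eval fs (\<rho> c) e (enc_list g (xs c)) t" for fs c e t
    using that by (cases "xs c") (auto simp del: One_nat_def add_Suc_right
        intro: eval_evals.IsCell_True eval_evals.IsCell_False)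
  show "poly_bounded I N (\<lambda>c. val_size (Num (of_bool (xs c \<noteq> []))))"
    by (rule poly_bounded_mono[OF poly_bounded_const[of I N "int_bits 1"] order_refl])
       (simp add: int_bits_mono)
qed

text \<open>Each branch need be polynomial only on the contexts that take it.\<close>

lemma run_if:
  assumes b: "run I N \<rho> (\<lambda>c. Num (of_bool (b c)))"
    and F: "run {c \<in> I. b c} N \<rho> F" and G: "run {c \<in> I. \<not> b c} N \<rho> G"
  shows "run I N \<rho> (\<lambda>c. if b c then F c else G c)"
proof (rule runI)
  let ?H = "\<lambda>c. if b c then F c else G c"
  have join: "poly_bounded I N (\<lambda>c. if b c then S c else T c)"
    if ST: "poly_bounded {c \<in> I. b c} N S" "poly_bounded {c \<in> I. \<not> b c} N T" for S T
  proof -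
    obtain k l where "\<forall>c\<in>{c \<in> I. b c}. S c \<le> (N c + 2) ^ k"
      "\<forall>c\<in>{c \<in> I. \<not> b c}. T c \<le> (N c + 2) ^ l"
      using ST unfolding poly_bounded_def by blast
    then have 1: "\<forall>c\<in>I. (if b c then S c else T c) \<le> (N c + 2) ^ k + (N c + 2) ^ l"
      by (auto intro: le_trans[OF _ le_add1] le_trans[OF _ le_add2])
    have pb: "poly_bounded I N (\<lambda>c. (N c + 2) ^ m)" for m
      unfolding poly_bounded_def by (rule exI[of _ m]) simp
    show ?thesis
      by (rule poly_bounded_mono[OF poly_bounded_add[OF pb[of k] pb[of l]] order_refl])
         (use 1 in blast)
  qed
  show "poly_bounded I N (\<lambda>c. val_size (?H c))"
    using join[OF run_size[OF F] run_size[OF G]] by (simp only: if_distrib)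
  fix n
  obtain gp ep Tp where 1: "poly_bounded I N Tp"
    "\<And>c pre post. c \<in> I \<Longrightarrow> length pre = n \<Longrightarrow>
      \<exists>t\<le>Tp c. eval (pre @ gp @ post) (\<rho> c) ep (Num (of_bool (b c))) t"
    by (rule runE[OF b, where n = n]) (rule that)
  obtain g1 e1 T1 where 2: "poly_bounded {c \<in> I. b c} N T1"
    "\<And>c pre post. c \<in> {c \<in> I. b c} \<Longrightarrow> length pre = n + length gp \<Longrightarrow>
      \<exists>t\<le>T1 c. eval (pre @ g1 @ post) (\<rho> c) e1 (F c) t"
    by (rule runE[OF F, where n = "n + length gp"]) (rule that)
  obtain g2 e2 T2 where 3: "poly_bounded {c \<in> I. \<not> b c} N T2"
    "\<And>c pre post. c \<in> {c \<in> I. \<not> b c} \<Longrightarrow> length pre = n + length gp + length g1 \<Longrightarrow>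
      \<exists>t\<le>T2 c. eval (pre @ g2 @ post) (\<rho> c) e2 (G c) t"
    by (rule runE[OF G, where n = "n + length gp + length g1"]) (rule that)
  let ?T = "\<lambda>c. Tp c + (if b c then T1 c else T2 c) + 1"
  let ?gs = "gp @ g1 @ g2"
  have "\<exists>t\<le>?T c. eval (pre @ ?gs @ post) (\<rho> c) (Cond ep e1 e2) (?H c) t"
    if c: "c \<in> I" and pre: "length pre = n" for c pre post
  proof -
    obtain tp where tp: "tp \<le> Tp c" "eval (pre @ ?gs @ post) (\<rho> c) ep (Num (of_bool (b c))) tp"
      using 1(2)[OF c pre, of "g1 @ g2 @ post"] by auto
    show ?thesis
    proof (cases "b c")
      case True
      then obtain t where t: "t \<le> T1 c" "eval (pre @ ?gs @ post) (\<rho> c) e1 (F c) t"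
        using 2(2)[of c "pre @ gp" "g2 @ post"] pre c by auto
      show ?thesis using True tp t eval_evals.Cond_True[OF tp(2) _ t(2)]
        by (intro exI[of _ "tp + t + 1"]) auto
    next
      case False
      then obtain t where t: "t \<le> T2 c" "eval (pre @ ?gs @ post) (\<rho> c) e2 (G c) t"
        using 3(2)[of c "pre @ gp @ g1" "post"] pre c by auto
      have "eval (pre @ ?gs @ post) (\<rho> c) ep (Num 0) tp" using False tp by simp
      from eval_evals.Cond_False[OF this t(2)] show ?thesis using False tp t
        by (intro exI[of _ "tp + t + 1"]) auto
    qed
  qed
  moreover have "poly_bounded I N ?T"
    by (intro poly_bounded_rules 1 join 2 3)
  ultimately show "\<exists>gs e T. poly_bounded I N T \<and>
        (\<forall>c\<in>I. \<forall>pre post. length pre = n \<longrightarrow> (\<exists>t\<le>T c. eval (pre @ gs @ post) (\<rho> c) e (?H c) t))"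
    by (intro exI[of _ ?gs] exI[of _ "Cond ep e1 e2"] exI[of _ ?T]) simp
qed

lemma env_ok_drop:
  assumes "env_ok I N \<rho>"
  shows "env_ok I N (\<lambda>c. drop n (\<rho> c))"
proof -
  obtain m where m: "\<forall>c\<in>I. length (\<rho> c) = m"
    and b: "poly_bounded I N (\<lambda>c. sum_list (map val_size (\<rho> c)))"
    using assms(1) unfolding env_ok_def by blast
  have "sum_list (map val_size (drop n xs)) \<le> sum_list (map val_size xs)" for xs
    by (metis append_take_drop_id le_add2 map_append sum_list_append)
  then have "poly_bounded I N (\<lambda>c. sum_list (map val_size (drop n (\<rho> c))))"
    by (intro poly_bounded_mono[OF b order_refl])
  moreover have "\<forall>c\<in>I. length (drop n (\<rho> c)) = m - n" using m by simp
  ultimately show ?thesis unfolding env_ok_def by blast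
qed

lemma runs_drop:
  assumes "env_ok I N \<rho>" "\<And>c. c \<in> I \<Longrightarrow> n \<le> length (\<rho> c)"
  shows "runs I N \<rho> (\<lambda>c. drop n (\<rho> c))"
proof -
  obtain m where m: "\<forall>c\<in>I. length (\<rho> c) = m" using assms unfolding env_ok_def by blast
  have ev: "evals fs (\<rho> c) (map Var [n..<m]) (drop n (\<rho> c)) (m - n)" if "c \<in> I" for fs c
    using evals_vars_drop[OF assms(2)[OF that], of fs] m that by simp
  show ?thesis
    unfolding runs_def using ev
    by (intro conjI env_ok_drop assms allI exI[of _ "[]"] exI[of _ "map Var [n..<m]"] exI[of _ "\<lambda>_. m - n"])
       (auto intro: poly_bounded_const)
qed


section \<open>Closure rules for polynomial time\<close>

lemma PTI: "(\<And>J. J \<subseteq> I \<Longrightarrow> env_ok J N \<rho> \<Longrightarrow> run J N \<rho> F) \<Longrightarrow> PT I N \<rho> F"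
  unfolding PT_def by blast

lemma PTD: "PT I N \<rho> F \<Longrightarrow> J \<subseteq> I \<Longrightarrow> env_ok J N \<rho> \<Longrightarrow> run J N \<rho> F"
  unfolding PT_def by blast

lemma PT_subset: "PT I N \<rho> F \<Longrightarrow> J \<subseteq> I \<Longrightarrow> PT J N \<rho> F"
  unfolding PT_def by (meson order_trans)

lemma PT_cong: "PT I N \<rho> F \<Longrightarrow> (\<And>c. c \<in> I \<Longrightarrow> F c = G c) \<Longrightarrow> PT I N \<rho> G"
  by (rule PTI, rule run_cong[OF PTD], assumption+) auto

lemma PT_Lit: "PT I N \<rho> (\<lambda>_. Num i)"
  by (rule PTI) (rule run_Lit)

lemma PT_arith:
  "PT I N \<rho> (\<lambda>c. Num (f c)) \<Longrightarrow> PT I N \<rho> (\<lambda>c. Num (g c)) \<Longrightarrow>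
    PT I N \<rho> (\<lambda>c. Num (arith_op op (f c) (g c)))"
  by (rule PTI) (intro run_arith PTD)

lemmas PT_add = PT_arith[where op = Add, simplified]
  and PT_sub = PT_arith[where op = Sub, simplified]
  and PT_mul = PT_arith[where op = Mul, simplified]
  and PT_div = PT_arith[where op = Div, simplified]
  and PT_mod = PT_arith[where op = Mod, simplified]
  and PT_less = PT_arith[where op = Less, simplified]

lemma PT_not:
  assumes "PT I N \<rho> (\<lambda>c. Num (of_bool (b c)))"
  shows "PT I N \<rho> (\<lambda>c. Num (of_bool (\<not> b c)))"
  by (rule PT_cong[OF PT_sub[OF PT_Lit[where i = 1] assms]]) simp

lemma PT_conj:
  assumes "PT I N \<rho> (\<lambda>c. Num (of_bool (a c)))" "PT I N \<rho> (\<lambda>c. Num (of_bool (b c)))"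
  shows "PT I N \<rho> (\<lambda>c. Num (of_bool (a c \<and> b c)))"
  by (rule PT_cong[OF PT_mul[OF assms]]) simp

lemma PT_eq:
  assumes "PT I N \<rho> (\<lambda>c. Num (f c))" "PT I N \<rho> (\<lambda>c. Num (g c))"
  shows "PT I N \<rho> (\<lambda>c. Num (of_bool (f c = g c)))"
  by (rule PT_cong[OF PT_conj[OF PT_not[OF PT_less[OF assms]] PT_not[OF PT_less[OF assms(2,1)]]]]) auto

lemma PT_Cell: "PT I N \<rho> F \<Longrightarrow> PT I N \<rho> G \<Longrightarrow> PT I N \<rho> (\<lambda>c. Cell (F c) (G c))"
  by (rule PTI) (intro run_Cell PTD)

definition enc_pair :: "('x \<Rightarrow> val) \<Rightarrow> ('y \<Rightarrow> val) \<Rightarrow> 'x \<times> 'y \<Rightarrow> val" where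
  "enc_pair f g p = Cell (f (fst p)) (g (snd p))"

lemma PT_pair:
  "PT I N \<rho> (\<lambda>c. ex (x c)) \<Longrightarrow> PT I N \<rho> (\<lambda>c. ey (y c)) \<Longrightarrow> PT I N \<rho> (\<lambda>c. enc_pair ex ey (x c, y c))"
  unfolding enc_pair_def by (simp add: PT_Cell)

lemma PT_fst: "PT I N \<rho> (\<lambda>c. enc_pair ex ey (p c)) \<Longrightarrow> PT I N \<rho> (\<lambda>c. ex (fst (p c)))"
  unfolding enc_pair_def by (rule PTI, rule run_First, rule PTD)

lemma PT_snd: "PT I N \<rho> (\<lambda>c. enc_pair ex ey (p c)) \<Longrightarrow> PT I N \<rho> (\<lambda>c. ey (snd (p c)))"
  unfolding enc_pair_def by (rule PTI, rule run_Second, rule PTD)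

lemma PT_Nil: "PT I N \<rho> (\<lambda>_. enc_list g [])"
  by (simp add: PT_Lit)

lemma PT_Cons:
  "PT I N \<rho> (\<lambda>c. g (x c)) \<Longrightarrow> PT I N \<rho> (\<lambda>c. enc_list g (xs c)) \<Longrightarrow> PT I N \<rho> (\<lambda>c. enc_list g (x c # xs c))"
  by (simp add: PT_Cell)

lemma PT_nonempty:
  "PT I N \<rho> (\<lambda>c. enc_list g (xs c)) \<Longrightarrow> PT I N \<rho> (\<lambda>c. Num (of_bool (xs c \<noteq> [])))"
  by (rule PTI) (intro run_nonempty PTD)

lemma PT_if:
  assumes "PT I N \<rho> (\<lambda>c. Num (of_bool (b c)))" "PT {c \<in> I. b c} N \<rho> F" "PT {c \<in> I. \<not> b c} N \<rho> G"
  shows "PT I N \<rho> (\<lambda>c. if b c then F c else G c)"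
proof (rule PTI)
  fix J assume J: "J \<subseteq> I" "env_ok J N \<rho>"
  show "run J N \<rho> (\<lambda>c. if b c then F c else G c)"
    by (intro run_if PTD[OF assms(1)] PTD[OF assms(2)] PTD[OF assms(3)] J env_ok_subset[OF J(2)])
       (use J in auto)
qed

lemma PT_hd:
  assumes "PT I N \<rho> (\<lambda>c. enc_list g (xs c))" "\<And>c. c \<in> I \<Longrightarrow> xs c \<noteq> []"
  shows "PT I N \<rho> (\<lambda>c. g (hd (xs c)))"
proof (rule PTI)
  fix J assume J: "J \<subseteq> I" "env_ok J N \<rho>"
  have "run J N \<rho> (\<lambda>c. Cell (g (hd (xs c))) (enc_list g (tl (xs c))))"
    by (rule run_cong[OF PTD[OF assms(1) J]])
       (use assms(2) J(1) in \<open>auto simp flip: enc_list_simps\<close>)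
  then show "run J N \<rho> (\<lambda>c. g (hd (xs c)))" by (rule run_First)
qed

lemma PT_tl:
  assumes "PT I N \<rho> (\<lambda>c. enc_list g (xs c))" "\<And>c. c \<in> I \<Longrightarrow> xs c \<noteq> []"
  shows "PT I N \<rho> (\<lambda>c. enc_list g (tl (xs c)))"
proof (rule PTI)
  fix J assume J: "J \<subseteq> I" "env_ok J N \<rho>"
  have "run J N \<rho> (\<lambda>c. Cell (g (hd (xs c))) (enc_list g (tl (xs c))))"
    by (rule run_cong[OF PTD[OF assms(1) J]])
       (use assms(2) J(1) in \<open>auto simp flip: enc_list_simps\<close>)
  then show "run J N \<rho> (\<lambda>c. enc_list g (tl (xs c)))" by (rule run_Second)
qed

lemma PT_var0: "PT I N (\<lambda>c. F c # \<rho> c) F"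
  using run_nth[of _ N "\<lambda>c. F c # \<rho> c" 0] by (intro PTI) simp

lemma PT_var1: "PT I N (\<lambda>c. a c # F c # \<rho> c) F"
  using run_nth[of _ N "\<lambda>c. a c # F c # \<rho> c" 1] by (intro PTI) simp

lemma PT_var2: "PT I N (\<lambda>c. a c # b c # F c # \<rho> c) F"
  using run_nth[of _ N "\<lambda>c. a c # b c # F c # \<rho> c" 2] by (intro PTI) simp

text \<open>A value computed in an outer scope is available in an inner one; \<open>h\<close> maps the inner context to the outer.\<close>

lemma PT_weaken:
  assumes F: "PT I N \<rho> F" and h: "\<And>q. q \<in> J \<Longrightarrow> h q \<in> I \<and> N (h q) = M q"
  shows "PT J M (\<lambda>q. x q # \<rho> (h q)) (\<lambda>q. F (h q))"
proof (rule PTI)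
  fix J' assume J': "J' \<subseteq> J" and ok: "env_ok J' M (\<lambda>q. x q # \<rho> (h q))"
  have h': "\<And>q. q \<in> J' \<Longrightarrow> N (h q) = M q" using h J' by blast
  have "env_ok (h ` J') N \<rho>"
    by (rule env_ok_image[where \<rho> = \<rho> and h = h and M = M and N = N, OF env_ok_tl(2)[OF ok]]) (rule h')
  then have "run (h ` J') N \<rho> F" by (rule PTD[OF F, rotated]) (use h J' in blast)
  then have 1: "run J' M (\<lambda>q. \<rho> (h q)) (\<lambda>q. F (h q))"
    by (rule run_reindex) (use h' in blast)
  have "runs J' M (\<lambda>q. x q # \<rho> (h q)) (\<lambda>q. \<rho> (h q))"
    using runs_drop[OF ok, of 1] by simp
  from run_call[OF this 1] show "run J' M (\<lambda>q. x q # \<rho> (h q)) (\<lambda>q. F (h q))" .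
qed

lemma PT_weaken2:
  assumes F: "PT I N \<rho> F" and h: "\<And>q. q \<in> J \<Longrightarrow> h q \<in> I \<and> N (h q) = M q"
  shows "PT J M (\<lambda>q. x q # y q # \<rho> (h q)) (\<lambda>q. F (h q))"
  by (rule PT_weaken[OF PT_weaken[OF F h, where x = y], where h = "\<lambda>q. q"]) auto


section \<open>Recursion on lists in polynomial time\<close>

lemma val_size_enc_list_suffix: "suffix ys xs \<Longrightarrow> val_size (enc_list g ys) \<le> val_size (enc_list g xs)"
proof (induction xs)
  case (Cons x xs)
  then show ?case by (cases "ys = x # xs") (auto simp: suffix_Cons)
qed simp

lemma val_size_enc_list_mem: "x \<in> set xs \<Longrightarrow> val_size (g x) \<le> val_size (enc_list g xs)"
  by (induction xs) auto

lemma length_le_val_size: "length xs \<le> val_size (enc_list g xs)"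
  by (induction xs) auto

lemma poly_bounded_fst:
  assumes "poly_bounded I N T" "\<And>q. q \<in> Q \<Longrightarrow> h q \<in> I" "\<And>q. q \<in> Q \<Longrightarrow> S q \<le> T (h q)"
  shows "poly_bounded Q (\<lambda>q. N (h q)) S"
proof -
  have "poly_bounded Q (\<lambda>q. N (h q)) (\<lambda>q. T (h q))"
    by (rule poly_bounded_reindex[OF assms(1)]) (use assms(2) in auto)
  from poly_bounded_mono[OF this order_refl assms(3)] show ?thesis .
qed

lemma env_ok_fst:
  assumes "env_ok I N \<rho>" "\<And>q. q \<in> Q \<Longrightarrow> h q \<in> I"
  shows "env_ok Q (\<lambda>q. N (h q)) (\<lambda>q. \<rho> (h q))"
  by (rule env_ok_reindex[OF assms(1)]) (use assms(2) in auto)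

lemma runs_cong:
  assumes "runs I N \<rho> F" "\<And>c. c \<in> I \<Longrightarrow> F c = F' c"
  shows "runs I N \<rho> F'"
proof -
  have 1: "(\<forall>c\<in>I. Q c (F' c)) = (\<forall>c\<in>I. Q c (F c))" for Q
    using assms(2) by (intro ball_cong) auto
  show ?thesis
    using assms(1) unfolding runs_def env_ok_def poly_bounded_def
    unfolding 1[of "\<lambda>c v. length v = _"] 1[of "\<lambda>c v. sum_list (map val_size v) \<le> _ c"]
      1[of "\<lambda>c v. sum_list (map val_size v) \<le> (N c + 2) ^ _"]
      1[of "\<lambda>c v. \<forall>pre post. length pre = _ \<longrightarrow> (\<exists>t\<le>_ c. evals (pre @ _ @ post) (\<rho> c) _ v t)"] .
qed

text \<open>The only loop used below. The body sees the next element, the accumulator and all outer variables;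
  the intermediate accumulators have to be bounded, given that the list and the initial value are.\<close>

lemma PT_foldr:
  fixes xs :: "'c \<Rightarrow> 'x list" and b :: "'c \<Rightarrow> 'y"
  assumes xs: "PT I N \<rho> (\<lambda>c. enc_list ex (xs c))"
    and b: "PT I N \<rho> (\<lambda>c. ey (b c))"
    and body: "PT {q. fst q \<in> I \<and> (\<exists>ys. suffix (fst (snd q) # ys) (xs (fst q)) \<and>
                  snd (snd q) = foldr (f (fst q)) ys (b (fst q)))}
          (\<lambda>q. N (fst q))
          (\<lambda>q. ex (fst (snd q)) # ey (snd (snd q)) # \<rho> (fst q))
          (\<lambda>q. ey (f (fst q) (fst (snd q)) (snd (snd q))))"
    and bnd: "\<And>J. J \<subseteq> I \<Longrightarrow> poly_bounded J N (\<lambda>c. val_size (enc_list ex (xs c))) \<Longrightarrow>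
        poly_bounded J N (\<lambda>c. val_size (ey (b c))) \<Longrightarrow>
        \<exists>T. poly_bounded J N T \<and>
          (\<forall>c\<in>J. \<forall>ys. suffix ys (xs c) \<longrightarrow> val_size (ey (foldr (f c) ys (b c))) \<le> T c)"
  shows "PT I N \<rho> (\<lambda>c. ey (foldr (f c) (xs c) (b c)))"
proof (rule PTI)
  fix J assume J: "J \<subseteq> I" and ok: "env_ok J N \<rho>"
  note run_xs = PTD[OF xs J ok] and run_b = PTD[OF b J ok]
  obtain T where T: "poly_bounded J N T"
    "\<And>c ys. c \<in> J \<Longrightarrow> suffix ys (xs c) \<Longrightarrow> val_size (ey (foldr (f c) ys (b c))) \<le> T c"
    using bnd[OF J run_size[OF run_xs] run_size[OF run_b]] by blast
  define Q where "Q = {q :: 'c \<times> 'x list. fst q \<in> J \<and> suffix (snd q) (xs (fst q))}"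
  define M where "M = (\<lambda>q :: 'c \<times> 'x list. N (fst q))"
  define r where "r = (\<lambda>q. ey (foldr (f (fst q)) (snd q) (b (fst q))))"
  define nx where "nx = (\<lambda>q :: 'c \<times> 'x list. (fst q, tl (snd q)))"
  let ?\<rho> = "\<lambda>q. enc_list ex (snd q) # ey (b (fst q)) # \<rho> (fst q)"
  have fstQ: "\<And>q. q \<in> Q \<Longrightarrow> fst q \<in> J" by (simp add: Q_def)
  have ok0: "env_ok Q M (\<lambda>q. \<rho> (fst q))"
    unfolding M_def by (rule env_ok_fst[OF ok fstQ])
  have ok1: "env_ok Q M ?\<rho>"
  proof (intro env_ok_Cons ok0)
    show "poly_bounded Q M (\<lambda>q. val_size (enc_list ex (snd q)))" unfolding M_def
      by (rule poly_bounded_fst[OF run_size[OF run_xs] fstQ])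
         (auto simp: Q_def intro: val_size_enc_list_suffix)
    show "poly_bounded Q M (\<lambda>q. val_size (ey (b (fst q))))" unfolding M_def
      by (rule poly_bounded_fst[OF run_size[OF run_b] fstQ], assumption) (rule order_refl)
  qed
  have size_r: "poly_bounded Q M (\<lambda>q. val_size (r q))" unfolding M_def r_def
    by (rule poly_bounded_fst[OF T(1) fstQ]) (auto simp: Q_def T(2))
  let ?P = "{q \<in> Q. snd q = []}" and ?Q = "{q \<in> Q. snd q \<noteq> []}"
  have ok2: "env_ok ?Q M ?\<rho>" by (rule env_ok_subset[OF ok1]) auto
  have v0: "run Q M ?\<rho> (\<lambda>q. enc_list ex (snd q))"
    by (rule PTD[OF PT_var0 order_refl ok1])
  have v1: "run Q M ?\<rho> (\<lambda>q. ey (b (fst q)))"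
    by (rule PTD[OF PT_var1 order_refl ok1])
  have nxQ: "nx q \<in> Q" if "q \<in> ?Q" for q
    using that by (auto simp: Q_def nx_def intro: suffix_order.trans[OF suffix_tl])
  have size_nx: "poly_bounded ?Q M (\<lambda>q. val_size (r (nx q)))"
    by (rule poly_bounded_reindex[OF size_r]) (use nxQ in \<open>auto simp: M_def nx_def\<close>)
  have "run Q M ?\<rho> r"
  proof (rule run_rec[where p = "\<lambda>q. snd q = []" and nx = nx and \<mu> = "\<lambda>q. length (snd q)"])
    show "env_ok Q M ?\<rho>" by (rule ok1)
    show "run Q M ?\<rho> (\<lambda>q. Num (of_bool (snd q = [])))"
      using PTD[OF PT_not[OF PT_nonempty[OF PT_var0]] order_refl ok1] by simp
    show "run ?P M ?\<rho> r"
      by (rule run_cong[OF run_subset[OF v1]]) (auto simp: r_def)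
    have tail: "run ?Q M ?\<rho> (\<lambda>q. enc_list ex (tl (snd q)))"
      by (rule PTD[OF PT_tl[OF PT_var0] order_refl ok2]) simp
    have d2: "runs ?Q M ?\<rho> (\<lambda>q. \<rho> (fst q))"
      using runs_drop[OF ok2, of 2] by simp
    have "runs ?Q M ?\<rho> (\<lambda>q. enc_list ex (tl (snd q)) # ey (b (fst q)) # \<rho> (fst q))"
      by (intro runs_Cons tail d2 run_subset[OF v1]) auto
    then show "runs ?Q M ?\<rho> (\<lambda>q. ?\<rho> (nx q))" by (simp add: nx_def)
    show "run ?Q M (\<lambda>q. r (nx q) # ?\<rho> q) r"
    proof -
      define h where "h = (\<lambda>q :: 'c \<times> 'x list. (fst q, hd (snd q), foldr (f (fst q)) (tl (snd q)) (b (fst q))))"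
      let ?R = "\<lambda>q. r (nx q) # ?\<rho> q"
      have ok3: "env_ok ?Q M ?R" by (intro env_ok_Cons[OF size_nx] ok2)
      have e: "run ?Q M ?R (\<lambda>q. ex (hd (snd q)))"
        by (rule PTD[OF PT_hd[OF PT_var1] order_refl ok3]) simp
      have a: "run ?Q M ?R (\<lambda>q. r (nx q))"
        by (rule PTD[OF PT_var0 order_refl ok3])
      have d3: "runs ?Q M ?R (\<lambda>q. \<rho> (fst q))"
        using runs_drop[OF ok3, of 3] by (simp add: numeral_3_eq_3)
      have args: "runs ?Q M ?R (\<lambda>q. ex (hd (snd q)) # r (nx q) # \<rho> (fst q))"
        by (intro runs_Cons e a d3)
      define TJ where "TJ = h ` ?Q"
      have hq: "fst (h q) \<in> J \<and> (\<exists>ys. suffix (fst (snd (h q)) # ys) (xs (fst (h q))) \<and>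
                  snd (snd (h q)) = foldr (f (fst (h q))) ys (b (fst (h q))))" if "q \<in> ?Q" for q
        using that by (intro conjI exI[of _ "tl (snd q)"]) (auto simp: h_def Q_def)
      have "env_ok ?Q M (\<lambda>q. ex (hd (snd q)) # r (nx q) # \<rho> (fst q))"
        using args unfolding runs_def by blast
      then have ok4: "env_ok TJ (\<lambda>q. N (fst q)) (\<lambda>q. ex (fst (snd q)) # ey (snd (snd q)) # \<rho> (fst q))"
        unfolding TJ_def by (intro env_ok_image[where M = M]) (simp_all add: h_def r_def nx_def M_def)
      have "run TJ (\<lambda>q. N (fst q)) (\<lambda>q. ex (fst (snd q)) # ey (snd (snd q)) # \<rho> (fst q))
          (\<lambda>q. ey (f (fst q) (fst (snd q)) (snd (snd q))))"
        by (rule PTD[OF body _ ok4]) (use hq J in \<open>auto simp: TJ_def\<close>)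
      from run_reindex[OF this, of ?Q h M]
      have "run ?Q M (\<lambda>q. ex (hd (snd q)) # r (nx q) # \<rho> (fst q))
          (\<lambda>q. ey (f (fst q) (hd (snd q)) (foldr (f (fst q)) (tl (snd q)) (b (fst q)))))"
        by (simp add: TJ_def h_def r_def nx_def M_def)
      then have "run ?Q M (\<lambda>q. ex (hd (snd q)) # r (nx q) # \<rho> (fst q)) r"
      proof (rule run_cong)
        fix q assume "q \<in> ?Q"
        then show "ey (f (fst q) (hd (snd q)) (foldr (f (fst q)) (tl (snd q)) (b (fst q)))) = r q"
          by (cases "snd q") (auto simp: r_def)
      qed simp
      from run_call[OF args this] show ?thesis .
    qed
    show "nx q \<in> Q \<and> M (nx q) = M q \<and> length (snd (nx q)) < length (snd q)"
      if "q \<in> Q" "snd q \<noteq> []" for q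
      using nxQ[of q] that by (auto simp: M_def nx_def)
    show "poly_bounded Q M (\<lambda>q. length (snd q))" unfolding M_def
      by (rule poly_bounded_fst[OF run_size[OF run_xs] fstQ])
         (auto simp: Q_def intro: order_trans[OF length_le_val_size val_size_enc_list_suffix])
  qed (rule size_r)
  from run_reindex[OF this, of J "\<lambda>c. (c, xs c)" N]
  have "run J N (\<lambda>c. enc_list ex (xs c) # ey (b c) # \<rho> c) (\<lambda>c. ey (foldr (f c) (xs c) (b c)))"
    by (simp add: Q_def M_def r_def)
  from run_call[OF runs_Cons[OF run_xs runs_Cons[OF run_b runs_id[OF ok]]] this]
  show "run J N \<rho> (\<lambda>c. ey (foldr (f c) (xs c) (b c)))" .
qed

lemma val_size_enc_list_le:
  assumes "length xs \<le> n" "\<And>x. x \<in> set xs \<Longrightarrow> val_size (g x) \<le> s"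
  shows "val_size (enc_list g xs) \<le> n * (1 + s) + 1"
proof -
  have "val_size (enc_list g xs) \<le> length xs * (1 + s) + 1"
    using assms(2)
  proof (induction xs)
    case (Cons a xs)
    then have "val_size (g a) \<le> s" "val_size (enc_list g xs) \<le> length xs * (1 + s) + 1" by auto
    then show ?case by (simp add: algebra_simps)
  qed (simp add: int_bits_def)
  also have "\<dots> \<le> n * (1 + s) + 1" using assms(1) by (intro add_right_mono mult_right_mono) auto
  finally show ?thesis .
qed

text \<open>The intermediate lists need no bound from the user: the bound on the values of the body suffices.\<close>

lemma PT_map:
  fixes xs :: "'c \<Rightarrow> 'x list" and f :: "'c \<Rightarrow> 'x \<Rightarrow> 'y"
  assumes xs: "PT I N \<rho> (\<lambda>c. enc_list ex (xs c))"
    and body: "PT {q. fst q \<in> I \<and> snd q \<in> set (xs (fst q))}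
          (\<lambda>q. N (fst q)) (\<lambda>q. ex (snd q) # \<rho> (fst q)) (\<lambda>q. ey (f (fst q) (snd q)))"
  shows "PT I N \<rho> (\<lambda>c. enc_list ey (map (f c) (xs c)))"
proof (rule PTI)
  fix J assume J: "J \<subseteq> I" and ok: "env_ok J N \<rho>"
  let ?Q = "{q. fst q \<in> J \<and> snd q \<in> set (xs (fst q))}"
  have "env_ok ?Q (\<lambda>q. N (fst q)) (\<lambda>q. ex (snd q) # \<rho> (fst q))"
    by (intro env_ok_Cons env_ok_fst[OF ok] poly_bounded_fst[OF run_size[OF PTD[OF xs J ok]]])
       (auto intro: val_size_enc_list_mem)
  then have "run ?Q (\<lambda>q. N (fst q)) (\<lambda>q. ex (snd q) # \<rho> (fst q)) (\<lambda>q. ey (f (fst q) (snd q)))"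
    by (rule PTD[OF body, rotated]) (use J in auto)
  from run_size[OF this] obtain k where
    k: "\<And>c x. c \<in> J \<Longrightarrow> x \<in> set (xs c) \<Longrightarrow> val_size (ey (f c x)) \<le> (N c + 2) ^ k"
    unfolding poly_bounded_def by auto
  have "PT J N \<rho> (\<lambda>c. enc_list ey (foldr (\<lambda>x ys. f c x # ys) (xs c) []))"
  proof (rule PT_foldr[where ey = "enc_list ey" and b = "\<lambda>_. []" and f = "\<lambda>c x ys. f c x # ys"])
    show "PT J N \<rho> (\<lambda>c. enc_list ex (xs c))" by (rule PT_subset[OF xs J])
    let ?T = "{q. fst q \<in> J \<and> (\<exists>ys. suffix (fst (snd q) # ys) (xs (fst q)) \<and>
        snd (snd q) = foldr (\<lambda>x ys. f (fst q) x # ys) ys [])}"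
    let ?\<rho> = "\<lambda>q. ex (fst (snd q)) # enc_list ey (snd (snd q)) # \<rho> (fst q)"
    have "PT ?T (\<lambda>q. N (fst q)) ?\<rho> (\<lambda>q. ey (f (fst q) (fst (snd q))))"
    proof (rule PTI)
      fix K assume K: "K \<subseteq> ?T" and okK: "env_ok K (\<lambda>q. N (fst q)) ?\<rho>"
      define h where "h q = (fst q, fst (snd q))" for q :: "'c \<times> 'x \<times> 'y list"
      have sub: "h ` K \<subseteq> ?Q" using K set_mono_suffix by (fastforce simp: h_def)
      have r2: "runs K (\<lambda>q. N (fst q)) ?\<rho> (\<lambda>q. ex (fst (snd q)) # \<rho> (fst q))"
        by (rule runs_Cons[OF PTD[OF PT_var0 order_refl okK]])
           (use runs_drop[OF okK, of 2] in simp)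
      then have "env_ok (h ` K) (\<lambda>q. N (fst q)) (\<lambda>q. ex (snd q) # \<rho> (fst q))"
        by (intro env_ok_image[where M = "\<lambda>q. N (fst q)"]) (auto simp: runs_def h_def)
      then have "run (h ` K) (\<lambda>q. N (fst q)) (\<lambda>q. ex (snd q) # \<rho> (fst q)) (\<lambda>q. ey (f (fst q) (snd q)))"
        by (rule PTD[OF body, rotated]) (use J sub in auto)
      from run_reindex[OF this, of K h "\<lambda>q. N (fst q)"]
      have "run K (\<lambda>q. N (fst q)) (\<lambda>q. ex (fst (snd q)) # \<rho> (fst q)) (\<lambda>q. ey (f (fst q) (fst (snd q))))"
        by (simp add: h_def)
      from run_call[OF r2 this] show "run K (\<lambda>q. N (fst q)) ?\<rho> (\<lambda>q. ey (f (fst q) (fst (snd q))))" .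
    qed
    then show "PT ?T (\<lambda>q. N (fst q)) ?\<rho> (\<lambda>q. enc_list ey (f (fst q) (fst (snd q)) # snd (snd q)))"
      by (intro PT_Cons PT_var1)
  next
    fix K assume K: "K \<subseteq> J" and b: "poly_bounded K N (\<lambda>c. val_size (enc_list ex (xs c)))"
    have pb: "poly_bounded K N (\<lambda>c. (N c + 2) ^ k)"
      unfolding poly_bounded_def by (rule exI[of _ k]) simp
    show "\<exists>T. poly_bounded K N T \<and> (\<forall>c\<in>K. \<forall>ys. suffix ys (xs c) \<longrightarrow>
        val_size (enc_list ey (foldr (\<lambda>x ys. f c x # ys) ys [])) \<le> T c)"
    proof (intro exI conjI ballI allI impI)
      show "poly_bounded K N (\<lambda>c. val_size (enc_list ex (xs c)) * (1 + (N c + 2) ^ k) + 1)"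
        by (intro poly_bounded_rules b pb)
      fix c ys assume c: "c \<in> K" and ys: "suffix ys (xs c)"
      have "foldr (\<lambda>x ys. f c x # ys) ys [] = map (f c) ys" by (induction ys) auto
      moreover have "length ys \<le> val_size (enc_list ex (xs c))"
        using length_le_val_size[of ys ex] val_size_enc_list_suffix[OF ys, of ex] by linarith
      ultimately show "val_size (enc_list ey (foldr (\<lambda>x ys. f c x # ys) ys []))
          \<le> val_size (enc_list ex (xs c)) * (1 + (N c + 2) ^ k) + 1"
        using k[of c] c K set_mono_suffix[OF ys] by (intro val_size_enc_list_le) auto
    qed
  qed (rule PT_Nil)
  moreover have "foldr (\<lambda>x ys. f c x # ys) zs [] = map (f c) zs" for c zs
    by (induction zs) auto
  ultimately have "PT J N \<rho> (\<lambda>c. enc_list ey (map (f c) (xs c)))" by simp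
  from PTD[OF this order_refl ok] show "run J N \<rho> (\<lambda>c. enc_list ey (map (f c) (xs c)))" .
qed

lemma PT_zip:
  fixes xs :: "'c \<Rightarrow> 'x list" and ys :: "'c \<Rightarrow> 'y list"
  assumes xs: "PT I N \<rho> (\<lambda>c. enc_list ex (xs c))"
    and ys: "PT I N \<rho> (\<lambda>c. enc_list ey (ys c))"
  shows "PT I N \<rho> (\<lambda>c. enc_list (enc_pair ex ey) (zip (xs c) (ys c)))"
proof (rule PTI)
  fix J assume J: "J \<subseteq> I" and ok: "env_ok J N \<rho>"
  note run_xs = PTD[OF xs J ok] and run_ys = PTD[OF ys J ok]
  define Q where "Q = {q :: 'c \<times> 'x list \<times> 'y list. fst q \<in> J \<and>
    suffix (fst (snd q)) (xs (fst q)) \<and> suffix (snd (snd q)) (ys (fst q))}"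
  define M where "M = (\<lambda>q :: 'c \<times> 'x list \<times> 'y list. N (fst q))"
  define r where "r = (\<lambda>q :: 'c \<times> 'x list \<times> 'y list. enc_list (enc_pair ex ey) (zip (fst (snd q)) (snd (snd q))))"
  define nx where "nx = (\<lambda>q :: 'c \<times> 'x list \<times> 'y list. (fst q, tl (fst (snd q)), tl (snd (snd q))))"
  let ?\<rho> = "\<lambda>q. [enc_list ex (fst (snd q)), enc_list ey (snd (snd q))]"
  have fstQ: "\<And>q. q \<in> Q \<Longrightarrow> fst q \<in> J" by (simp add: Q_def)
  have bx: "poly_bounded Q M (\<lambda>q. val_size (enc_list ex (fst (snd q))))" unfolding M_def
    by (rule poly_bounded_fst[OF run_size[OF run_xs] fstQ])
       (auto simp: Q_def intro: val_size_enc_list_suffix)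
  have by': "poly_bounded Q M (\<lambda>q. val_size (enc_list ey (snd (snd q))))" unfolding M_def
    by (rule poly_bounded_fst[OF run_size[OF run_ys] fstQ])
       (auto simp: Q_def intro: val_size_enc_list_suffix)
  have ok1: "env_ok Q M ?\<rho>" by (intro env_ok_Cons env_ok_Nil bx by')
  let ?p = "\<lambda>q :: 'c \<times> 'x list \<times> 'y list. \<not> (fst (snd q) \<noteq> [] \<and> snd (snd q) \<noteq> [])"
  have ok2: "env_ok {q \<in> Q. \<not> ?p q} M ?\<rho>" by (rule env_ok_subset[OF ok1]) auto
  have zip_size: "val_size (enc_list (enc_pair ex ey) (zip as bs)) \<le>
      val_size (enc_list ex as) + val_size (enc_list ey bs)" for as bs
    by (induction as bs rule: list_induct2') (auto simp: enc_pair_def)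
  have size_r: "poly_bounded Q M (\<lambda>q. val_size (r q))" unfolding r_def
    by (rule poly_bounded_mono[OF poly_bounded_add[OF bx by'] order_refl]) (rule zip_size)
  have nxQ: "nx q \<in> Q \<and> M (nx q) = M q \<and> length (fst (snd (nx q))) < length (fst (snd q))"
    if "q \<in> Q" "\<not> ?p q" for q
    using that by (auto simp: Q_def M_def nx_def intro: suffix_order.trans[OF suffix_tl])
  have "run Q M ?\<rho> r"
  proof (rule run_rec[where p = ?p and nx = nx and \<mu> = "\<lambda>q. length (fst (snd q))"])
    show "run Q M ?\<rho> (\<lambda>q. Num (of_bool (?p q)))"
      by (rule PTD[OF PT_not[OF PT_conj[OF PT_nonempty[OF PT_var0] PT_nonempty[OF PT_var1]]] order_refl ok1])
    show "run {q \<in> Q. ?p q} M ?\<rho> r"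
      by (rule run_cong[OF run_Lit[where i = 0]]) (auto simp: r_def)
    show "runs {q \<in> Q. \<not> ?p q} M ?\<rho> (\<lambda>q. ?\<rho> (nx q))" unfolding nx_def
      by (simp only: fst_conv snd_conv)
         (intro runs_Cons runs_Nil PTD[OF PT_tl[OF PT_var0] order_refl ok2]
            PTD[OF PT_tl[OF PT_var1] order_refl ok2]; simp)
    show "run {q \<in> Q. \<not> ?p q} M (\<lambda>q. r (nx q) # ?\<rho> q) r"
    proof -
      let ?R = "\<lambda>q. r (nx q) # ?\<rho> q"
      have ok3: "env_ok {q \<in> Q. \<not> ?p q} M ?R"
        by (intro env_ok_Cons[OF _ ok2] poly_bounded_reindex[OF size_r]) (use nxQ in blast)
      have "run {q \<in> Q. \<not> ?p q} M ?R
          (\<lambda>q. Cell (Cell (ex (hd (fst (snd q)))) (ey (hd (snd (snd q))))) (r (nx q)))"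
        by (intro run_Cell PTD[OF PT_var0 order_refl ok3] PTD[OF PT_hd[OF PT_var1] order_refl ok3]
            PTD[OF PT_hd[OF PT_var2] order_refl ok3]) simp_all
      then show ?thesis
      proof (rule run_cong)
        fix q assume "q \<in> {q \<in> Q. \<not> ?p q}"
        then show "Cell (Cell (ex (hd (fst (snd q)))) (ey (hd (snd (snd q))))) (r (nx q)) = r q"
          by (cases "fst (snd q)"; cases "snd (snd q)") (auto simp: r_def nx_def enc_pair_def)
      qed simp
    qed
    show "poly_bounded Q M (\<lambda>q. length (fst (snd q)))"
      by (rule poly_bounded_mono[OF bx order_refl]) (rule length_le_val_size)
  qed (rule ok1 size_r nxQ; assumption)+
  from run_reindex[OF this, of J "\<lambda>c. (c, xs c, ys c)" N]
  have "run J N (\<lambda>c. [enc_list ex (xs c), enc_list ey (ys c)])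
      (\<lambda>c. enc_list (enc_pair ex ey) (zip (xs c) (ys c)))"
    by (simp add: Q_def M_def r_def)
  from run_call[OF runs_Cons[OF run_xs runs_Cons[OF run_ys runs_Nil]] this]
  show "run J N \<rho> (\<lambda>c. enc_list (enc_pair ex ey) (zip (xs c) (ys c)))" .
qed

text \<open>The lists \<open>countdown n\<close> serve as loop counters and as supplies of \<open>n\<close> distinct nonzero keys.\<close>

primrec countdown :: "nat \<Rightarrow> int list" where
  "countdown 0 = []"
| "countdown (Suc n) = int (Suc n) # countdown n"

lemma set_countdown: "set (countdown n) = {1..int n}"
  by (induction n) auto

lemma distinct_countdown: "distinct (countdown n)"
  by (induction n) (auto simp: set_countdown)

lemma length_countdown [simp]: "length (countdown n) = n"
  by (induction n) auto

lemma int_bits_le_self: "int_bits (int n) \<le> n + 1"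
  using int_bits_le[of "int n" n] less_exp[of n] by (simp flip: of_nat_less_iff)

lemma PT_countdown:
  fixes n :: "'c \<Rightarrow> nat"
  assumes n: "PT I N \<rho> (\<lambda>c. Num (int (n c)))" and b: "poly_bounded I N n"
  shows "PT I N \<rho> (\<lambda>c. enc_list Num (countdown (n c)))"
proof (rule PTI)
  fix J assume J: "J \<subseteq> I" and ok: "env_ok J N \<rho>"
  note run_n = PTD[OF n J ok]
  define Q where "Q = {q :: 'c \<times> nat. fst q \<in> J \<and> snd q \<le> n (fst q)}"
  define M where "M = (\<lambda>q :: 'c \<times> nat. N (fst q))"
  define r where "r = (\<lambda>q :: 'c \<times> nat. enc_list Num (countdown (snd q)))"
  define nx where "nx = (\<lambda>q :: 'c \<times> nat. (fst q, snd q - 1))"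
  let ?\<rho> = "\<lambda>q. [Num (int (snd q))]"
  have b1: "poly_bounded Q M (\<lambda>q. snd q)" unfolding M_def
    by (rule poly_bounded_fst[OF b]) (use J in \<open>auto simp: Q_def\<close>)
  have b2: "poly_bounded Q M (\<lambda>q. snd q + 1)" by (intro poly_bounded_rules b1)
  have b3: "poly_bounded Q M (\<lambda>q. val_size (Num (int (snd q))))"
    by (rule poly_bounded_mono[OF b2 order_refl]) (simp add: int_bits_le_self[simplified])
  have ok1: "env_ok Q M ?\<rho>" by (intro env_ok_Cons env_ok_Nil b3)
  have ok2: "env_ok {q \<in> Q. snd q \<noteq> 0} M ?\<rho>" by (rule env_ok_subset[OF ok1]) auto
  have "poly_bounded Q M (\<lambda>q. snd q * (1 + (snd q + 1)) + 1)"
    by (intro poly_bounded_rules b1)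
  then have size_r: "poly_bounded Q M (\<lambda>q. val_size (r q))" unfolding r_def
  proof (rule poly_bounded_mono[OF _ order_refl], intro val_size_enc_list_le)
    fix q and x :: int assume "x \<in> set (countdown (snd q))"
    then have "int_bits x \<le> int_bits (int (snd q))" by (intro int_bits_mono) (auto simp: set_countdown)
    then show "val_size (Num x) \<le> snd q + 1" using int_bits_le_self[of "snd q"] by simp
  qed simp
  have nxQ: "nx q \<in> Q \<and> M (nx q) = M q \<and> snd (nx q) < snd q" if "q \<in> Q" "snd q \<noteq> 0" for q
    using that by (auto simp: Q_def M_def nx_def)
  have "run Q M ?\<rho> r"
  proof (rule run_rec[where p = "\<lambda>q. snd q = 0" and nx = nx and \<mu> = snd])
    show "run Q M ?\<rho> (\<lambda>q. Num (of_bool (snd q = 0)))"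
      using PTD[OF PT_eq[OF PT_var0 PT_Lit[where i = 0]] order_refl ok1] by simp
    show "run {q \<in> Q. snd q = 0} M ?\<rho> r"
      by (rule run_cong[OF run_Lit[where i = 0]]) (auto simp: r_def)
    have "runs {q \<in> Q. snd q \<noteq> 0} M ?\<rho> (\<lambda>q. [Num (int (snd q) - 1)])"
      by (intro runs_Cons runs_Nil PTD[OF PT_sub[OF PT_var0 PT_Lit] order_refl ok2])
    then show "runs {q \<in> Q. snd q \<noteq> 0} M ?\<rho> (\<lambda>q. ?\<rho> (nx q))"
      by (rule runs_cong) (auto simp: nx_def of_nat_diff)
    show "run {q \<in> Q. snd q \<noteq> 0} M (\<lambda>q. r (nx q) # ?\<rho> q) r"
    proof -
      let ?R = "\<lambda>q. r (nx q) # ?\<rho> q"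
      have ok3: "env_ok {q \<in> Q. snd q \<noteq> 0} M ?R"
        by (intro env_ok_Cons[OF _ ok2] poly_bounded_reindex[OF size_r]) (use nxQ in blast)
      have "run {q \<in> Q. snd q \<noteq> 0} M ?R (\<lambda>q. Cell (Num (int (snd q))) (r (nx q)))"
        by (intro run_Cell PTD[OF PT_var0 order_refl ok3] PTD[OF PT_var1 order_refl ok3])
      then show ?thesis
      proof (rule run_cong)
        fix q assume "q \<in> {q \<in> Q. snd q \<noteq> 0}"
        then show "Cell (Num (int (snd q))) (r (nx q)) = r q"
          by (cases "snd q") (auto simp: r_def nx_def)
      qed simp
    qed
  qed (rule ok1 b1 size_r nxQ; assumption)+
  from run_reindex[OF this, of J "\<lambda>c. (c, n c)" N]
  have "run J N (\<lambda>c. [Num (int (n c))]) (\<lambda>c. enc_list Num (countdown (n c)))"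
    by (simp add: Q_def M_def r_def)
  from run_call[OF runs_Cons[OF run_n runs_Nil] this]
  show "run J N \<rho> (\<lambda>c. enc_list Num (countdown (n c)))" .
qed


section \<open>Lattices of full rank\<close>

subsection \<open>The index is the determinant\<close>

lemma mult_mat_vec_sum:
  assumes "A \<in> carrier_mat n m" "z \<in> carrier_vec m" "i < n"
  shows "(A *\<^sub>v z) $ i = (\<Sum>j = 0..<m. A $$ (i, j) * z $ j)"
  using assms by (simp add: scalar_prod_def)

text \<open>Euclid's algorithm on the first row by column operations: among the matrices with the same column
  lattice, one whose first row has minimal absolute sum has at most one nonzero entry there.\<close>

lemma clear_first_row:
  fixes H :: "int mat"
  assumes H: "H \<in> carrier_mat d d" and d: "0 < d"
  shows "\<exists>H' U. H' \<in> carrier_mat d d \<and> U \<in> carrier_mat d d \<and> H' = H * U \<and> \<bar>det H'\<bar> = \<bar>det H\<bar> \<and>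
    (\<forall>j. 0 < j \<longrightarrow> j < d \<longrightarrow> H' $$ (0, j) = 0)"
proof -
  define S where "S = {H' \<in> carrier_mat d d. \<bar>det H'\<bar> = \<bar>det H\<bar> \<and> (\<exists>U\<in>carrier_mat d d. H' = H * U)}"
  define \<mu> where "\<mu> = (\<lambda>A :: int mat. \<Sum>j<d. nat \<bar>A $$ (0, j)\<bar>)"
  have "H = H * 1\<^sub>m d" using H by simp
  then have "H \<in> S" unfolding S_def using H one_carrier_mat[of d] by blast
  then obtain A where A: "A \<in> S" and min: "\<And>B. B \<in> S \<Longrightarrow> \<mu> A \<le> \<mu> B"
    using ex_has_least_nat[of "\<lambda>B. B \<in> S" H \<mu>] by blast
  have Ac: "A \<in> carrier_mat d d" using A by (simp add: S_def)
  obtain U where U: "U \<in> carrier_mat d d" "A = H * U" "\<bar>det A\<bar> = \<bar>det H\<bar>"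
    using A unfolding S_def by blast
  have one: "A $$ (0, j) = 0 \<or> A $$ (0, k) = 0" if jk: "j < d" "k < d" "j \<noteq> k" for j k
  proof (rule ccontr)
    have aux: False if jk: "j < d" "k < d" "j \<noteq> k" "A $$ (0, k) \<noteq> 0" "\<bar>A $$ (0, k)\<bar> \<le> \<bar>A $$ (0, j)\<bar>" for j k
    proof -
      \<comment> \<open>subtracting or adding the smaller entry, according to the signs, decreases the larger one\<close>
      define B where "B = addcol (if sgn (A $$ (0, j)) = sgn (A $$ (0, k)) then - 1 else 1) j k A"
      have "B \<in> S"
        unfolding S_def
      proof (intro CollectI conjI)
        show "B \<in> carrier_mat d d" using Ac by (simp add: B_def mat_addcol_def)
        show "\<bar>det B\<bar> = \<bar>det H\<bar>"
          unfolding B_def using U(3) jk Ac by (subst det_addcol[of k d]) auto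
        have B: "B = H * (U * addrow_mat d (if sgn (A $$ (0, j)) = sgn (A $$ (0, k)) then - 1 else 1) k j)"
          unfolding B_def addcol_mat[OF Ac jk(2)] using U(1,2) H
          by (simp add: assoc_mult_mat[of _ d d _ d _ d])
        then show "\<exists>U\<in>carrier_mat d d. B = H * U" using B U(1) by (intro bexI[where x = "U * addrow_mat d (if sgn (A $$ (0, j)) = sgn (A $$ (0, k)) then - 1 else 1) k j"]) simp_all
      qed
      then have le: "\<mu> A \<le> \<mu> B" by (rule min)
      have 1: "B $$ (0, i) = A $$ (0, i)" if "i < d" "i \<noteq> j" for i
        using that Ac d by (auto simp: B_def)
      have 2: "nat \<bar>B $$ (0, j)\<bar> < nat \<bar>A $$ (0, j)\<bar>"
      proof -
        have red: "\<bar>(if sgn y = sgn x then - 1 else 1) * x + y\<bar> < \<bar>y\<bar>"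
          if "x \<noteq> 0" "\<bar>x\<bar> \<le> \<bar>y\<bar>" for x y :: int
          using that by (cases x "0 :: int" rule: linorder_cases; cases y "0 :: int" rule: linorder_cases) simp_all
        show ?thesis using red[OF jk(4,5)] jk Ac d by (simp add: B_def nat_less_eq_zless)
      qed
      have "\<mu> B < \<mu> A"
        unfolding \<mu>_def
      proof (rule sum_strict_mono_ex1)
        show "\<forall>x\<in>{..<d}. nat \<bar>B $$ (0, x)\<bar> \<le> nat \<bar>A $$ (0, x)\<bar>"
        proof
          fix x assume "x \<in> {..<d}"
          then show "nat \<bar>B $$ (0, x)\<bar> \<le> nat \<bar>A $$ (0, x)\<bar>" using 1[of x] 2 by (cases "x = j") auto
        qed
        show "\<exists>a\<in>{..<d}. nat \<bar>B $$ (0, a)\<bar> < nat \<bar>A $$ (0, a)\<bar>" using 2 jk(1) by blast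
      qed simp
      with le show False by simp
    qed
    assume "\<not> ?thesis"
    then show False using aux[of j k] aux[of k j] jk by linarith
  qed
  show ?thesis
  proof (cases "\<exists>j. 0 < j \<and> j < d \<and> A $$ (0, j) \<noteq> 0")
    case False
    then show ?thesis using Ac U by blast
  next
    case True
    then obtain k where k: "0 < k" "k < d" "A $$ (0, k) \<noteq> 0" by blast
    let ?B = "swapcols 0 k A"
    have "?B = H * (U * swaprows_mat d 0 k)"
      using swapcols_mat[OF Ac d k(2)] U(1,2) H by (simp add: assoc_mult_mat[of _ d d _ d _ d])
    moreover have "\<bar>det ?B\<bar> = \<bar>det H\<bar>" using det_swapcols[OF d k(2) _ Ac] k(1) U(3) by simp
    moreover have "?B $$ (0, j) = 0" if "0 < j" "j < d" for j
      using that Ac d k one[of j k] one[of 0 k] by (cases "j = k") (simp_all add: mat_swapcols_def)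
    moreover have "?B \<in> carrier_mat d d" "U * swaprows_mat d 0 k \<in> carrier_mat d d"
      using Ac U(1) by (simp_all add: mat_swapcols_def)
    ultimately show ?thesis by blast
  qed
qed

text \<open>After clearing the first row, the matrix is block triangular with a first entry \<open>g\<close>. A representative
  consists of a residue modulo \<open>g\<close> and a representative for the remaining block, which gives the
  determinant as the number of classes.\<close>

lemma lattice_representatives:
  fixes H :: "int mat"
  assumes "H \<in> carrier_mat d d" "det H \<noteq> 0"
  shows "\<exists>R. finite R \<and> int (card R) \<le> \<bar>det H\<bar> \<and>
    (\<forall>w\<in>carrier_vec d. \<exists>r\<in>R. r \<in> carrier_vec d \<and> (\<exists>z\<in>carrier_vec d. w - r = H *\<^sub>v z))"
  using assms
proof (induction d arbitrary: H)
  case 0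
  then have "det H = 1" by (auto simp: det_def)
  then show ?case using 0 by (intro exI[of _ "{0\<^sub>v 0}"]) (auto intro!: bexI[of _ "0\<^sub>v 0"] eq_vecI)
next
  case (Suc d)
  obtain H' U where H': "H' \<in> carrier_mat (Suc d) (Suc d)" and U: "U \<in> carrier_mat (Suc d) (Suc d)"
    and HU: "H' = H * U" and det': "\<bar>det H'\<bar> = \<bar>det H\<bar>"
    and row0: "\<And>j. 0 < j \<Longrightarrow> j < Suc d \<Longrightarrow> H' $$ (0, j) = 0"
    using clear_first_row[OF Suc.prems(1)] by auto
  define g where "g = H' $$ (0, 0)"
  define H1 where "H1 = mat_delete H' 0 0"
  have H1: "H1 \<in> carrier_mat d d" unfolding H1_def using mat_delete_carrier[OF H', of 0 0] by simp
  have H1_index: "H1 $$ (i, j) = H' $$ (Suc i, Suc j)" if "i < d" "j < d" for i j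
    using that H' by (auto simp: H1_def mat_delete_def)
  have "det H' = (\<Sum>j<Suc d. H' $$ (0, j) * cofactor H' 0 j)"
    by (rule laplace_expansion_row[OF H']) simp
  also have "\<dots> = g * det H1"
    using row0 by (subst sum.lessThan_Suc_shift) (simp add: g_def cofactor_def H1_def)
  finally have det: "det H' = g * det H1" .
  then have g: "g \<noteq> 0" and "det H1 \<noteq> 0" using det' Suc.prems(2) by auto
  then obtain R where R: "finite R" "int (card R) \<le> \<bar>det H1\<bar>"
    "\<And>w. w \<in> carrier_vec d \<Longrightarrow> \<exists>r\<in>R. r \<in> carrier_vec d \<and> (\<exists>z\<in>carrier_vec d. w - r = H1 *\<^sub>v z)"
    using Suc.IH[OF H1] by blast
  define R' where "R' = (\<lambda>(i, r). vCons i r) ` ({0..<\<bar>g\<bar>} \<times> R)"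
  have "card R' \<le> card ({0..<\<bar>g\<bar>} \<times> R)" unfolding R'_def by (rule card_image_le) (use R in auto)
  then have "int (card R') \<le> int (nat \<bar>g\<bar> * card R)"
    unfolding of_nat_le_iff by (simp add: card_cartesian_product)
  also have "\<dots> \<le> \<bar>g\<bar> * \<bar>det H1\<bar>" using R(2) by (simp add: mult_left_mono)
  also have "\<dots> = \<bar>det H\<bar>" using det det' by (simp add: abs_mult)
  finally have card: "int (card R') \<le> \<bar>det H\<bar>" .
  show ?case
  proof (intro exI[of _ R'] conjI ballI)
    show "finite R'" using R by (simp add: R'_def)
    fix w :: "int vec" assume w: "w \<in> carrier_vec (Suc d)"
    define i q where "i = w $ 0 mod \<bar>g\<bar>" and "q = sgn g * (w $ 0 div \<bar>g\<bar>)"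
    have q: "w $ 0 - i = g * q"
    proof -
      have "g * q = \<bar>g\<bar> * (w $ 0 div \<bar>g\<bar>)" by (simp add: q_def abs_sgn[of g])
      then show ?thesis by (simp add: i_def minus_mod_eq_mult_div)
    qed
    define w1 where "w1 = vec d (\<lambda>j. w $ Suc j - H' $$ (Suc j, 0) * q)"
    have "w1 \<in> carrier_vec d" by (simp add: w1_def)
    from R(3)[OF this] obtain r z where r: "r \<in> R" "r \<in> carrier_vec d"
      and z: "z \<in> carrier_vec d" "w1 - r = H1 *\<^sub>v z" by blast
    have "w - vCons i r = H' *\<^sub>v vCons q z"
    proof (rule eq_vecI)
      fix k assume "k < dim_vec (H' *\<^sub>v vCons q z)"
      then have k: "k < Suc d" using H' by simp
      have s: "(H' *\<^sub>v vCons q z) $ k = H' $$ (k, 0) * q + (\<Sum>j = 0..<d. H' $$ (k, Suc j) * z $ j)"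
        using mult_mat_vec_sum[OF H' _ k, of "vCons q z"] z(1)
        by (simp add: sum.atLeast0_lessThan_Suc_shift del: sum.op_ivl_Suc)
      show "(w - vCons i r) $ k = (H' *\<^sub>v vCons q z) $ k"
      proof (cases k)
        case 0
        then show ?thesis using s q row0 r w by (simp add: g_def)
      next
        case (Suc k')
        have "(w1 - r) $ k' = (\<Sum>j = 0..<d. H1 $$ (k', j) * z $ j)"
          using z mult_mat_vec_sum[OF H1 z(1), of k'] k Suc by simp
        also have "\<dots> = (\<Sum>j = 0..<d. H' $$ (k, Suc j) * z $ j)"
          using Suc k by (intro sum.cong) (auto simp: H1_index)
        finally show ?thesis using s Suc k r w by (simp add: w1_def)
      qed
    qed (use w H' r in auto)
    also have "\<dots> = H *\<^sub>v (U *\<^sub>v vCons q z)"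
      unfolding HU using Suc.prems(1) U z by (subst assoc_mult_mat_vec) auto
    finally show "\<exists>r\<in>R'. r \<in> carrier_vec (Suc d) \<and> (\<exists>z\<in>carrier_vec (Suc d). w - r = H *\<^sub>v z)"
      using r z U g by (intro bexI[of _ "vCons i r"]) (auto simp: R'_def i_def)
  qed (rule card)
qed


subsection \<open>Multiples of the inverse\<close>

text \<open>A multiple of the inverse is a multiple of the adjugate; this is why the divisions below are exact.\<close>

lemma adj_mat_unique:
  fixes M N :: "int mat"
  assumes M: "M \<in> carrier_mat d d" and N: "N \<in> carrier_mat d d" and MN: "M * N = c \<cdot>\<^sub>m 1\<^sub>m d"
  shows "det M \<cdot>\<^sub>m N = c \<cdot>\<^sub>m adj_mat M"
proof -
  note adj = adj_mat[OF M]
  have "adj_mat M * (M * N) = (adj_mat M * M) * N"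
    using adj(1) M N by (simp add: assoc_mult_mat[of _ d d _ d _ d])
  then show ?thesis using adj M N MN by (simp add: mult_smult_distrib[of _ d d _ d] mult_smult_assoc_mat[of _ d d _ d])
qed

lemma scaled_inverse_commute:
  fixes M N :: "int mat"
  assumes M: "M \<in> carrier_mat d d" and N: "N \<in> carrier_mat d d" and MN: "M * N = c \<cdot>\<^sub>m 1\<^sub>m d"
    and det: "det M \<noteq> 0"
  shows "N * M = c \<cdot>\<^sub>m 1\<^sub>m d"
proof -
  have "det M \<cdot>\<^sub>m (N * M) = (det M \<cdot>\<^sub>m N) * M" using M N by (simp add: mult_smult_assoc_mat[of _ d d _ d])
  also have "\<dots> = (c \<cdot>\<^sub>m adj_mat M) * M" by (simp add: adj_mat_unique[OF M N MN])
  also have "\<dots> = c \<cdot>\<^sub>m (det M \<cdot>\<^sub>m 1\<^sub>m d)"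
    using adj_mat[OF M] M by (simp add: mult_smult_assoc_mat[of _ d d _ d])
  finally have eq: "det M \<cdot>\<^sub>m (N * M) = c \<cdot>\<^sub>m (det M \<cdot>\<^sub>m 1\<^sub>m d)" .
  show ?thesis
  proof (rule eq_matI)
    fix i j assume "i < dim_row (c \<cdot>\<^sub>m 1\<^sub>m d)" "j < dim_col (c \<cdot>\<^sub>m 1\<^sub>m d :: int mat)"
    then have ij: "i < d" "j < d" by auto
    have "(det M \<cdot>\<^sub>m (N * M)) $$ (i, j) = (c \<cdot>\<^sub>m (det M \<cdot>\<^sub>m 1\<^sub>m d)) $$ (i, j)" using eq by simp
    then have "det M * (N * M) $$ (i, j) = det M * (c \<cdot>\<^sub>m 1\<^sub>m d) $$ (i, j)"
      using ij M N by (simp del: index_mult_mat(1))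
    then show "(N * M) $$ (i, j) = (c \<cdot>\<^sub>m 1\<^sub>m d) $$ (i, j)" using det by simp
  qed (use M N in auto)
qed

lemma smult_one_mult_vec:
  fixes z :: "int vec"
  assumes "z \<in> carrier_vec d"
  shows "(c \<cdot>\<^sub>m 1\<^sub>m d) *\<^sub>v z = c \<cdot>\<^sub>v z"
proof (rule eq_vecI)
  fix i assume "i < dim_vec (c \<cdot>\<^sub>v z)"
  then have i: "i < d" using assms by simp
  have "((c \<cdot>\<^sub>m 1\<^sub>m d) *\<^sub>v z) $ i = (\<Sum>j = 0..<d. if i = j then c * z $ j else 0)"
    using mult_mat_vec_sum[of "c \<cdot>\<^sub>m 1\<^sub>m d" d d z i] assms i by (auto intro!: sum.cong)
  then show "((c \<cdot>\<^sub>m 1\<^sub>m d) *\<^sub>v z) $ i = (c \<cdot>\<^sub>v z) $ i" using i assms by simp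
qed (use assms in simp)

text \<open>As \<open>N / c\<close> is the inverse of \<open>H\<close>, the vector \<open>u - v\<close> lies in \<open>H \<int>\<^sup>d\<close> iff \<open>N (u - v) / c\<close> is
  integral. So the residues of \<open>N u\<close> modulo \<open>c\<close> are a complete invariant of the class of \<open>u\<close>.\<close>

lemma lattice_cong_iff:
  fixes H N :: "int mat"
  assumes H: "H \<in> carrier_mat d d" and N: "N \<in> carrier_mat d d" and HN: "H * N = c \<cdot>\<^sub>m 1\<^sub>m d"
    and det: "det H \<noteq> 0" and c: "c \<noteq> 0" and u: "u \<in> carrier_vec d" and v: "v \<in> carrier_vec d"
  shows "lattice_cong H u v \<longleftrightarrow> (\<forall>i<d. (N *\<^sub>v u) $ i mod c = (N *\<^sub>v v) $ i mod c)"
proof -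
  have diff: "(N *\<^sub>v (u - v)) $ i = (N *\<^sub>v u) $ i - (N *\<^sub>v v) $ i" if "i < d" for i
    using mult_minus_distrib_mat_vec[OF N u v] N u v that by simp
  have "lattice_cong H u v \<longleftrightarrow> (\<exists>z\<in>carrier_vec d. N *\<^sub>v (u - v) = c \<cdot>\<^sub>v z)"
  proof
    assume "lattice_cong H u v"
    then obtain z where z: "z \<in> carrier_vec d" "u - v = H *\<^sub>v z" using H by (auto simp: lattice_cong_def)
    have "N *\<^sub>v (u - v) = (N * H) *\<^sub>v z" using z H N by (simp add: assoc_mult_mat_vec[of _ d d _ d])
    also have "\<dots> = c \<cdot>\<^sub>v z" using scaled_inverse_commute[OF H N HN det] z by (simp add: smult_one_mult_vec)
    finally show "\<exists>z\<in>carrier_vec d. N *\<^sub>v (u - v) = c \<cdot>\<^sub>v z" using z by blast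
  next
    assume "\<exists>z\<in>carrier_vec d. N *\<^sub>v (u - v) = c \<cdot>\<^sub>v z"
    then obtain z where z: "z \<in> carrier_vec d" "N *\<^sub>v (u - v) = c \<cdot>\<^sub>v z" by blast
    have "c \<cdot>\<^sub>v (u - v) = (H * N) *\<^sub>v (u - v)"
      using HN u v by (simp add: smult_one_mult_vec)
    also have "\<dots> = H *\<^sub>v (c \<cdot>\<^sub>v z)" using z H N u v by (simp add: assoc_mult_mat_vec[of _ d d _ d])
    also have "\<dots> = c \<cdot>\<^sub>v (H *\<^sub>v z)" using H z by (auto simp: mult_mat_vec[of _ d d])
    finally have eq: "c \<cdot>\<^sub>v (u - v) = c \<cdot>\<^sub>v (H *\<^sub>v z)" .
    have "u - v = H *\<^sub>v z"
    proof (rule eq_vecI)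
      fix i assume i: "i < dim_vec (H *\<^sub>v z)"
      then have "c * (u - v) $ i = c * (H *\<^sub>v z) $ i" using arg_cong[OF eq, of "\<lambda>x. x $ i"] H u v by simp
      then show "(u - v) $ i = (H *\<^sub>v z) $ i" using c by simp
    qed (use u v H in auto)
    then show "lattice_cong H u v" using z H by (auto simp: lattice_cong_def)
  qed
  also have "\<dots> \<longleftrightarrow> (\<forall>i<d. c dvd (N *\<^sub>v (u - v)) $ i)"
  proof
    assume "\<forall>i<d. c dvd (N *\<^sub>v (u - v)) $ i"
    then have "N *\<^sub>v (u - v) = c \<cdot>\<^sub>v vec d (\<lambda>i. (N *\<^sub>v (u - v)) $ i div c)"
      using N by (intro eq_vecI) auto
    then show "\<exists>z\<in>carrier_vec d. N *\<^sub>v (u - v) = c \<cdot>\<^sub>v z" by (intro bexI) auto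
  qed auto
  also have "\<dots> \<longleftrightarrow> (\<forall>i<d. (N *\<^sub>v u) $ i mod c = (N *\<^sub>v v) $ i mod c)"
    using diff by (auto simp: mod_eq_dvd_iff)
  finally show ?thesis .
qed

lemma abs_det_le:
  fixes M :: "int mat"
  assumes M: "M \<in> carrier_mat n n" and B: "\<And>i j. i < n \<Longrightarrow> j < n \<Longrightarrow> \<bar>M $$ (i, j)\<bar> \<le> B"
  shows "\<bar>det M\<bar> \<le> fact n * B ^ n"
proof -
  have "\<bar>det M\<bar> \<le> (\<Sum>p\<in>{p. p permutes {0..<n}}. \<bar>signof p * (\<Prod>i = 0..<n. M $$ (i, p i))\<bar>)"
    unfolding det_def'[OF M] by (rule sum_abs)
  also have "\<dots> \<le> (\<Sum>p\<in>{p. p permutes {0..<n}}. B ^ n)"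
  proof (rule sum_mono)
    fix p assume "p \<in> {p. p permutes {0..<n}}"
    then have p: "p permutes {0..<n}" by simp
    have "\<bar>signof p * (\<Prod>i = 0..<n. M $$ (i, p i))\<bar> = (\<Prod>i = 0..<n. \<bar>M $$ (i, p i)\<bar>)"
      by (simp add: abs_mult abs_prod sign_def)
    also have "\<dots> \<le> (\<Prod>i = 0..<n. B)"
      using B permutes_in_image[OF p] by (intro prod_mono) auto
    finally show "\<bar>signof p * (\<Prod>i = 0..<n. M $$ (i, p i))\<bar> \<le> B ^ n" by simp
  qed
  also have "\<dots> = fact n * B ^ n" by (simp add: card_permutations)
  finally show ?thesis .
qed


subsection \<open>Row elimination with exact division\<close>

definition dot :: "int list \<Rightarrow> int list \<Rightarrow> int" where
  "dot xs ys = sum_list (map2 (*) xs ys)"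

lemma dot_conv_sum: "length xs = n \<Longrightarrow> length ys = n \<Longrightarrow> dot xs ys = (\<Sum>i = 0..<n. xs ! i * ys ! i)"
  by (simp add: dot_def sum_list_sum_nth)

text \<open>Let the columns \<open>p\<close> and \<open>c\<close> belong to a multiple \<open>\<delta>\<close> of the inverse of a matrix, and replace the row
  paired with \<open>p\<close> by \<open>h\<close>. Then \<open>elim\<close> gives the new column in place of \<open>c\<close>, for the multiple \<open>dot h p\<close>.\<close>

definition elim_raw :: "int list \<Rightarrow> int list \<Rightarrow> int list \<Rightarrow> int list" where
  "elim_raw h p c = map2 (\<lambda>x y. dot h p * x - dot h c * y) c p"

definition elim :: "int list \<Rightarrow> int \<Rightarrow> int list \<Rightarrow> int list \<Rightarrow> int list" where
  "elim h \<delta> p c = map (\<lambda>x. x div \<delta>) (elim_raw h p c)"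

lemma length_elim_raw [simp]: "length (elim_raw h p c) = min (length c) (length p)"
  by (simp add: elim_raw_def)

lemma length_elim [simp]: "length (elim h \<delta> p c) = min (length c) (length p)"
  by (simp add: elim_def)

definition rowmat :: "nat \<Rightarrow> int list list \<Rightarrow> int mat" where
  "rowmat d R = mat d d (\<lambda>(i, j). R ! i ! j)"

definition colmat :: "nat \<Rightarrow> int list list \<Rightarrow> int mat" where
  "colmat d C = mat d d (\<lambda>(i, j). C ! j ! i)"

lemma rowmat_carrier [simp]: "rowmat d R \<in> carrier_mat d d"
  and colmat_carrier [simp]: "colmat d C \<in> carrier_mat d d"
  by (simp_all add: rowmat_def colmat_def)

text \<open>Elimination moves the pivot to the front of the list, which permutes rows; hence all statements
  about determinants there are up to sign.\<close>

lemma abs_det_rowmat_mset: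
  assumes "mset R = mset R'" "length R = d"
  shows "\<bar>det (rowmat d R)\<bar> = \<bar>det (rowmat d R')\<bar>"
proof -
  have len: "length R' = d" using assms by (metis size_mset)
  obtain p where p: "p permutes {..<length R'}" "permute_list p R' = R"
    using mset_eq_permutation[OF assms(1)] by blast
  have p': "p permutes {0..<d}" using p(1) len by (simp add: lessThan_atLeast0)
  have "rowmat d R = mat d d (\<lambda>(i, j). rowmat d R' $$ (p i, j))"
  proof (rule eq_matI)
    fix i j assume "i < dim_row (mat d d (\<lambda>(i, j). rowmat d R' $$ (p i, j)))"
      "j < dim_col (mat d d (\<lambda>(i, j). rowmat d R' $$ (p i, j)))"
    then have ij: "i < d" "j < d" by auto
    then have "p i < d" using permutes_in_image[OF p'] by auto
    then show "rowmat d R $$ (i, j) = mat d d (\<lambda>(i, j). rowmat d R' $$ (p i, j)) $$ (i, j)"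
      using ij permute_list_nth[OF p(1), of i] len p(2) by (simp add: rowmat_def)
  qed (simp_all add: rowmat_def)
  then have "det (rowmat d R) = signof p * det (rowmat d R')"
    using det_permute_rows[OF rowmat_carrier p'] by metis
  then show ?thesis by (simp add: abs_mult sign_def)
qed

text \<open>Row \<open>i\<close> and column \<open>i\<close> have product \<open>c\<close>; all other products vanish. This form is
  insensitive to a simultaneous reordering of the two lists.\<close>

definition biorthogonal :: "(int list \<times> int list) list \<Rightarrow> int \<Rightarrow> bool" where
  "biorthogonal ps c \<longleftrightarrow> (\<forall>p\<in>set ps. dot (fst p) (snd p) = c) \<and>
     sorted_wrt (\<lambda>p q. dot (fst p) (snd q) = 0 \<and> dot (fst q) (snd p) = 0) ps"

lemma biorthogonal_nth:
  assumes "biorthogonal ps c" "i < length ps" "j < length ps"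
  shows "dot (fst (ps ! i)) (snd (ps ! j)) = (if i = j then c else 0)"
proof -
  have s: "\<And>i j. i < j \<Longrightarrow> j < length ps \<Longrightarrow>
      dot (fst (ps ! i)) (snd (ps ! j)) = 0 \<and> dot (fst (ps ! j)) (snd (ps ! i)) = 0"
    using assms(1) unfolding biorthogonal_def sorted_wrt_iff_nth_less by blast
  show ?thesis
    using assms s[of i j] s[of j i] unfolding biorthogonal_def by (cases i j rule: linorder_cases) auto
qed

lemma biorthogonal_mat:
  assumes "biorthogonal (zip R C) c" "length R = d" "length C = d"
    "\<And>r. r \<in> set R \<Longrightarrow> length r = d" "\<And>r. r \<in> set C \<Longrightarrow> length r = d"
  shows "rowmat d R * colmat d C = c \<cdot>\<^sub>m 1\<^sub>m d"
proof (rule eq_matI)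
  fix i j assume "i < dim_row (c \<cdot>\<^sub>m 1\<^sub>m d)" "j < dim_col (c \<cdot>\<^sub>m 1\<^sub>m d :: int mat)"
  then have ij: "i < d" "j < d" by auto
  have "(rowmat d R * colmat d C) $$ (i, j) = dot (R ! i) (C ! j)"
    using ij assms by (simp add: rowmat_def colmat_def scalar_prod_def dot_conv_sum[of _ d])
  also have "\<dots> = (if i = j then c else 0)"
    using biorthogonal_nth[OF assms(1), of i j] ij assms(2,3) by simp
  finally show "(rowmat d R * colmat d C) $$ (i, j) = (c \<cdot>\<^sub>m 1\<^sub>m d) $$ (i, j)" using ij by simp
qed (simp_all add: rowmat_def colmat_def)

lemma dot_elim_raw:
  assumes "length r = d" "length p = d" "length c = d"
  shows "dot r (elim_raw h p c) = dot h p * dot r c - dot h c * dot r p"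
proof -
  have "dot r (elim_raw h p c) = (\<Sum>i = 0..<d. r ! i * (dot h p * c ! i - dot h c * p ! i))"
    using assms by (subst dot_conv_sum[of _ d]) (auto simp: elim_raw_def intro!: sum.cong)
  also have "\<dots> = dot h p * (\<Sum>i = 0..<d. r ! i * c ! i) - dot h c * (\<Sum>i = 0..<d. r ! i * p ! i)"
    by (simp add: sum_distrib_left sum_subtractf[symmetric] algebra_simps)
  finally show ?thesis using assms by (simp add: dot_conv_sum[of _ d])
qed

lemma dot_map_div:
  assumes "length r = d" "length x = d" "\<And>i. i < d \<Longrightarrow> \<delta> dvd x ! i"
  shows "\<delta> * dot r (map (\<lambda>x. x div \<delta>) x) = dot r x"
proof -
  have "\<delta> * dot r (map (\<lambda>x. x div \<delta>) x) = (\<Sum>i = 0..<d. r ! i * (\<delta> * (x ! i div \<delta>)))"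
    using assms by (auto simp: dot_conv_sum[of _ d] sum_distrib_left mult.left_commute intro!: sum.cong)
  also have "\<dots> = (\<Sum>i = 0..<d. r ! i * x ! i)" using assms by (intro sum.cong) auto
  finally show ?thesis using assms by (simp add: dot_conv_sum[of _ d])
qed

lemma dot_scale: "length r = d \<Longrightarrow> length x = d \<Longrightarrow> dot r (map (\<lambda>x. k * x) x) = k * dot r x"
  by (simp add: dot_conv_sum[of _ d] sum_distrib_left mult.left_commute)

lemma biorthogonal_map:
  assumes "biorthogonal (zip rs cs) \<delta>" "length rs = length cs"
    and f: "\<And>r c. r \<in> set rs \<Longrightarrow> c \<in> set cs \<Longrightarrow> k * dot r (f c) = l * dot r c" and "k \<noteq> 0" "k * c' = l * \<delta>"
  shows "biorthogonal (zip rs (map f cs)) c'"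
proof -
  have eq: "zip rs (map f cs) = map (\<lambda>(r, c). (r, f c)) (zip rs cs)" by (simp add: zip_map2)
  have mem: "fst p \<in> set rs" "snd p \<in> set cs" if "p \<in> set (zip rs cs)" for p
    using that set_zip_leftD[of "fst p" "snd p"] set_zip_rightD[of "fst p" "snd p"] by simp_all
  have "dot (fst p) (f (snd q)) = 0" if "p \<in> set (zip rs cs)" "q \<in> set (zip rs cs)" "dot (fst p) (snd q) = 0" for p q
    using f[OF mem(1)[OF that(1)] mem(2)[OF that(2)]] that(3) \<open>k \<noteq> 0\<close> by simp
  then have "sorted_wrt (\<lambda>p q. dot (fst p) (f (snd q)) = 0 \<and> dot (fst q) (f (snd p)) = 0) (zip rs cs)"
    using assms(1) unfolding biorthogonal_def by (elim conjE) (rule sorted_wrt_mono_rel, auto)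
  moreover have "dot (fst p) (f (snd p)) = c'" if "p \<in> set (zip rs cs)" for p
  proof -
    have "k * dot (fst p) (f (snd p)) = k * c'"
      using f[OF mem(1)[OF that] mem(2)[OF that]] that assms(1,5) by (simp add: biorthogonal_def)
    then show ?thesis using \<open>k \<noteq> 0\<close> by simp
  qed
  ultimately show ?thesis unfolding eq biorthogonal_def
    by (auto simp: sorted_wrt_map split_def)
qed

text \<open>The undivided columns form \<open>\<delta> * dot h p\<close> times the inverse of the new matrix. Expanding along the new
  row shows that its determinant is \<open>dot h p\<close> up to sign, so these columns are \<open>\<delta>\<close> times the adjugate up to
  sign, and the division by \<open>\<delta>\<close> is exact.\<close>

lemma elim_step:
  assumes R: "length (r0 # rs) = d" "\<And>r. r \<in> set (r0 # rs) \<Longrightarrow> length r = d"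
    and C: "length (p # cs) = d" "\<And>c. c \<in> set (p # cs) \<Longrightarrow> length c = d"
    and bi: "biorthogonal (zip (r0 # rs) (p # cs)) \<delta>"
    and det: "\<bar>det (rowmat d (r0 # rs))\<bar> = \<bar>\<delta>\<bar>" and \<delta>: "\<delta> \<noteq> 0"
    and h: "length h = d" and u: "dot h p \<noteq> 0"
  shows "biorthogonal (zip (h # rs) (p # map (elim h \<delta> p) cs)) (dot h p)"
    and "\<bar>det (rowmat d (h # rs))\<bar> = \<bar>dot h p\<bar>"
proof -
  have d: "0 < d" using R(1) by auto
  define M where "M = rowmat d (r0 # rs)"
  define M' where "M' = rowmat d (h # rs)"
  have M: "M \<in> carrier_mat d d" "M' \<in> carrier_mat d d" by (simp_all add: M_def M'_def)
  have len_p: "length p = d" using C(2) by simp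
  have "M * colmat d (p # cs) = \<delta> \<cdot>\<^sub>m 1\<^sub>m d"
    unfolding M_def by (rule biorthogonal_mat[OF bi R(1) C(1) R(2) C(2)])
  from adj_mat_unique[OF M(1) colmat_carrier this]
  have adj: "det M \<cdot>\<^sub>m colmat d (p # cs) = \<delta> \<cdot>\<^sub>m adj_mat M" .
  have p_cof: "det M * p ! j = \<delta> * cofactor M 0 j" if "j < d" for j
    using arg_cong[OF adj, of "\<lambda>X. X $$ (j, 0)"] that d M adj_mat(1)[OF M(1)]
    by (simp add: colmat_def adj_mat_def)
  have del: "mat_delete M' 0 j = mat_delete M 0 j" for j
    unfolding mat_delete_def by (rule eq_matI) (auto simp: M_def M'_def rowmat_def)
  have "\<delta> * det M' = (\<Sum>j<d. h ! j * (\<delta> * cofactor M 0 j))"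
    unfolding laplace_expansion_row[OF M(2) d] sum_distrib_left
    using d by (intro sum.cong) (auto simp: cofactor_def del, simp add: M'_def rowmat_def)
  also have "\<dots> = det M * (\<Sum>j = 0..<d. h ! j * p ! j)"
    unfolding sum_distrib_left by (intro sum.cong) (auto simp: p_cof[symmetric])
  also have "(\<Sum>j = 0..<d. h ! j * p ! j) = dot h p" using h len_p by (simp add: dot_conv_sum)
  finally have "\<bar>\<delta> * det M'\<bar> = \<bar>det M * dot h p\<bar>" by simp
  then have "\<bar>\<delta>\<bar> * \<bar>det M'\<bar> = \<bar>\<delta>\<bar> * \<bar>dot h p\<bar>" using det by (simp add: M_def abs_mult)
  then show det': "\<bar>det (rowmat d (h # rs))\<bar> = \<bar>dot h p\<bar>" using \<delta> by (simp add: M'_def)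
  have tl: "biorthogonal (zip rs cs) \<delta>" and p0: "\<And>r. r \<in> set rs \<Longrightarrow> dot r p = 0"
  proof -
    show "biorthogonal (zip rs cs) \<delta>" using bi by (simp add: biorthogonal_def)
    have *: "\<forall>q\<in>set (zip rs cs). dot (fst q) p = 0" using bi by (simp add: biorthogonal_def)
    fix r assume "r \<in> set rs"
    then obtain i where "i < length rs" "r = rs ! i" by (auto simp: in_set_conv_nth)
    then have "(r, cs ! i) \<in> set (zip rs cs)" using R(1) C(1) by (auto simp: set_zip)
    then show "dot r p = 0" using * by force
  qed
  have raw: "dot r (elim_raw h p c) = dot h p * dot r c" if "r \<in> set rs" "c \<in> set cs" for r c
    using dot_elim_raw[of r d p c h] R(2) C(2) that p0 by simp
  have h_raw: "dot h (elim_raw h p c) = 0" if "c \<in> set cs" for c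
    using dot_elim_raw[of h d p c h] C(2) that h by simp
  have zipl: "dot (fst q) p = 0" "length (fst q) = d" if "q \<in> set (zip rs xs)" for q and xs :: "int list list"
    using that set_zip_leftD[of "fst q" "snd q"] p0 R(2) by simp_all
  have len_eq: "length rs = length cs" using R(1) C(1) by simp
  have "biorthogonal (zip rs (map (elim_raw h p) cs)) (\<delta> * dot h p)"
    by (rule biorthogonal_map[OF tl len_eq, where k = 1 and l = "dot h p"]) (auto simp: raw)
  moreover have "dot h (snd q) = 0" if "q \<in> set (zip rs (map (elim_raw h p) cs))" for q
    using set_zip_rightD[of "fst q" "snd q", simplified, OF that] h_raw by auto
  ultimately have "biorthogonal (zip (h # rs) (map (\<lambda>x. \<delta> * x) p # map (elim_raw h p) cs)) (\<delta> * dot h p)"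
    unfolding biorthogonal_def by (auto simp: dot_scale[of _ d] h len_p zipl)
  then have "M' * colmat d (map (\<lambda>x. \<delta> * x) p # map (elim_raw h p) cs) = (\<delta> * dot h p) \<cdot>\<^sub>m 1\<^sub>m d"
    unfolding M'_def by (rule biorthogonal_mat) (use R C h in auto)
  from adj_mat_unique[OF M(2) colmat_carrier this]
  have adj': "det M' \<cdot>\<^sub>m colmat d (map (\<lambda>x. \<delta> * x) p # map (elim_raw h p) cs) = (\<delta> * dot h p) \<cdot>\<^sub>m adj_mat M'" .
  have dvd: "\<delta> dvd elim_raw h p c ! i" if c: "c \<in> set cs" and i: "i < d" for c i
  proof -
    obtain j where j: "j < length cs" "c = cs ! j" using c by (auto simp: in_set_conv_nth)
    then have "Suc j < d" using C(1) by simp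
    then have "det M' * elim_raw h p c ! i = (\<delta> * dot h p) * adj_mat M' $$ (i, Suc j)"
      using arg_cong[OF adj', of "\<lambda>X. X $$ (i, Suc j)"] j i M adj_mat(1)[OF M(2)]
      by (simp add: colmat_def)
    moreover have "det M' = dot h p \<or> det M' = - dot h p"
      using det' unfolding M'_def by linarith
    ultimately have "dot h p * elim_raw h p c ! i = dot h p * (\<delta> * adj_mat M' $$ (i, Suc j)) \<or>
        dot h p * elim_raw h p c ! i = dot h p * (\<delta> * - adj_mat M' $$ (i, Suc j))"
      by (auto simp: algebra_simps)
    then show ?thesis using u by (metis dvd_triv_left mult_left_cancel)
  qed
  have el: "\<delta> * dot r (elim h \<delta> p c) = dot r (elim_raw h p c)" if "length r = d" "c \<in> set cs" for r c
    unfolding elim_def using that C len_p by (intro dot_map_div[of _ d] dvd) auto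
  have "biorthogonal (zip rs (map (elim h \<delta> p) cs)) (dot h p)"
    by (rule biorthogonal_map[OF tl len_eq, where k = \<delta> and l = "dot h p"])
       (use R(2) \<delta> in \<open>auto simp: el raw\<close>)
  moreover have "dot h (elim h \<delta> p c) = 0" if "c \<in> set cs" for c
    using el[OF h that] h_raw[OF that] \<delta> by simp
  then have "dot h (snd q) = 0" if "q \<in> set (zip rs (map (elim h \<delta> p) cs))" for q
    using set_zip_rightD[of "fst q" "snd q", simplified, OF that] by auto
  ultimately show "biorthogonal (zip (h # rs) (p # map (elim h \<delta> p) cs)) (dot h p)"
    unfolding biorthogonal_def by (auto simp: zipl(1))
qed


text \<open>The result is the pivot, in a list of length at most one, and the other columns.\<close>

definition pick :: "int list \<Rightarrow> int list list \<Rightarrow> int list list \<times> int list list" where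
  "pick h cs = foldr (\<lambda>c s. if fst s = [] \<and> dot h c \<noteq> 0 then ([c], snd s) else (fst s, c # snd s)) cs ([], [])"

lemma pick_cases:
  obtains "\<forall>c\<in>set cs. dot h c = 0" "pick h cs = ([], cs)"
  | cs1 p cs2 where "cs = cs1 @ p # cs2" "pick h cs = ([p], cs1 @ cs2)" "dot h p \<noteq> 0"
proof -
  have "(\<forall>c\<in>set cs. dot h c = 0) \<and> pick h cs = ([], cs) \<or>
    (\<exists>cs1 p cs2. cs = cs1 @ p # cs2 \<and> pick h cs = ([p], cs1 @ cs2) \<and> dot h p \<noteq> 0)"
  proof (induction cs)
    case (Cons c cs)
    have p: "pick h (c # cs) = (if fst (pick h cs) = [] \<and> dot h c \<noteq> 0 then ([c], snd (pick h cs))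
        else (fst (pick h cs), c # snd (pick h cs)))"
      by (simp add: pick_def)
    from Cons show ?case
    proof (elim disjE exE conjE)
      fix cs1 q cs2 assume "cs = cs1 @ q # cs2" "pick h cs = ([q], cs1 @ cs2)" "dot h q \<noteq> 0"
      then show ?case unfolding p by (intro disjI2 exI[of _ "c # cs1"] exI[of _ q] exI[of _ cs2]) simp
    next
      assume a: "\<forall>c\<in>set cs. dot h c = 0" "pick h cs = ([], cs)"
      show ?case
      proof (cases "dot h c = 0")
        case False
        then show ?thesis using a unfolding p
          by (intro disjI2 exI[of _ "[]"] exI[of _ c] exI[of _ cs]) simp
      qed (use a p in simp)
    qed
  qed (simp add: pick_def)
  then show thesis using that by blast
qed

text \<open>A state consists of the current multiple, the columns paired with the rows inserted so far, and the
  columns still paired with unit vectors.\<close>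

type_synonym elim_state = "int \<times> int list list \<times> int list list"

definition insert_row :: "int list \<Rightarrow> elim_state \<Rightarrow> elim_state" where
  "insert_row h s = (let r = pick h (snd (snd s)) in
     if fst r = [] then s
     else (dot h (hd (fst r)), hd (fst r) # map (elim h (fst s) (hd (fst r))) (fst (snd s)),
       map (elim h (fst s) (hd (fst r))) (snd r)))"

text \<open>The identity matrix of size \<open>length ks\<close>, for distinct \<open>ks\<close>.\<close>

definition ident :: "int list \<Rightarrow> int list list" where
  "ident ks = map (\<lambda>i. map (\<lambda>j. of_bool (i = j)) ks) ks"

definition eliminate :: "int list list \<Rightarrow> int list \<Rightarrow> elim_state" where
  "eliminate R ks = foldr insert_row R (1, [], ident ks)"

text \<open>The unit vectors \<open>us\<close> are the rows that have not been replaced yet.\<close>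

definition elim_inv :: "nat \<Rightarrow> int list \<Rightarrow> int list list \<Rightarrow> elim_state \<Rightarrow> int list list \<Rightarrow> bool" where
  "elim_inv d ks R s us \<longleftrightarrow>
     length (fst (snd s)) = length R \<and> length (snd (snd s)) = length us \<and> length R + length us = d \<and>
     set us \<subseteq> set (ident ks) \<and> (\<forall>r\<in>set (R @ us). length r = d) \<and>
     (\<forall>c\<in>set (fst (snd s) @ snd (snd s)). length c = d) \<and>
     biorthogonal (zip (R @ us) (fst (snd s) @ snd (snd s))) (fst s) \<and>
     \<bar>det (rowmat d (R @ us))\<bar> = \<bar>fst s\<bar> \<and> fst s \<noteq> 0"

lemma elim_inv_init:
  assumes ks: "distinct ks" "length ks = d"
  shows "elim_inv d ks [] (1, [], ident ks) (ident ks)"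
proof -
  have nth: "ident ks ! i ! j = of_bool (i = j)" if "i < d" "j < d" for i j
    using that ks by (simp add: ident_def nth_eq_iff_index_eq)
  have len: "length (ident ks) = d" "\<And>r. r \<in> set (ident ks) \<Longrightarrow> length r = d"
    using ks by (auto simp: ident_def)
  have "rowmat d (ident ks) = 1\<^sub>m d" by (rule eq_matI) (auto simp: rowmat_def nth)
  moreover have dot: "dot (ident ks ! i) (ident ks ! j) = of_bool (i = j)" if ij: "i < d" "j < d" for i j
  proof -
    have "dot (ident ks ! i) (ident ks ! j) = (\<Sum>k = 0..<d. of_bool (i = k) * of_bool (j = k))"
      using ij len by (subst dot_conv_sum[of _ d]) (auto simp: nth intro!: sum.cong)
    also have "\<dots> = (\<Sum>k = 0..<d. if k = i then of_bool (i = j) else 0)" by (intro sum.cong) auto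
    finally show ?thesis using ij by simp
  qed
  have "biorthogonal (zip (ident ks) (ident ks)) 1"
    unfolding biorthogonal_def sorted_wrt_iff_nth_less
  proof (intro conjI ballI)
    fix q assume "q \<in> set (zip (ident ks) (ident ks))"
    then obtain i where "i < d" "q = (ident ks ! i, ident ks ! i)" using len by (auto simp: set_zip)
    then show "dot (fst q) (snd q) = 1" using dot[of i i] by simp
  qed (use dot len in auto)
  ultimately show ?thesis unfolding elim_inv_def using len by auto
qed

text \<open>As long as the rows are independent, some remaining column is not orthogonal to the new row:
  otherwise the new row would be a rational combination of the rows that were inserted before.\<close>

lemma exists_pivot:
  assumes inv: "elim_inv d ks R s us" and det: "det (rowmat d (pre @ h # R)) \<noteq> 0"
    and len: "length (pre @ h # R) = d" "length h = d"
  shows "\<exists>c\<in>set (snd (snd s)). dot h c \<noteq> 0"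
proof (rule ccontr)
  assume "\<not> ?thesis"
  then have zero: "\<And>c. c \<in> set (snd (snd s)) \<Longrightarrow> dot h c = 0" by blast
  define cs where "cs = fst (snd s) @ snd (snd s)"
  define M where "M = rowmat d (R @ us)"
  define G where "G = rowmat d (pre @ h # R)"
  \<comment> \<open>\<open>z\<close> is orthogonal to all rows of \<open>G\<close> but \<open>h\<close>, with which it has product \<open>det G\<close>\<close>
  define z where "z k = adj_mat G $$ (k, length pre)" for k
  note inv = inv[unfolded elim_inv_def]
  have cs: "length cs = d" "\<And>c. c \<in> set cs \<Longrightarrow> length c = d" using inv by (auto simp: cs_def)
  have "M * colmat d cs = fst s \<cdot>\<^sub>m 1\<^sub>m d"
    unfolding M_def by (rule biorthogonal_mat) (use inv cs in \<open>auto simp: cs_def\<close>)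
  moreover have "det M \<noteq> 0" using inv by (auto simp: M_def)
  ultimately have comm: "colmat d cs * M = fst s \<cdot>\<^sub>m 1\<^sub>m d"
    using scaled_inverse_commute[of M d "colmat d cs"] by (simp add: M_def)
  have comb: "fst s * h ! k = (\<Sum>j = 0..<d. dot h (cs ! j) * (R @ us) ! j ! k)" if k: "k < d" for k
  proof -
    have "(\<Sum>j = 0..<d. dot h (cs ! j) * (R @ us) ! j ! k) =
        (\<Sum>j = 0..<d. \<Sum>i = 0..<d. h ! i * (cs ! j ! i * (R @ us) ! j ! k))"
      using cs len(2) by (intro sum.cong refl) (simp add: dot_conv_sum[of _ d] sum_distrib_right mult.assoc)
    also have "\<dots> = (\<Sum>i = 0..<d. h ! i * (\<Sum>j = 0..<d. cs ! j ! i * (R @ us) ! j ! k))"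
      by (subst sum.swap) (simp add: sum_distrib_left)
    also have "\<dots> = (\<Sum>i = 0..<d. h ! i * (colmat d cs * M) $$ (i, k))"
      using k by (intro sum.cong refl) (simp add: colmat_def M_def rowmat_def scalar_prod_def)
    also have "\<dots> = (\<Sum>i = 0..<d. if i = k then fst s * h ! k else 0)"
      unfolding comm using k by (intro sum.cong) auto
    finally show ?thesis using k by simp
  qed
  have G: "G \<in> carrier_mat d d" by (simp add: G_def)
  have pre: "length pre < d" using len by simp
  have Gz: "(\<Sum>k = 0..<d. (pre @ h # R) ! i ! k * z k) = (if i = length pre then det G else 0)" if i: "i < d" for i
  proof -
    have "(G * adj_mat G) $$ (i, length pre) = (det G \<cdot>\<^sub>m 1\<^sub>m d) $$ (i, length pre)"
      using adj_mat(2)[OF G] by simp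
    moreover have "(G * adj_mat G) $$ (i, length pre) = (\<Sum>k = 0..<d. (pre @ h # R) ! i ! k * z k)"
      using i pre G adj_mat(1)[OF G] by (auto simp: scalar_prod_def z_def G_def rowmat_def intro!: sum.cong)
    ultimately show ?thesis using i pre by simp
  qed
  have "fst s * det G = (\<Sum>k = 0..<d. fst s * h ! k * z k)"
    using Gz[OF pre] by (simp add: sum_distrib_left[symmetric] mult.assoc nth_append)
  also have "\<dots> = (\<Sum>k = 0..<d. \<Sum>j = 0..<d. dot h (cs ! j) * (R @ us) ! j ! k * z k)"
    by (intro sum.cong refl) (simp add: comb sum_distrib_right)
  also have "\<dots> = (\<Sum>j = 0..<d. dot h (cs ! j) * (\<Sum>k = 0..<d. (R @ us) ! j ! k * z k))"
    by (subst sum.swap) (simp add: sum_distrib_left mult.assoc)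
  also have "\<dots> = 0"
  proof (rule sum.neutral, rule ballI)
    fix j assume "j \<in> {0..<d}"
    then have j: "j < d" by simp
    show "dot h (cs ! j) * (\<Sum>k = 0..<d. (R @ us) ! j ! k * z k) = 0"
    proof (cases "j < length R")
      case True
      then have "(R @ us) ! j = (pre @ h # R) ! (length pre + 1 + j)" by (simp add: nth_append)
      moreover have "length pre + 1 + j < d" using True len by simp
      ultimately show ?thesis using Gz[of "length pre + 1 + j"] by simp
    next
      case False
      then have "cs ! j \<in> set (snd (snd s))" using inv j cs(1) by (auto simp: cs_def nth_append)
      then show ?thesis using zero by simp
    qed
  qed
  finally show False using inv det by (simp add: G_def)
qed

lemma elim_inv_step:
  assumes inv: "elim_inv d ks R s us" and det: "det (rowmat d (pre @ h # R)) \<noteq> 0"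
    and len: "length (pre @ h # R) = d" "length h = d"
  shows "\<exists>us'. elim_inv d ks (h # R) (insert_row h s) us'"
proof -
  obtain \<delta> don todo where s: "s = (\<delta>, don, todo)" by (cases s)
  obtain cs1 p cs2 where todo: "todo = cs1 @ p # cs2" and pick: "pick h todo = ([p], cs1 @ cs2)"
    and u: "dot h p \<noteq> 0"
    using exists_pivot[OF assms] by (cases rule: pick_cases[of todo h]) (auto simp: s)
  note i = inv[unfolded elim_inv_def s fst_conv snd_conv todo]
  define us1 u0 us2 where "us1 = take (length cs1) us" and "u0 = us ! length cs1" and "us2 = drop (Suc (length cs1)) us"
  have us: "us = us1 @ u0 # us2" "length us1 = length cs1" "length us2 = length cs2"
  proof -
    have l: "length us = Suc (length cs1 + length cs2)" using i by simp
    then show "us = us1 @ u0 # us2" unfolding us1_def u0_def us2_def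
      by (intro id_take_nth_drop) simp
    show "length us1 = length cs1" "length us2 = length cs2" using l by (simp_all add: us1_def us2_def)
  qed
  let ?rs = "R @ us1 @ us2" and ?cs = "don @ cs1 @ cs2"
  have lens: "length don = length R" "length R + (length us1 + Suc (length us2)) = d"
    using i us(2,3) unfolding us(1) by simp_all
  have bi0: "biorthogonal (zip (R @ us) (don @ cs1 @ p # cs2)) \<delta>"
    and det0: "\<bar>det (rowmat d (R @ us))\<bar> = \<bar>\<delta>\<bar>" and \<delta>: "\<delta> \<noteq> 0"
    and setus: "set us \<subseteq> set (ident ks)"
    and lenr: "\<forall>r\<in>set (R @ us). length r = d" and lenc: "\<forall>c\<in>set (don @ cs1 @ p # cs2). length c = d"
    using i by blast+
  have z: "zip (R @ us) (don @ cs1 @ p # cs2) = zip R don @ zip us1 cs1 @ (u0, p) # zip us2 cs2"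
    unfolding us(1) using lens us(2,3) by simp
  have bi: "biorthogonal (zip (u0 # ?rs) (p # ?cs)) \<delta>"
    using bi0 lens us(2,3) unfolding z biorthogonal_def by (simp add: sorted_wrt_append) blast
  have "mset (u0 # ?rs) = mset (R @ us)" unfolding us(1) by simp
  then have "\<bar>det (rowmat d (u0 # ?rs))\<bar> = \<bar>det (rowmat d (R @ us))\<bar>"
    by (rule abs_det_rowmat_mset) (use lens in simp)
  then have d: "\<bar>det (rowmat d (u0 # ?rs))\<bar> = \<bar>\<delta>\<bar>" using det0 by simp
  have R: "length (u0 # ?rs) = d" "\<And>r. r \<in> set (u0 # ?rs) \<Longrightarrow> length r = d"
    using lens lenr unfolding us(1) by auto
  have C: "length (p # ?cs) = d" "\<And>r. r \<in> set (p # ?cs) \<Longrightarrow> length r = d"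
    using lens lenc us(2,3) by auto
  note step = elim_step[OF R C bi d \<delta> len(2) u]
  have ins: "insert_row h s = (dot h p, p # map (elim h \<delta> p) don, map (elim h \<delta> p) (cs1 @ cs2))"
    by (simp add: insert_row_def s pick)
  have "elim_inv d ks (h # R) (insert_row h s) (us1 @ us2)"
    unfolding elim_inv_def ins fst_conv snd_conv
  proof (intro conjI)
    show "biorthogonal (zip ((h # R) @ us1 @ us2) ((p # map (elim h \<delta> p) don) @ map (elim h \<delta> p) (cs1 @ cs2))) (dot h p)"
      using step(1) by simp
    show "\<bar>det (rowmat d ((h # R) @ us1 @ us2))\<bar> = \<bar>dot h p\<bar>" using step(2) by simp
    show "\<forall>c\<in>set ((p # map (elim h \<delta> p) don) @ map (elim h \<delta> p) (cs1 @ cs2)). length c = d"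
      using C(2) by auto
    show "\<forall>r\<in>set ((h # R) @ us1 @ us2). length r = d" using R(2) len(2) by auto
    show "set (us1 @ us2) \<subseteq> set (ident ks)" using setus unfolding us(1) by auto
    show "length (p # map (elim h \<delta> p) don) = length (h # R)" using lens by simp
    show "length (map (elim h \<delta> p) (cs1 @ cs2)) = length (us1 @ us2)" using us(2,3) by simp
    show "length (h # R) + length (us1 @ us2) = d" using lens by simp
  qed (rule u)
  then show ?thesis by blast
qed

lemma elim_inv_suffix:
  assumes "distinct ks" "length ks = d" "length (pre @ R) = d" "\<And>r. r \<in> set (pre @ R) \<Longrightarrow> length r = d"
    "det (rowmat d (pre @ R)) \<noteq> 0"
  shows "\<exists>us. elim_inv d ks R (foldr insert_row R (1, [], ident ks)) us"
  using assms(3-5)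
proof (induction R arbitrary: pre)
  case Nil
  then show ?case using elim_inv_init[OF assms(1,2)] by auto
next
  case (Cons h R)
  obtain us where "elim_inv d ks R (foldr insert_row R (1, [], ident ks)) us"
    using Cons.IH[of "pre @ [h]"] Cons.prems by auto
  from elim_inv_step[OF this Cons.prems(3,1)] Cons.prems(2) show ?case by auto
qed

text \<open>By uniqueness of the adjugate, the columns are cofactors of a matrix whose rows are rows of \<open>R\<close> and
  unit vectors. So the numbers that occur during elimination have polynomially many bits.\<close>

lemma elim_inv_bound:
  assumes inv: "elim_inv d ks R s us" and B: "\<And>r x. r \<in> set R \<Longrightarrow> x \<in> set r \<Longrightarrow> \<bar>x\<bar> \<le> B" "1 \<le> B"
  shows "\<bar>fst s\<bar> \<le> fact d * B ^ d"
    "c \<in> set (fst (snd s) @ snd (snd s)) \<Longrightarrow> x \<in> set c \<Longrightarrow> \<bar>x\<bar> \<le> fact d * B ^ d"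
proof -
  note i = inv[unfolded elim_inv_def]
  define M where "M = rowmat d (R @ us)"
  define cs where "cs = fst (snd s) @ snd (snd s)"
  have M: "M \<in> carrier_mat d d" by (simp add: M_def)
  have ent: "\<bar>M $$ (i, j)\<bar> \<le> B" if ij: "i < d" "j < d" for i j
  proof -
    have len: "length (R @ us) = d" "\<And>r. r \<in> set (R @ us) \<Longrightarrow> length r = d"
      and us: "set us \<subseteq> set (ident ks)" using i by auto
    define r where "r = (R @ us) ! i"
    have r: "r \<in> set (R @ us)" unfolding r_def using ij len(1) by (intro nth_mem) simp
    have x: "r ! j \<in> set r" using ij len(2)[OF r] by (intro nth_mem) simp
    have "\<bar>r ! j\<bar> \<le> B"
    proof (cases "r \<in> set R")
      case True
      then show ?thesis by (rule B(1)[OF _ x])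
    next
      case False
      then have "r \<in> set (ident ks)" using r us by auto
      then obtain k where "r = map (\<lambda>j. of_bool (k = j)) ks" by (auto simp: ident_def)
      with x have "r ! j \<in> {0, 1}" by auto
      then show ?thesis using B(2) by auto
    qed
    then have "\<bar>(R @ us) ! i ! j\<bar> \<le> B" by (simp only: r_def)
    then show ?thesis using ij by (simp add: M_def rowmat_def)
  qed
  have "\<bar>det M\<bar> \<le> fact d * B ^ d" by (rule abs_det_le[OF M ent])
  then show "\<bar>fst s\<bar> \<le> fact d * B ^ d" using i by (simp add: M_def)
  assume c: "c \<in> set (fst (snd s) @ snd (snd s))" and x: "x \<in> set c"
  have "length cs = d" using i by (auto simp: cs_def)
  then obtain k where k: "k < d" "c = cs ! k" using c unfolding cs_def[symmetric] in_set_conv_nth by blast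
  have "length c = d" using c i by blast
  then obtain l where l: "l < d" "x = c ! l" using x by (auto simp: in_set_conv_nth)
  have "M * colmat d cs = fst s \<cdot>\<^sub>m 1\<^sub>m d"
    unfolding M_def by (rule biorthogonal_mat) (use i in \<open>auto simp: cs_def\<close>)
  from arg_cong[OF adj_mat_unique[OF M colmat_carrier this], of "\<lambda>X. X $$ (l, k)"]
  have "det M * x = fst s * cofactor M k l"
    using k l M adj_mat(1)[OF M] by (simp add: colmat_def adj_mat_def)
  then have "\<bar>det M * x\<bar> = \<bar>fst s * cofactor M k l\<bar>" by (rule arg_cong)
  moreover have "\<bar>det M\<bar> = \<bar>fst s\<bar>" "fst s \<noteq> 0" using i by (simp_all add: M_def)
  ultimately have "\<bar>x\<bar> = \<bar>cofactor M k l\<bar>" by (simp add: abs_mult)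
  also have "\<dots> = \<bar>det (mat_delete M k l)\<bar>" by (simp add: cofactor_def abs_mult)
  also have "\<dots> \<le> fact (d - 1) * B ^ (d - 1)"
  proof (rule abs_det_le)
    show "mat_delete M k l \<in> carrier_mat (d - 1) (d - 1)" by (rule mat_delete_carrier[OF M])
    show "\<bar>mat_delete M k l $$ (i, j)\<bar> \<le> B" if "i < d - 1" "j < d - 1" for i j
      using that M by (simp add: mat_delete_def ent)
  qed
  also have "\<dots> \<le> fact d * B ^ d"
    using B(2) by (intro mult_mono fact_mono power_increasing) auto
  finally show "\<bar>x\<bar> \<le> fact d * B ^ d" .
qed


section \<open>Circulations and closed walks\<close>

fun walk :: "('e \<Rightarrow> 'n) \<Rightarrow> ('e \<Rightarrow> 'n) \<Rightarrow> 'n \<Rightarrow> 'e list \<Rightarrow> 'n \<Rightarrow> bool" where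
  "walk s t n [] m \<longleftrightarrow> n = m"
| "walk s t n (e # es) m \<longleftrightarrow> s e = n \<and> walk s t (t e) es m"

lemma walk_append: "walk s t n (xs @ ys) m \<longleftrightarrow> (\<exists>k. walk s t n xs k \<and> walk s t k ys m)"
  by (induction xs arbitrary: n) auto

text \<open>The excess of inflow over outflow.\<close>

definition net_inflow :: "'e set \<Rightarrow> ('e \<Rightarrow> 'n) \<Rightarrow> ('e \<Rightarrow> 'n) \<Rightarrow> ('e \<Rightarrow> 'r) \<Rightarrow> 'n \<Rightarrow> 'r :: linordered_idom" where
  "net_inflow E s t z n = (\<Sum>e\<in>E. (of_bool (t e = n) - of_bool (s e = n)) * z e)"

lemma net_inflow_add: "net_inflow E s t (\<lambda>e. y e + z e) n = net_inflow E s t y n + net_inflow E s t z n"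
  by (simp add: net_inflow_def distrib_left sum.distrib)

lemma net_inflow_scale: "net_inflow E s t (\<lambda>e. c * z e) n = c * net_inflow E s t z n"
  by (simp add: net_inflow_def sum_distrib_left mult.left_commute)

lemma sum_count_list:
  fixes \<phi> :: "'e \<Rightarrow> 'r :: linordered_idom"
  assumes "finite E" "set es \<subseteq> E"
  shows "(\<Sum>e\<in>E. \<phi> e * of_nat (count_list es e)) = sum_list (map \<phi> es)"
  using assms(2)
proof (induction es)
  case (Cons x es)
  have "(\<Sum>e\<in>E. \<phi> e * of_nat (count_list (x # es) e)) =
      (\<Sum>e\<in>E. (if e = x then \<phi> x else 0) + \<phi> e * of_nat (count_list es e))"
    by (intro sum.cong) (auto simp: algebra_simps)
  then show ?case using Cons assms(1) by (simp add: sum.distrib)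
qed simp

text \<open>The contributions of consecutive edges cancel at the node between them.\<close>

lemma net_inflow_walk:
  fixes s t :: "'e \<Rightarrow> 'n"
  assumes "finite E" "set es \<subseteq> E" "walk s t n es m"
  shows "net_inflow E s t (\<lambda>e. of_nat (count_list es e) :: 'r :: linordered_idom) k = of_bool (m = k) - of_bool (n = k)"
proof -
  have "sum_list (map (\<lambda>e. of_bool (t e = k) - of_bool (s e = k)) es) = (of_bool (m = k) - of_bool (n = k) :: 'r)"
    using assms(3) by (induction es arbitrary: n) auto
  then show ?thesis unfolding net_inflow_def sum_count_list[OF assms(1,2)] .
qed

text \<open>A longest trail cannot be extended, hence its last edge is followed by one of its own edges.\<close>

lemma exists_closed_trail:
  assumes fin: "finite S" and ne: "S \<noteq> {}" and succ: "\<And>e. e \<in> S \<Longrightarrow> \<exists>e'\<in>S. s e' = t e"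
  shows "\<exists>n es. walk s t n es n \<and> distinct es \<and> es \<noteq> [] \<and> set es \<subseteq> S"
proof -
  define P where "P = {es. set es \<subseteq> S \<and> distinct es \<and> es \<noteq> [] \<and> (\<exists>n m. walk s t n es m)}"
  have "P \<subseteq> {es. set es \<subseteq> S \<and> distinct es}" by (auto simp: P_def)
  then have finP: "finite P" by (rule finite_subset) (rule finite_subset_distinct[OF fin])
  obtain e0 where "e0 \<in> S" using ne by blast
  then have "[e0] \<in> P" unfolding P_def mem_Collect_eq
    by (intro conjI exI[of _ "s e0"] exI[of _ "t e0"]) simp_all
  then have "Max (length ` P) \<in> length ` P" using finP by (intro Max_in) auto
  then obtain es where es: "es \<in> P" "length es = Max (length ` P)" by auto
  have max: "length es' \<le> length es" if "es' \<in> P" for es'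
    unfolding es(2) using finP that by (intro Max_ge) auto
  obtain n m where w: "walk s t n es m" and es': "set es \<subseteq> S" "distinct es" "es \<noteq> []"
    using es(1) by (auto simp: P_def)
  obtain xs e where xs: "es = xs @ [e]" using es'(3) by (cases es rule: rev_cases) auto
  then have m: "m = t e" using w by (auto simp: walk_append)
  obtain e' where e': "e' \<in> S" "s e' = t e" using succ[of e] es'(1) xs by auto
  show ?thesis
  proof (cases "e' \<in> set es")
    case False
    have "walk s t n (es @ [e']) (t e')" using w e' m by (auto simp: walk_append)
    then have "es @ [e'] \<in> P" using False es' e' unfolding P_def by auto
    from max[OF this] show ?thesis by simp
  next
    case True
    then obtain ys zs where "es = ys @ e' # zs" by (auto simp: in_set_conv_decomp)
    then have "walk s t m (e' # zs) m" "distinct (e' # zs)" "set (e' # zs) \<subseteq> S"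
      using w es' e' m by (auto simp: walk_append)
    then show ?thesis by blast
  qed
qed

text \<open>Flow decomposition in the form of an induction rule: a circulation arises from zero by adding
  multiples of closed trails. It serves integer circulations (to lift them into the network) and real
  ones (to decompose a solution of the linear program). A step removes the minimum of \<open>z\<close> on a closed
  trail of its support, so an edge leaves the support.\<close>

lemma circulation_induct:
  fixes z :: "'e \<Rightarrow> 'r :: linordered_idom"
  assumes fin: "finite E"
    and z: "\<And>e. 0 \<le> z e" "\<And>e. e \<notin> E \<Longrightarrow> z e = 0" "\<And>n. net_inflow E s t z n = 0"
    and zero: "P (\<lambda>_. 0)"
    and add: "\<And>z c n es. (\<And>e. 0 \<le> z e) \<Longrightarrow> P z \<Longrightarrow> 0 < c \<Longrightarrow> walk s t n es n \<Longrightarrow> distinct es \<Longrightarrow> es \<noteq> [] \<Longrightarrow>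
      set es \<subseteq> E \<Longrightarrow> P (\<lambda>e. z e + c * of_nat (count_list es e))"
  shows "P z"
  using z
proof (induction "card {e \<in> E. z e \<noteq> 0}" arbitrary: z rule: less_induct)
  case less
  define S where "S = {e \<in> E. z e \<noteq> 0}"
  have finS: "finite S" using fin by (simp add: S_def)
  show ?case
  proof (cases "S = {}")
    case True
    then have "z = (\<lambda>_. 0)" using less.prems(2) unfolding S_def by blast
    then show ?thesis using zero by simp
  next
    case False
    have succ: "\<exists>e'\<in>S. s e' = t e" if e: "e \<in> S" for e
    proof (rule ccontr)
      assume no: "\<not> ?thesis"
      have "net_inflow E s t z (t e) = (\<Sum>e'\<in>E. of_bool (t e' = t e) * z e')"
        unfolding net_inflow_def
        by (rule sum.cong[OF refl]) (use no in \<open>auto simp: S_def\<close>)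
      moreover have "z e \<le> (\<Sum>e'\<in>E. of_bool (t e' = t e) * z e')"
        using member_le_sum[of e E "\<lambda>e'. of_bool (t e' = t e) * z e'"] e fin less.prems(1)
        by (simp add: S_def)
      ultimately show False using less.prems(1,3) e by (simp add: S_def order_antisym)
    qed
    obtain n es where es: "walk s t n es n" "distinct es" "es \<noteq> []" "set es \<subseteq> S"
      using exists_closed_trail[where s = s and t = t, OF finS False succ] by blast
    have esE: "set es \<subseteq> E" using es(4) by (auto simp: S_def)
    define c where "c = Min (z ` set es)"
    have "c \<in> z ` set es" unfolding c_def using es(3) by (intro Min_in) auto
    then obtain e0 where e0: "e0 \<in> set es" "z e0 = c" by auto
    have c: "0 < c" using e0 es(4) less.prems(1)[of e0] by (auto simp: S_def)
    have le: "c \<le> z e" if "e \<in> set es" for e unfolding c_def using that by (intro Min_le) auto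
    define y where "y = (\<lambda>e. z e - c * of_nat (count_list es e))"
    have count: "count_list es e = of_bool (e \<in> set es)" for e
      using es(2) by (induction es) auto
    have y0: "0 \<le> y e" for e using le[of e] less.prems(1)[of e] by (simp add: y_def count)
    have yE: "y e = 0" if "e \<notin> E" for e
    proof -
      have "e \<notin> set es" using that esE by blast
      then show ?thesis using that less.prems(2) by (simp add: y_def count)
    qed
    have "net_inflow E s t z k = net_inflow E s t y k + c * net_inflow E s t (\<lambda>e. of_nat (count_list es e)) k" for k
      unfolding net_inflow_scale[symmetric] net_inflow_add[symmetric] by (simp add: y_def)
    then have yc: "net_inflow E s t y k = 0" for k
      using less.prems(3)[of k] net_inflow_walk[OF fin esE es(1), of k, where 'r = 'r] by simp
    have "{e \<in> E. y e \<noteq> 0} \<subset> S"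
    proof
      show "{e \<in> E. y e \<noteq> 0} \<subseteq> S" using es(4) by (auto simp: S_def y_def count split: if_splits)
      have "e0 \<in> S" "y e0 = 0" using e0 es(4) by (auto simp: y_def count)
      then show "{e \<in> E. y e \<noteq> 0} \<noteq> S" by auto
    qed
    then have "card {e \<in> E. y e \<noteq> 0} < card {e \<in> E. z e \<noteq> 0}"
      using finS unfolding S_def by (rule psubset_card_mono[rotated])
    from less.hyps[OF this y0 yE yc] have "P y" .
    from add[OF y0 this c es(1-3) esE] show ?thesis by (simp add: y_def)
  qed
qed


section \<open>The extended formulation\<close>

text \<open>The node \<open>u\<close> of copy \<open>i\<close> at label \<open>g\<close>. The copy \<open>i\<close> is meant for closed walks that start at the node with
  key \<open>i\<close>: there it is glued to the hub \<open>(0, 0, g)\<close>, which is shared by all copies. Keys of nodes are nonzero,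
  so copy \<open>0\<close> never meets a hub.\<close>

definition node :: "int \<Rightarrow> int \<Rightarrow> 'g \<Rightarrow> int \<times> int \<times> 'g" where
  "node i u g = (if u = i then (0, 0, g) else (i, u, g))"

lemma node_simps [simp]:
  "node i i g = (0, 0, g)" "snd (snd (node i u g)) = g"
  "u \<noteq> i \<Longrightarrow> node i' u' g' = (i, u, g) \<longleftrightarrow> i' = i \<and> u' = u \<and> g' = g"
  by (auto simp: node_def)

text \<open>The finite abelian group \<open>\<int>\<^sup>d / H \<int>\<^sup>d\<close> enters only through the labels \<open>lab u\<close> of its classes, the effect
  \<open>step a\<close> of an arc on them and a period. The last assumption on \<open>K\<close> covers a trivial group, for which one
  copy is enough; this keeps the formulation small when \<open>\<Delta> = 1\<close>.\<close>

locale labelled_network =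
  fixes A :: "'a set" and src trg :: "'a \<Rightarrow> int" and W :: "nat \<Rightarrow> 'a \<Rightarrow> int"
    and lab :: "(nat \<Rightarrow> int) \<Rightarrow> 'g" and step :: "'a \<Rightarrow> 'g \<Rightarrow> 'g" and L :: "'g set" and K :: "int set"
    and f :: "nat \<Rightarrow> int" and period :: nat
  assumes fin: "finite A" "finite L" "finite K"
    and ends: "\<And>a. a \<in> A \<Longrightarrow> src a \<noteq> 0 \<and> trg a \<noteq> 0"
    and step: "\<And>a u. a \<in> A \<Longrightarrow> step a (lab u) = lab (\<lambda>i. u i + W i a)"
    and L: "lab (\<lambda>_. 0) \<in> L" "\<And>a g. a \<in> A \<Longrightarrow> g \<in> L \<Longrightarrow> step a g \<in> L"
    and period: "0 < period" "\<And>u w. lab (\<lambda>i. u i + int period * w i) = lab u"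
    and K: "0 \<in> K" "(\<forall>a\<in>A. src a \<in> K) \<or> (\<forall>u. lab u = lab (\<lambda>_. 0))"
begin

definition E :: "(int \<times> 'g \<times> 'a) set" where
  "E = K \<times> L \<times> A"

definition esrc :: "int \<times> 'g \<times> 'a \<Rightarrow> int \<times> int \<times> 'g" where
  "esrc = (\<lambda>(i, g, a). node i (src a) g)"

definition etrg :: "int \<times> 'g \<times> 'a \<Rightarrow> int \<times> int \<times> 'g" where
  "etrg = (\<lambda>(i, g, a). node i (trg a) (step a g))"

definition nodes :: "(int \<times> int \<times> 'g) set" where
  "nodes = K \<times> insert 0 (src ` A \<union> trg ` A) \<times> L"

definition hub :: "(nat \<Rightarrow> int) \<Rightarrow> int \<times> int \<times> 'g" where
  "hub u = (0, 0, lab u)"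

text \<open>The linear program: a flow of value one from the hub of \<open>0\<close> to the hub of \<open>f\<close>, possibly with further
  cycles, together with its projection \<open>x\<close> to the arcs. One inequality per node is enough.\<close>

definition solution :: "('a \<Rightarrow> real) \<Rightarrow> (int \<times> 'g \<times> 'a \<Rightarrow> real) \<Rightarrow> bool" where
  "solution x z \<longleftrightarrow> (\<forall>a\<in>A. x a = (\<Sum>i\<in>K. \<Sum>g\<in>L. z (i, g, a))) \<and> (\<forall>e\<in>E. 0 \<le> z e) \<and>
     (\<forall>n\<in>nodes. net_inflow E esrc etrg z n \<le> of_bool (hub f = n) - of_bool (hub (\<lambda>_. 0) = n))"

definition weight :: "('a \<Rightarrow> nat) \<Rightarrow> nat \<Rightarrow> int" where
  "weight y = (\<lambda>i. \<Sum>a\<in>A. W i a * int (y a))"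

definition circulations :: "('a \<Rightarrow> nat) set" where
  "circulations = {y. (\<forall>a. a \<notin> A \<longrightarrow> y a = 0) \<and> (\<forall>u. net_inflow A src trg (\<lambda>a. int (y a)) u = 0)}"

definition Y :: "('a \<Rightarrow> nat) set" where
  "Y = {y \<in> circulations. lab (weight y) = lab f}"

lemma finite_E: "finite E"
  using fin by (simp add: E_def)

lemma finite_nodes: "finite nodes"
  using fin by (simp add: nodes_def)

lemma ends_in_nodes: "e \<in> E \<Longrightarrow> esrc e \<in> nodes" "e \<in> E \<Longrightarrow> etrg e \<in> nodes"
  using L K by (auto simp: E_def esrc_def etrg_def nodes_def node_def)

subsection \<open>Lifting circulations\<close>

fun lifted :: "int \<Rightarrow> 'g \<Rightarrow> 'a list \<Rightarrow> (int \<times> 'g \<times> 'a) list" where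
  "lifted i g [] = []"
| "lifted i g (a # as) = (i, g, a) # lifted i (step a g) as"

text \<open>A walk, started at label \<open>lab u\<close> in copy \<open>i\<close>, lifts to a walk that collects the labels of its arcs.\<close>

lemma lifted:
  assumes "set as \<subseteq> A" "walk src trg n as m" "lab u \<in> L" "i \<in> K"
  shows "walk esrc etrg (node i n (lab u)) (lifted i (lab u) as)
      (node i m (lab (\<lambda>j. u j + sum_list (map (W j) as))))"
    and "set (lifted i (lab u) as) \<subseteq> E"
    and "a \<in> A \<Longrightarrow> (\<Sum>i'\<in>K. \<Sum>g\<in>L. count_list (lifted i (lab u) as) (i', g, a)) = count_list as a"
    and "lab (\<lambda>j. u j + sum_list (map (W j) as)) \<in> L"
proof -
  have "walk esrc etrg (node i n (lab u)) (lifted i (lab u) as)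
      (node i m (lab (\<lambda>j. u j + sum_list (map (W j) as)))) \<and> set (lifted i (lab u) as) \<subseteq> E \<and>
    (\<forall>a\<in>A. (\<Sum>i'\<in>K. \<Sum>g\<in>L. count_list (lifted i (lab u) as) (i', g, a)) = count_list as a) \<and>
    lab (\<lambda>j. u j + sum_list (map (W j) as)) \<in> L"
    using assms
  proof (induction as arbitrary: n u)
    case (Cons b as)
    have b: "b \<in> A" "src b = n" "walk src trg (trg b) as m" "set as \<subseteq> A" using Cons.prems by auto
    have st: "step b (lab u) = lab (\<lambda>j. u j + W j b)" by (rule step[OF b(1)])
    have inL: "lab (\<lambda>j. u j + W j b) \<in> L" using L(2)[OF b(1) Cons.prems(3)] st by simp
    note IH = Cons.IH[OF b(4,3) inL Cons.prems(4)]
    have "(\<Sum>i'\<in>K. \<Sum>g\<in>L. count_list (lifted i (lab u) (b # as)) (i', g, a)) = count_list (b # as) a"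
      if a: "a \<in> A" for a
    proof -
      have "(\<Sum>i'\<in>K. \<Sum>g\<in>L. count_list (lifted i (lab u) (b # as)) (i', g, a)) =
          (\<Sum>i'\<in>K. \<Sum>g\<in>L. (if i = i' then if lab u = g then of_bool (b = a) else 0 else 0) +
             count_list (lifted i (lab (\<lambda>j. u j + W j b)) as) (i', g, a))"
        by (intro sum.cong) (auto simp: st)
      also have "\<dots> = (\<Sum>i'\<in>K. \<Sum>g\<in>L. if i = i' then if lab u = g then of_bool (b = a) else 0 else 0) +
          count_list as a"
        using IH a by (simp add: sum.distrib)
      also have "(\<Sum>i'\<in>K. \<Sum>g\<in>L. if i = i' then if lab u = g then of_bool (b = a) else 0 else 0) =
          (\<Sum>i'\<in>K. if i = i' then of_bool (b = a) else (0 :: nat))"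
        using fin Cons.prems(3) by (intro sum.cong) auto
      also have "\<dots> = of_bool (b = a)" using fin Cons.prems(4) by simp
      finally show ?thesis by simp
    qed
    moreover have "set (lifted i (lab u) (b # as)) \<subseteq> E" using IH b Cons.prems(3,4) st by (auto simp: E_def)
    ultimately show ?case using IH b st by (auto simp: esrc_def etrg_def add.assoc)
  qed auto
  then show "walk esrc etrg (node i n (lab u)) (lifted i (lab u) as)
      (node i m (lab (\<lambda>j. u j + sum_list (map (W j) as))))"
    and "set (lifted i (lab u) as) \<subseteq> E"
    and "a \<in> A \<Longrightarrow> (\<Sum>i'\<in>K. \<Sum>g\<in>L. count_list (lifted i (lab u) as) (i', g, a)) = count_list as a"
    and "lab (\<lambda>j. u j + sum_list (map (W j) as)) \<in> L" by blast+
qed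

text \<open>The statement to be proved for integer circulations by induction on their decomposition into cycles.\<close>

definition liftable :: "('a \<Rightarrow> int) \<Rightarrow> bool" where
  "liftable y \<longleftrightarrow> lab (\<lambda>i. \<Sum>a\<in>A. W i a * y a) \<in> L \<and> (\<exists>z. (\<forall>e. 0 \<le> z e) \<and>
     (\<forall>a\<in>A. y a = (\<Sum>i\<in>K. \<Sum>g\<in>L. z (i, g, a))) \<and>
     (\<forall>n. net_inflow E esrc etrg z n = of_bool (hub (\<lambda>i. \<Sum>a\<in>A. W i a * y a) = n) - of_bool (hub (\<lambda>_. 0) = n)))"

text \<open>A cycle is lifted into the copy of one of its nodes. There it leads from the hub of the current label
  to the hub of the new one, so it extends the flow from the hub of \<open>0\<close>.\<close>

lemma liftable_add_cycle:
  assumes y: "liftable y" and w: "walk src trg n as n" and as: "as \<noteq> []" "set as \<subseteq> A"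
  shows "liftable (\<lambda>a. y a + int (count_list as a))"
proof -
  define u where "u = (\<lambda>i. \<Sum>a\<in>A. W i a * y a)"
  define v where "v = (\<lambda>i. \<Sum>a\<in>A. W i a * (y a + int (count_list as a)))"
  have v: "v = (\<lambda>i. u i + sum_list (map (W i) as))"
    using sum_count_list[OF fin(1) as(2), of "W _"] by (auto simp: v_def u_def distrib_left sum.distrib)
  obtain z where u: "lab u \<in> L" and z: "\<And>e. 0 \<le> z e" "\<And>a. a \<in> A \<Longrightarrow> y a = (\<Sum>i\<in>K. \<Sum>g\<in>L. z (i, g, a))"
    "\<And>n. net_inflow E esrc etrg z n = of_bool (hub u = n) - of_bool (hub (\<lambda>_. 0) = n)"
    using y unfolding liftable_def u_def by blast
  \<comment> \<open>if the start node has no copy, all labels are equal and every lift is closed, even in copy \<open>0\<close>\<close>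
  define i where "i = (if n \<in> K then n else 0)"
  have i: "i \<in> K" using K by (simp add: i_def)
  have loop: "of_bool (node i n (lab v) = k) - of_bool (node i n (lab u) = k) =
      (of_bool (hub v = k) - of_bool (hub u = k) :: int)" for k
  proof (cases "n \<in> K")
    case True
    then show ?thesis by (simp add: i_def hub_def)
  next
    case False
    have "n \<in> src ` A" using w as by (cases as) auto
    then have "\<forall>u. lab u = lab (\<lambda>_. 0)" using K(2) False by blast
    then have "lab v = lab u" by metis
    then show ?thesis by (simp add: hub_def)
  qed
  note lift = lifted[OF as(2) w u i]
  define z' where "z' = (\<lambda>e. z e + int (count_list (lifted i (lab u) as) e))"
  have "net_inflow E esrc etrg z' k = of_bool (hub v = k) - of_bool (hub (\<lambda>_. 0) = k)" for k
    unfolding z'_def net_inflow_add z(3)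
    using net_inflow_walk[OF finite_E lift(2) lift(1), of k, where 'r = int] loop[of k] by (simp add: v)
  moreover have "y a + int (count_list as a) = (\<Sum>i\<in>K. \<Sum>g\<in>L. z' (i, g, a))" if a: "a \<in> A" for a
    unfolding z'_def sum.distrib using z(2)[OF a] lift(3)[OF a]
    by (simp flip: of_nat_sum)
  moreover have "0 \<le> z' e" for e using z(1) by (simp add: z'_def)
  moreover have "lab v \<in> L" using lift(4) by (simp add: v)
  ultimately show ?thesis unfolding liftable_def v_def by blast
qed

lemma circulation_solution:
  assumes y: "y \<in> Y"
  shows "\<exists>z. solution (\<lambda>a. real (y a)) z"
proof -
  have y': "\<And>a. a \<notin> A \<Longrightarrow> y a = 0" "\<And>u. net_inflow A src trg (\<lambda>a. int (y a)) u = 0" "lab (weight y) = lab f"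
    using y by (auto simp: Y_def circulations_def)
  have "liftable (\<lambda>a. int (y a))"
  proof (rule circulation_induct[OF fin(1), where s = src and t = trg])
    show "net_inflow A src trg (\<lambda>a. int (y a)) n = 0" for n by (rule y')
    show "liftable (\<lambda>_. 0)" unfolding liftable_def
      using L(1) by (auto intro!: exI[of _ "\<lambda>_. 0"] simp: net_inflow_def)
    fix z :: "'a \<Rightarrow> int" and c :: int and n es
    assume *: "liftable z" "0 < c" "walk src trg n es n" "es \<noteq> []" "set es \<subseteq> A"
    have "liftable (\<lambda>a. z a + int k * int (count_list es a))" for k
    proof (induction k)
      case (Suc k)
      from liftable_add_cycle[OF Suc *(3-5)] show ?case by (simp add: algebra_simps)
    qed (use * in simp)
    from this[of "nat c"] show "liftable (\<lambda>e. z e + c * int (count_list es e))" using *(2) by simp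
  qed (use y' in auto)
  then obtain z where z: "\<And>e. 0 \<le> z e" "\<And>a. a \<in> A \<Longrightarrow> int (y a) = (\<Sum>i\<in>K. \<Sum>g\<in>L. z (i, g, a))"
    "\<And>n. net_inflow E esrc etrg z n = of_bool (hub (weight y) = n) - of_bool (hub (\<lambda>_. 0) = n)"
    unfolding liftable_def weight_def by blast
  have "net_inflow E esrc etrg (\<lambda>e. real_of_int (z e)) n = real_of_int (net_inflow E esrc etrg z n)" for n
    by (simp add: net_inflow_def)
  then have "net_inflow E esrc etrg (\<lambda>e. real_of_int (z e)) n = of_bool (hub f = n) - of_bool (hub (\<lambda>_. 0) = n)" for n
    using z(3) y'(3) by (simp add: hub_def)
  moreover have "real (y a) = (\<Sum>i\<in>K. \<Sum>g\<in>L. real_of_int (z (i, g, a)))" if "a \<in> A" for a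
    using arg_cong[OF z(2)[OF that], of real_of_int] by simp
  ultimately have "solution (\<lambda>a. real (y a)) (\<lambda>e. real_of_int (z e))"
    unfolding solution_def using z(1) by simp
  then show ?thesis by blast
qed

subsection \<open>Projecting solutions\<close>

lemma convex_solutions: "convex {x. (\<forall>a. a \<notin> A \<longrightarrow> x a = 0) \<and> (\<exists>z. solution x z)}"
proof (rule convexI, clarify, intro conjI allI impI)
  fix x y :: "'a \<Rightarrow> real" and zx zy and u v :: real
  assume *: "\<forall>a. a \<notin> A \<longrightarrow> x a = 0" "\<forall>a. a \<notin> A \<longrightarrow> y a = 0" "solution x zx" "solution y zy"
    and uv: "0 \<le> u" "0 \<le> v" "u + v = 1"
  show "(u *\<^sub>R x + v *\<^sub>R y) a = 0" if "a \<notin> A" for a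
    using * that by (simp add: scaleR_fun_def)
  have "solution (u *\<^sub>R x + v *\<^sub>R y) (\<lambda>e. u * zx e + v * zy e)"
    unfolding solution_def
  proof (intro conjI ballI)
    fix n assume n: "n \<in> nodes"
    let ?b = "of_bool (hub f = n) - of_bool (hub (\<lambda>_. 0) = n) :: real"
    have "net_inflow E esrc etrg zx n \<le> ?b" "net_inflow E esrc etrg zy n \<le> ?b"
      using *(3,4) n by (simp_all add: solution_def)
    then have "u * net_inflow E esrc etrg zx n + v * net_inflow E esrc etrg zy n \<le> u * ?b + v * ?b"
      using uv by (intro add_mono mult_left_mono)
    then show "net_inflow E esrc etrg (\<lambda>e. u * zx e + v * zy e) n \<le> ?b"
      unfolding net_inflow_add net_inflow_scale distrib_right[symmetric] uv(3) by simp
  qed (use *(3,4) uv in \<open>auto simp: solution_def scaleR_fun_def sum.distrib sum_distrib_left\<close>)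
  then show "\<exists>z. solution (u *\<^sub>R x + v *\<^sub>R y) z" by blast
qed

text \<open>The node inequalities add up to \<open>0 \<le> 0\<close>, so all of them are tight.\<close>

lemma solution_tight:
  assumes "solution x z"
  shows "net_inflow E esrc etrg z n = of_bool (hub f = n) - of_bool (hub (\<lambda>_. 0) = n)"
proof -
  define b where "b n = (of_bool (hub f = n) - of_bool (hub (\<lambda>_. 0) = n) :: real)" for n
  have le: "net_inflow E esrc etrg z n \<le> b n" if "n \<in> nodes" for n
    using assms that by (simp add: solution_def b_def)
  have delta: "(\<Sum>n\<in>nodes. of_bool (m = n) :: real) = of_bool (m \<in> nodes)" for m
    using finite_nodes by (simp add: of_bool_def)
  have "(\<Sum>n\<in>nodes. net_inflow E esrc etrg z n) =
      (\<Sum>e\<in>E. (\<Sum>n\<in>nodes. of_bool (etrg e = n) - of_bool (esrc e = n)) * z e)"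
    unfolding net_inflow_def by (subst sum.swap) (simp add: sum_distrib_right)
  also have "\<dots> = 0"
    by (rule sum.neutral) (simp add: sum_subtractf delta ends_in_nodes)
  finally have sum0: "(\<Sum>n\<in>nodes. net_inflow E esrc etrg z n) = 0" .
  have hub0: "hub (\<lambda>_. 0) \<in> nodes" using K L by (simp add: hub_def nodes_def)
  have sumb: "(\<Sum>n\<in>nodes. b n) = of_bool (hub f \<in> nodes) - 1"
    using hub0 by (simp add: b_def sum_subtractf delta)
  have "(\<Sum>n\<in>nodes. net_inflow E esrc etrg z n) \<le> (\<Sum>n\<in>nodes. b n)" by (intro sum_mono le)
  then have hubf: "hub f \<in> nodes" using sum0 sumb by (cases "hub f \<in> nodes") simp_all
  have "(\<Sum>n\<in>nodes. b n - net_inflow E esrc etrg z n) = 0" using sum0 sumb hubf by (simp add: sum_subtractf)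
  then have tight: "b n = net_inflow E esrc etrg z n" if "n \<in> nodes" for n
    using sum_nonneg_eq_0_iff[of nodes "\<lambda>n. b n - net_inflow E esrc etrg z n"] le finite_nodes that by simp
  show ?thesis
  proof (cases "n \<in> nodes")
    case False
    then have "net_inflow E esrc etrg z n = 0"
      unfolding net_inflow_def using ends_in_nodes by (intro sum.neutral) auto
    then show ?thesis using False hub0 hubf by auto
  qed (use tight in \<open>simp add: b_def\<close>)
qed

definition projection :: "(int \<times> 'g \<times> 'a \<Rightarrow> real) \<Rightarrow> 'a \<Rightarrow> real" where
  "projection z a = of_bool (a \<in> A) * (\<Sum>i\<in>K. \<Sum>g\<in>L. z (i, g, a))"

text \<open>In the copy \<open>i\<close>, conservation at the nodes other than \<open>i\<close> forces conservation at \<open>i\<close>. So a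
  flow that is conserved outside the hubs projects to a circulation.\<close>

lemma projection_circulation:
  assumes "\<And>n. (\<forall>g. n \<noteq> (0, 0, g)) \<Longrightarrow> net_inflow E esrc etrg z n = 0"
  shows "net_inflow A src trg (projection z) u = 0"
proof -
  define D where "D i u = (\<Sum>g\<in>L. \<Sum>a\<in>A. (of_bool (trg a = u) - of_bool (src a = u)) * z (i, g, a))" for i u
  have other: "D i u = 0" if i: "i \<in> K" and ui: "u \<noteq> i" for i u
  proof -
    have "0 = (\<Sum>g\<in>L. net_inflow E esrc etrg z (i, u, g))"
      using assms ui by (intro sum.neutral[symmetric]) auto
    also have "\<dots> = (\<Sum>e\<in>E. \<Sum>g\<in>L. (of_bool (etrg e = (i, u, g)) - of_bool (esrc e = (i, u, g))) * z e)"
      unfolding net_inflow_def by (rule sum.swap)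
    also have "\<dots> = (\<Sum>e\<in>E. if fst e = i then (of_bool (trg (snd (snd e)) = u) - of_bool (src (snd (snd e)) = u)) * z e else 0)"
    proof (rule sum.cong[OF refl])
      fix e assume e: "e \<in> E"
      obtain j h a where ea: "e = (j, h, a)" by (cases e)
      have h: "h \<in> L" "step a h \<in> L" using e L(2) by (auto simp: ea E_def)
      have "(\<Sum>g\<in>L. of_bool (etrg e = (i, u, g)) :: real) = of_bool (j = i \<and> trg a = u)"
        "(\<Sum>g\<in>L. of_bool (esrc e = (i, u, g)) :: real) = of_bool (j = i \<and> src a = u)"
        using h fin ui by (auto simp: ea etrg_def esrc_def of_bool_def)
      then show "(\<Sum>g\<in>L. (of_bool (etrg e = (i, u, g)) - of_bool (esrc e = (i, u, g))) * z e) =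
          (if fst e = i then (of_bool (trg (snd (snd e)) = u) - of_bool (src (snd (snd e)) = u)) * z e else 0)"
        unfolding sum_distrib_right[symmetric] sum_subtractf by (auto simp: ea)
    qed
    also have "\<dots> = (\<Sum>j\<in>K. \<Sum>g\<in>L. \<Sum>a\<in>A. if j = i then (of_bool (trg a = u) - of_bool (src a = u)) * z (j, g, a) else 0)"
      unfolding E_def sum.cartesian_product by (intro sum.cong) auto
    also have "\<dots> = (\<Sum>j\<in>K. if j = i then D i u else 0)"
      unfolding D_def by (intro sum.cong refl) auto
    also have "\<dots> = D i u" using i fin by simp
    finally show ?thesis by simp
  qed
  have "D i u = 0" if i: "i \<in> K" for i u
  proof (cases "u = i")
    case True
    define V where "V = insert i (src ` A \<union> trg ` A)"
    have finV: "finite V" using fin by (simp add: V_def)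
    have "(\<Sum>v\<in>V. D i v) = (\<Sum>g\<in>L. \<Sum>v\<in>V. \<Sum>a\<in>A. (of_bool (trg a = v) - of_bool (src a = v)) * z (i, g, a))"
      unfolding D_def by (rule sum.swap)
    also have "\<dots> = (\<Sum>g\<in>L. \<Sum>a\<in>A. (\<Sum>v\<in>V. of_bool (trg a = v) - of_bool (src a = v)) * z (i, g, a))"
      unfolding sum_distrib_right by (intro sum.cong refl sum.swap)
    also have "\<dots> = 0"
      using finV by (intro sum.neutral ballI) (auto simp: sum_subtractf V_def of_bool_def)
    finally have "(\<Sum>v\<in>V. D i v) = 0" .
    moreover have "(\<Sum>v\<in>V. D i v) = D i i + (\<Sum>v\<in>V - {i}. D i v)"
      using finV by (intro sum.remove) (auto simp: V_def)
    moreover have "(\<Sum>v\<in>V - {i}. D i v) = 0" by (intro sum.neutral) (use other[OF i] in auto)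
    ultimately show ?thesis using True by simp
  qed (use other i in blast)
  then have "0 = (\<Sum>i\<in>K. D i u)" by simp
  also have "\<dots> = (\<Sum>i\<in>K. \<Sum>a\<in>A. \<Sum>g\<in>L. (of_bool (trg a = u) - of_bool (src a = u)) * z (i, g, a))"
    unfolding D_def by (intro sum.cong refl sum.swap)
  also have "\<dots> = (\<Sum>a\<in>A. (of_bool (trg a = u) - of_bool (src a = u)) * (\<Sum>i\<in>K. \<Sum>g\<in>L. z (i, g, a)))"
    by (subst sum.swap) (simp add: sum_distrib_left)
  also have "\<dots> = net_inflow A src trg (projection z) u"
    unfolding net_inflow_def projection_def by (intro sum.cong) auto
  finally show ?thesis by simp
qed

definition stable :: "('a \<Rightarrow> real) set" where
  "stable = {r. \<forall>s\<in>convex hull ((\<lambda>y a. real (y a)) ` Y). s + r \<in> convex hull ((\<lambda>y a. real (y a)) ` Y)}"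

lemma weight_add: "weight (\<lambda>a. y a + k * z a) = (\<lambda>i. weight y i + int k * weight z i)"
  by (auto simp: weight_def distrib_left sum.distrib sum_distrib_left mult.left_commute)

text \<open>Adding \<open>period\<close> times a circulation does not change the label, so every circulation is a direction in
  which the convex hull of \<open>Y\<close> is unbounded.\<close>

lemma stable_circulation:
  assumes y: "y \<in> circulations" and c: "0 \<le> c"
  shows "(\<lambda>a. c * real (y a)) \<in> stable"
proof -
  let ?R = "\<lambda>y a. real (y a)" and ?r = "\<lambda>a. c * real (y a)"
  let ?H = "convex hull (?R ` Y)"
  \<comment> \<open>\<open>s + c y\<close> lies between \<open>s\<close> and \<open>s + m y\<close>, where \<open>m\<close> is a large multiple of the period\<close>
  obtain k :: nat where k: "c < real k" using reals_Archimedean2 by blast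
  define m where "m = k * period"
  have m: "c \<le> real m" "0 < real m"
  proof -
    have "1 \<le> real period" using period(1) by linarith
    then have "real k \<le> real k * real period" using mult_left_mono[of 1 "real period" "real k"] by simp
    with k show "c \<le> real m" by (simp add: m_def)
    show "0 < real m" using k c period(1) by (simp add: m_def)
  qed
  have "?R x + ?r \<in> ?H" if x: "x \<in> Y" for x
  proof -
    let ?x' = "\<lambda>a. x a + m * y a"
    have "net_inflow A src trg (\<lambda>a. int (?x' a)) u = 0" for u
      using x y by (simp add: Y_def circulations_def net_inflow_add net_inflow_scale)
    moreover have "weight ?x' = (\<lambda>i. weight x i + int period * (int k * weight y i))"
      unfolding weight_add by (simp add: m_def mult.assoc mult.left_commute)
    then have "lab (weight ?x') = lab f"
      using x period(2)[of "weight x" "\<lambda>i. int k * weight y i"] by (simp add: Y_def)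
    ultimately have "?x' \<in> Y" using x y by (auto simp: Y_def circulations_def)
    then have "?R ?x' \<in> ?H" by (rule hull_inc[OF imageI])
    moreover have "?R x \<in> ?H" by (rule hull_inc[OF imageI[OF x]])
    ultimately have "(1 - c / m) *\<^sub>R ?R x + (c / m) *\<^sub>R ?R ?x' \<in> ?H"
      using m c by (intro convexD[OF convex_convex_hull]) auto
    also have "(1 - c / m) *\<^sub>R ?R x + (c / m) *\<^sub>R ?R ?x' = ?R x + ?r"
      using m by (auto simp: scaleR_fun_def fun_eq_iff field_simps)
    finally show ?thesis .
  qed
  then have "?R ` Y \<subseteq> {s. s + ?r \<in> ?H}" by blast
  moreover have "convex {s. s + ?r \<in> ?H}"
  proof (rule convexI, clarify)
    fix s s' :: "'a \<Rightarrow> real" and u v :: real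
    assume "s + ?r \<in> ?H" "s' + ?r \<in> ?H" and uv: "0 \<le> u" "0 \<le> v" "u + v = 1"
    then have "u *\<^sub>R (s + ?r) + v *\<^sub>R (s' + ?r) \<in> ?H" by (intro convexD[OF convex_convex_hull])
    also have "u *\<^sub>R (s + ?r) + v *\<^sub>R (s' + ?r) = u *\<^sub>R s + v *\<^sub>R s' + (u + v) *\<^sub>R ?r"
      by (simp only: scaleR_add_right scaleR_add_left add.assoc add.commute add.left_commute)
    also have "\<dots> = u *\<^sub>R s + v *\<^sub>R s' + ?r" by (simp only: uv(3) scaleR_one)
    finally show "u *\<^sub>R s + v *\<^sub>R s' + ?r \<in> ?H" .
  qed
  ultimately have "?H \<subseteq> {s. s + ?r \<in> ?H}" by (rule hull_minimal)
  then show ?thesis by (auto simp: stable_def)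
qed

lemma stable_zero: "(\<lambda>_. 0) \<in> stable"
proof -
  have "s + (\<lambda>_. 0) = s" for s :: "'a \<Rightarrow> real" by (simp add: fun_eq_iff)
  then show ?thesis by (simp add: stable_def)
qed

lemma stable_add: "r \<in> stable \<Longrightarrow> r' \<in> stable \<Longrightarrow> r + r' \<in> stable"
  by (simp add: stable_def add.assoc[symmetric])

text \<open>The return arc \<open>None\<close> from the hub of \<open>f\<close> to the hub of \<open>0\<close> turns a solution into a circulation.\<close>

definition csrc :: "(int \<times> 'g \<times> 'a) option \<Rightarrow> int \<times> int \<times> 'g" where
  "csrc = case_option (hub f) esrc"

definition ctrg :: "(int \<times> 'g \<times> 'a) option \<Rightarrow> int \<times> int \<times> 'g" where
  "ctrg = case_option (hub (\<lambda>_. 0)) etrg"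

fun arcs_of :: "(int \<times> 'g \<times> 'a) option list \<Rightarrow> 'a list" where
  "arcs_of [] = []"
| "arcs_of (None # es) = arcs_of es"
| "arcs_of (Some e # es) = snd (snd e) # arcs_of es"

lemma arcs_of_append: "arcs_of (xs @ ys) = arcs_of xs @ arcs_of ys"
  by (induction xs rule: arcs_of.induct) auto

lemma set_arcs_of: "set es \<subseteq> insert None (Some ` E) \<Longrightarrow> set (arcs_of es) \<subseteq> A"
  by (induction es rule: arcs_of.induct) (auto simp: E_def)

lemma projection_count:
  assumes "set es \<subseteq> insert None (Some ` E)"
  shows "projection (\<lambda>e. real (count_list es (Some e))) a = real (count_list (arcs_of es) a)"
proof (cases "a \<in> A")
  case True
  have "(\<Sum>i\<in>K. \<Sum>g\<in>L. count_list es (Some (i, g, a))) = count_list (arcs_of es) a"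
    using assms
  proof (induction es rule: arcs_of.induct)
    case (3 e es)
    obtain j h b where e: "e = (j, h, b)" by (cases e)
    have jh: "j \<in> K" "h \<in> L" using 3 by (auto simp: e E_def)
    have "(\<Sum>i\<in>K. \<Sum>g\<in>L. count_list (Some e # es) (Some (i, g, a))) =
        (\<Sum>i\<in>K. \<Sum>g\<in>L. (if j = i then if h = g then of_bool (b = a) else 0 else 0) + count_list es (Some (i, g, a)))"
      by (intro sum.cong) (auto simp: e)
    also have "\<dots> = (\<Sum>i\<in>K. \<Sum>g\<in>L. if j = i then if h = g then of_bool (b = a) else 0 else 0) + count_list (arcs_of es) a"
      using 3 by (simp add: sum.distrib)
    also have "(\<Sum>i\<in>K. \<Sum>g\<in>L. if j = i then if h = g then of_bool (b = a) else 0 else 0) =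
        (\<Sum>i\<in>K. if j = i then of_bool (b = a) else (0 :: nat))"
      using fin jh by (intro sum.cong) auto
    also have "\<dots> = of_bool (b = a)" using fin jh by simp
    finally show ?case by (simp add: e)
  qed auto
  then show ?thesis using True by (simp add: projection_def flip: of_nat_sum)
next
  case False
  then have "a \<notin> set (arcs_of es)" using set_arcs_of[OF assms] by blast
  then show ?thesis using False by (simp add: projection_def)
qed

lemma walk_label:
  assumes "walk csrc ctrg n es m" "set es \<subseteq> Some ` E" "snd (snd n) = lab u"
  shows "snd (snd m) = lab (\<lambda>i. u i + sum_list (map (W i) (arcs_of es)))"
  using assms
proof (induction es arbitrary: n u)
  case (Cons x es)
  then obtain i g a where x: "x = Some (i, g, a)" "a \<in> A" by (auto simp: E_def)
  have g: "g = lab u" using Cons.prems by (auto simp: x csrc_def esrc_def)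
  have "snd (snd (ctrg x)) = lab (\<lambda>j. u j + W j a)"
    using step[OF x(2), of u] by (simp add: x(1) ctrg_def etrg_def g)
  from Cons.IH[OF _ _ this] Cons.prems show ?case by (simp add: x(1) add.assoc)
qed simp

text \<open>A closed trail through the return arc is a path from the hub of \<open>0\<close> to the hub of \<open>f\<close>; the labels along
  it show that its projection has the label of \<open>f\<close>.\<close>

lemma closed_trail_circulation:
  assumes w: "walk csrc ctrg n es n" and es: "distinct es" "set es \<subseteq> insert None (Some ` E)"
  shows "count_list (arcs_of es) \<in> circulations"
    and "None \<in> set es \<Longrightarrow> count_list (arcs_of es) \<in> Y"
proof -
  let ?E = "insert None (Some ` E)"
  have "net_inflow E esrc etrg (\<lambda>e. real (count_list es (Some e))) k = 0" if k: "\<forall>g. k \<noteq> (0, 0, g)" for k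
  proof -
    have "net_inflow ?E csrc ctrg (\<lambda>e. real (count_list es e)) k = 0"
      using net_inflow_walk[OF _ es(2) w, where 'r = real] finite_E by simp
    moreover have "net_inflow ?E csrc ctrg (\<lambda>e. real (count_list es e)) k =
        net_inflow E esrc etrg (\<lambda>e. real (count_list es (Some e))) k"
    proof -
      have "of_bool (ctrg None = k) = (0 :: real)" "of_bool (csrc None = k) = (0 :: real)"
        using k by (auto simp: ctrg_def csrc_def hub_def)
      then show ?thesis unfolding net_inflow_def
        using finite_E by (subst sum.insert) (auto simp: sum.reindex csrc_def ctrg_def)
    qed
    ultimately show ?thesis by simp
  qed
  from projection_circulation[OF this] have "net_inflow A src trg (\<lambda>a. real (count_list (arcs_of es) a)) u = 0" for u
    unfolding projection_count[OF es(2), abs_def] .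
  moreover have "net_inflow A src trg (\<lambda>a. real (count_list (arcs_of es) a)) u =
      real_of_int (net_inflow A src trg (\<lambda>a. int (count_list (arcs_of es) a)) u)" for u
    by (simp add: net_inflow_def)
  moreover have "count_list (arcs_of es) a = 0" if "a \<notin> A" for a
    using that set_arcs_of[OF es(2)] by (auto simp: count_list_0_iff)
  ultimately show circ: "count_list (arcs_of es) \<in> circulations" by (simp add: circulations_def)
  assume "None \<in> set es"
  then obtain ps qs where pq: "es = ps @ None # qs" by (auto simp: in_set_conv_decomp)
  obtain k where "walk csrc ctrg n ps k" "walk csrc ctrg k (None # qs) n"
    using w unfolding pq walk_append by blast
  moreover have "csrc None = hub f" "ctrg None = hub (\<lambda>_. 0)" by (simp_all add: csrc_def ctrg_def)
  ultimately have "walk csrc ctrg (hub (\<lambda>_. 0)) qs n" "walk csrc ctrg n ps (hub f)" by auto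
  then have "walk csrc ctrg (hub (\<lambda>_. 0)) (qs @ ps) (hub f)"
    unfolding walk_append by blast
  moreover have "set (qs @ ps) \<subseteq> Some ` E" using es by (auto simp: pq)
  ultimately have "lab f = lab (\<lambda>i. 0 + sum_list (map (W i) (arcs_of (qs @ ps))))"
    using walk_label[of "hub (\<lambda>_. 0)" "qs @ ps" "hub f" "\<lambda>_. 0"] by (simp add: hub_def)
  also have "(\<lambda>i. 0 + sum_list (map (W i) (arcs_of (qs @ ps)))) = weight (count_list (arcs_of es))"
    unfolding weight_def using sum_count_list[OF fin(1) set_arcs_of[OF es(2)], of "W _"]
    by (auto simp: pq arcs_of_append)
  finally show "count_list (arcs_of es) \<in> Y" using circ by (simp add: Y_def)
qed

text \<open>Decompose the closed flow into closed trails. Those through the return arc have total weight 1 and give a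
  convex combination of elements of \<open>Y\<close>; the others give directions in which the hull is unbounded.\<close>

lemma solution_in_hull:
  assumes x: "\<And>a. a \<notin> A \<Longrightarrow> x a = 0" and sol: "solution x z"
  shows "x \<in> convex hull ((\<lambda>y a. real (y a)) ` Y)"
proof -
  let ?E = "insert None (Some ` E)" and ?H = "convex hull ((\<lambda>y a. real (y a)) ` Y)"
  define z' where "z' = case_option 1 (\<lambda>e. of_bool (e \<in> E) * z e)"
  \<comment> \<open>the weight of the return arc is the total weight of the paths; \<open>s\<close> collects them, \<open>r\<close> the rest\<close>
  define Q where "Q \<zeta> \<longleftrightarrow> 0 \<le> \<zeta> None \<and> (\<exists>r\<in>stable. \<exists>s. projection (\<lambda>e. \<zeta> (Some e)) = s + r \<and>
      (if \<zeta> None = 0 then s = (\<lambda>_. 0) else (1 / \<zeta> None) *\<^sub>R s \<in> ?H))" for \<zeta> :: "(int \<times> 'g \<times> 'a) option \<Rightarrow> real"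
  have "Q z'"
  proof (rule circulation_induct[where E = ?E and s = csrc and t = ctrg])
    show "finite ?E" using finite_E by simp
    show "0 \<le> z' e" for e using sol by (cases e) (auto simp: z'_def solution_def)
    show "z' e = 0" if "e \<notin> ?E" for e using that by (cases e) (auto simp: z'_def)
    show "net_inflow ?E csrc ctrg z' n = 0" for n
    proof -
      have "net_inflow ?E csrc ctrg z' n = (of_bool (hub (\<lambda>_. 0) = n) - of_bool (hub f = n)) + net_inflow E esrc etrg z n"
        unfolding net_inflow_def using finite_E
        by (subst sum.insert) (auto simp: sum.reindex csrc_def ctrg_def z'_def)
      then show ?thesis using solution_tight[OF sol, of n] by simp
    qed
    have "projection (\<lambda>_. 0) = (\<lambda>_. 0) + (\<lambda>_. 0)" by (simp add: projection_def fun_eq_iff)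
    then show "Q (\<lambda>_. 0)" unfolding Q_def using stable_zero by auto
  next
    fix \<zeta> :: "(int \<times> 'g \<times> 'a) option \<Rightarrow> real" and c :: real and n es
    assume Q: "Q \<zeta>" and c: "0 < c" and es: "walk csrc ctrg n es n" "distinct es" "set es \<subseteq> ?E"
    define y where "y = count_list (arcs_of es)"
    let ?y = "\<lambda>a. real (y a)"
    obtain r s where rs: "r \<in> stable" "projection (\<lambda>e. \<zeta> (Some e)) = s + r"
      "if \<zeta> None = 0 then s = (\<lambda>_. 0) else (1 / \<zeta> None) *\<^sub>R s \<in> ?H" and \<zeta>: "0 \<le> \<zeta> None"
      using Q unfolding Q_def by blast
    have proj: "projection (\<lambda>e. \<zeta> (Some e) + c * real (count_list es (Some e))) = s + r + (\<lambda>a. c * ?y a)"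
    proof
      fix a
      have "projection (\<lambda>e. \<zeta> (Some e) + c * real (count_list es (Some e))) a =
          projection (\<lambda>e. \<zeta> (Some e)) a + c * projection (\<lambda>e. real (count_list es (Some e))) a"
        by (simp add: projection_def sum.distrib sum_distrib_left distrib_left mult.left_commute)
      then show "projection (\<lambda>e. \<zeta> (Some e) + c * real (count_list es (Some e))) a = (s + r + (\<lambda>a. c * ?y a)) a"
        by (simp add: rs(2) projection_count[OF es(3)] y_def)
    qed
    show "Q (\<lambda>e. \<zeta> e + c * real (count_list es e))"
    proof (cases "None \<in> set es")
      case False
      have "(\<lambda>a. c * ?y a) \<in> stable"
        using stable_circulation[OF closed_trail_circulation(1)[OF es]] c by (simp add: y_def)
      then have "r + (\<lambda>a. c * ?y a) \<in> stable" by (rule stable_add[OF rs(1)])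
      moreover have "count_list es None = 0" using False by (simp add: count_list_0_iff)
      ultimately show ?thesis unfolding Q_def proj using \<zeta> rs(3)
        by (intro conjI bexI[of _ "r + (\<lambda>a. c * ?y a)"] exI[of _ s]) (simp_all add: add.assoc)
    next
      case True
      have "y \<in> Y" unfolding y_def by (rule closed_trail_circulation(2)[OF es True])
      then have yH: "?y \<in> ?H" by (intro hull_inc) auto
      have "count_list es e = of_bool (e \<in> set es)" for e using es(2) by (induction es) auto
      then have one: "count_list es None = 1" using True by simp
      define s' where "s' = s + (\<lambda>a. c * ?y a)"
      have "(1 / (\<zeta> None + c)) *\<^sub>R s' \<in> ?H"
      proof (cases "\<zeta> None = 0")
        case True
        then have "(1 / (\<zeta> None + c)) *\<^sub>R s' = ?y" using rs(3) c by (simp add: s'_def scaleR_fun_def fun_eq_iff)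
        then show ?thesis using yH by simp
      next
        case False
        then have sH: "(1 / \<zeta> None) *\<^sub>R s \<in> ?H" using rs(3) by simp
        have pos: "0 < \<zeta> None" using False \<zeta> by simp
        have "(\<zeta> None / (\<zeta> None + c)) *\<^sub>R ((1 / \<zeta> None) *\<^sub>R s) + (c / (\<zeta> None + c)) *\<^sub>R ?y \<in> ?H"
          using c \<zeta> by (intro convexD[OF convex_convex_hull sH yH]) (auto simp: add_divide_distrib[symmetric])
        also have "(\<zeta> None / (\<zeta> None + c)) *\<^sub>R ((1 / \<zeta> None) *\<^sub>R s) + (c / (\<zeta> None + c)) *\<^sub>R ?y = (1 / (\<zeta> None + c)) *\<^sub>R s'"
          using pos by (simp add: s'_def scaleR_fun_def fun_eq_iff add_divide_distrib)
        finally show ?thesis .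
      qed
      moreover have "s + r + (\<lambda>a. c * ?y a) = s' + r" by (simp add: s'_def fun_eq_iff)
      ultimately show ?thesis unfolding Q_def proj one using \<zeta> c rs(1) by (auto intro!: bexI[of _ r] exI[of _ s'])
    qed
  qed
  then obtain r s where rs: "r \<in> stable" "projection (\<lambda>e. z' (Some e)) = s + r" "s \<in> ?H"
    unfolding Q_def by (auto simp: z'_def)
  have "x = projection (\<lambda>e. z' (Some e))"
  proof
    fix a show "x a = projection (\<lambda>e. z' (Some e)) a"
      using x[of a] sol by (cases "a \<in> A") (auto simp: projection_def z'_def solution_def E_def intro!: sum.cong)
  qed
  then show ?thesis using rs by (simp add: stable_def)
qed

theorem solutions_eq_hull:
  "{x. (\<forall>a. a \<notin> A \<longrightarrow> x a = 0) \<and> (\<exists>z. solution x z)} = convex hull ((\<lambda>y a. real (y a)) ` Y)"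
proof
  show "convex hull ((\<lambda>y a. real (y a)) ` Y) \<subseteq> {x. (\<forall>a. a \<notin> A \<longrightarrow> x a = 0) \<and> (\<exists>z. solution x z)}"
  proof (rule hull_minimal)
    show "(\<lambda>y a. real (y a)) ` Y \<subseteq> {x. (\<forall>a. a \<notin> A \<longrightarrow> x a = 0) \<and> (\<exists>z. solution x z)}"
      using circulation_solution by (auto simp: Y_def circulations_def)
  qed (rule convex_solutions)
qed (use solution_in_hull in blast)

end


section \<open>List functions in polynomial time\<close>

lemma PT_outer:
  assumes "PT I N \<rho> F" "\<And>q. q \<in> Q \<Longrightarrow> fst q \<in> I"
  shows "PT Q (\<lambda>q. N (fst q)) (\<lambda>q. x q # \<rho> (fst q)) (\<lambda>q. F (fst q))"
  by (rule PT_weaken[OF assms(1)]) (use assms(2) in auto)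

lemma PT_outer2:
  assumes "PT I N \<rho> F" "\<And>q. q \<in> Q \<Longrightarrow> fst q \<in> I"
  shows "PT Q (\<lambda>q. N (fst q)) (\<lambda>q. x q # y q # \<rho> (fst q)) (\<lambda>q. F (fst q))"
  by (rule PT_weaken2[OF assms(1)]) (use assms(2) in auto)

lemma val_size_enc_list_append:
  "val_size (enc_list g (xs @ ys)) \<le> val_size (enc_list g xs) + val_size (enc_list g ys)"
  by (induction xs) auto

lemma PT_append:
  assumes "PT I N \<rho> (\<lambda>c. enc_list g (xs c))" "PT I N \<rho> (\<lambda>c. enc_list g (ys c))"
  shows "PT I N \<rho> (\<lambda>c. enc_list g (xs c @ ys c))"
proof -
  have eq: "foldr (#) as bs = as @ bs" for as bs :: "'b list" by (induction as) auto
  have "PT I N \<rho> (\<lambda>c. enc_list g (foldr (#) (xs c) (ys c)))"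
  proof (rule PT_foldr[where ex = g and ey = "enc_list g" and xs = xs and b = ys and f = "\<lambda>_ x a. x # a"])
    show "PT I N \<rho> (\<lambda>c. enc_list g (xs c))" "PT I N \<rho> (\<lambda>c. enc_list g (ys c))" by (rule assms)+
    fix J assume b: "poly_bounded J N (\<lambda>c. val_size (enc_list g (xs c)))"
      "poly_bounded J N (\<lambda>c. val_size (enc_list g (ys c)))"
    show "\<exists>T. poly_bounded J N T \<and> (\<forall>c\<in>J. \<forall>zs. suffix zs (xs c) \<longrightarrow>
        val_size (enc_list g (foldr (#) zs (ys c))) \<le> T c)"
      by (intro exI conjI, rule poly_bounded_add[OF b])
         (auto simp: eq intro!: order_trans[OF val_size_enc_list_append] val_size_enc_list_suffix)
  qed (intro PT_Cons PT_var0 PT_var1)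
  then show ?thesis by (simp add: eq)
qed

lemma PT_concat:
  assumes "PT I N \<rho> (\<lambda>c. enc_list (enc_list g) (xss c))"
  shows "PT I N \<rho> (\<lambda>c. enc_list g (concat (xss c)))"
proof -
  have size: "val_size (enc_list g (concat zss)) \<le> val_size (enc_list (enc_list g) zss)" for zss
  proof (induction zss)
    case (Cons zs zss)
    then show ?case using val_size_enc_list_append[of g zs "concat zss"] by simp
  qed simp
  have eq: "foldr (@) zss [] = concat zss" for zss :: "'b list list" by (induction zss) auto
  have "PT I N \<rho> (\<lambda>c. enc_list g (foldr (@) (xss c) []))"
  proof (rule PT_foldr[OF assms, where f = "\<lambda>_ x a. x @ a" and b = "\<lambda>_. []"])
    fix J assume b: "poly_bounded J N (\<lambda>c. val_size (enc_list (enc_list g) (xss c)))"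
    show "\<exists>T. poly_bounded J N T \<and> (\<forall>c\<in>J. \<forall>zs. suffix zs (xss c) \<longrightarrow>
        val_size (enc_list g (foldr (@) zs [])) \<le> T c)"
      by (intro exI conjI, rule b)
         (auto simp: eq intro: order_trans[OF size] val_size_enc_list_suffix)
  qed (rule PT_Nil PT_append PT_var0 PT_var1)+
  then show ?thesis by (simp add: eq)
qed

lemma PT_concat_map:
  assumes "PT I N \<rho> (\<lambda>c. enc_list ex (xs c))"
    and "PT {q. fst q \<in> I \<and> snd q \<in> set (xs (fst q))}
          (\<lambda>q. N (fst q)) (\<lambda>q. ex (snd q) # \<rho> (fst q)) (\<lambda>q. enc_list ey (f (fst q) (snd q)))"
  shows "PT I N \<rho> (\<lambda>c. enc_list ey (concat (map (f c) (xs c))))"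
  by (rule PT_concat, rule PT_map) (rule assms)+

lemma PT_length:
  assumes "PT I N \<rho> (\<lambda>c. enc_list g (xs c))"
  shows "PT I N \<rho> (\<lambda>c. Num (int (length (xs c))))"
proof -
  have eq: "foldr (\<lambda>_ n. n + 1) zs 0 = int (length zs)" for zs :: "'b list" by (induction zs) auto
  have "PT I N \<rho> (\<lambda>c. Num (foldr (\<lambda>_ n. n + 1) (xs c) 0))"
  proof (rule PT_foldr[OF assms, where f = "\<lambda>_ _ n. n + 1" and b = "\<lambda>_. 0" and ey = Num])
    fix J assume b: "poly_bounded J N (\<lambda>c. val_size (enc_list g (xs c)))"
    show "\<exists>T. poly_bounded J N T \<and> (\<forall>c\<in>J. \<forall>zs. suffix zs (xs c) \<longrightarrow>
        val_size (Num (foldr (\<lambda>_ n. n + 1) zs 0)) \<le> T c)"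
    proof (intro exI conjI ballI allI impI, rule poly_bounded_add[OF b poly_bounded_const])
      fix c zs assume "suffix zs (xs c)"
      then show "val_size (Num (foldr (\<lambda>_ n. n + 1) zs 0)) \<le> val_size (enc_list g (xs c)) + 1"
        unfolding eq using int_bits_le_self[of "length zs"] length_le_val_size[of zs g]
          val_size_enc_list_suffix[of zs "xs c" g] by simp
    qed
  qed (intro PT_Lit PT_add PT_var1)+
  then show ?thesis by (simp add: eq)
qed

lemma int_bits_sum_list: "int_bits (sum_list xs) \<le> val_size (enc_list Num xs)"
proof (induction xs)
  case (Cons x xs)
  then show ?case using int_bits_arith_op[of Add x "sum_list xs"] by simp
qed (simp add: int_bits_def)

lemma PT_sum_list:
  assumes "PT I N \<rho> (\<lambda>c. enc_list Num (xs c))"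
  shows "PT I N \<rho> (\<lambda>c. Num (sum_list (xs c)))"
proof -
  have "PT I N \<rho> (\<lambda>c. Num (foldr (+) (xs c) 0))"
  proof (rule PT_foldr[OF assms, where f = "\<lambda>_ x n. x + n" and b = "\<lambda>_. 0" and ey = Num])
    fix J assume b: "poly_bounded J N (\<lambda>c. val_size (enc_list Num (xs c)))"
    show "\<exists>T. poly_bounded J N T \<and> (\<forall>c\<in>J. \<forall>zs. suffix zs (xs c) \<longrightarrow>
        val_size (Num (foldr (+) zs 0)) \<le> T c)"
      by (intro exI conjI, rule b)
         (auto simp flip: sum_list.eq_foldr intro: order_trans[OF int_bits_sum_list] val_size_enc_list_suffix)
  qed (rule PT_Lit PT_add PT_var0 PT_var1)+
  then show ?thesis by (simp add: sum_list.eq_foldr)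
qed

lemma PT_ex:
  assumes "PT I N \<rho> (\<lambda>c. enc_list ex (xs c))"
    and "PT {q. fst q \<in> I \<and> snd q \<in> set (xs (fst q))}
          (\<lambda>q. N (fst q)) (\<lambda>q. ex (snd q) # \<rho> (fst q)) (\<lambda>q. Num (of_bool (P (fst q) (snd q))))"
  shows "PT I N \<rho> (\<lambda>c. Num (of_bool (\<exists>x\<in>set (xs c). P c x)))"
proof -
  have "PT I N \<rho> (\<lambda>c. enc_list Num (map (\<lambda>x. of_bool (P c x)) (xs c)))"
    by (rule PT_map[OF assms(1)]) (rule assms(2))
  from PT_less[OF PT_Lit[where i = 0] PT_sum_list[OF this]]
  have "PT I N \<rho> (\<lambda>c. Num (of_bool (0 < (\<Sum>x\<leftarrow>xs c. of_bool (P c x) :: int))))" .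
  moreover have pos: "0 \<le> (\<Sum>x\<leftarrow>zs. of_bool (P c x) :: int)" for c zs
    by (induction zs) auto
  have "(0 < (\<Sum>x\<leftarrow>zs. of_bool (P c x) :: int)) \<longleftrightarrow> (\<exists>x\<in>set zs. P c x)" for c zs
  proof (induction zs)
    case (Cons z zs)
    then show ?case using pos[where c = c and zs = zs] by (cases "P c z") auto
  qed simp
  ultimately show ?thesis by simp
qed

abbreviation EL :: "int list \<Rightarrow> val" where "EL \<equiv> enc_list Num"
abbreviation EM :: "int list list \<Rightarrow> val" where "EM \<equiv> enc_list EL"

lemma PT_eq_list:
  assumes xs: "PT I N \<rho> (\<lambda>c. EL (xs c))" and ys: "PT I N \<rho> (\<lambda>c. EL (ys c))"
  shows "PT I N \<rho> (\<lambda>c. Num (of_bool (xs c = ys c)))"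
proof -
  have len: "PT I N \<rho> (\<lambda>c. Num (of_bool (int (length (xs c)) = int (length (ys c)))))"
    by (intro PT_eq PT_length[OF xs] PT_length[OF ys])
  have ex: "PT I N \<rho> (\<lambda>c. Num (of_bool (\<exists>p\<in>set (zip (xs c) (ys c)). \<not> fst p = snd p)))"
    by (rule PT_ex[OF PT_zip[OF xs ys]], rule PT_not[OF PT_eq[OF PT_fst[OF PT_var0] PT_snd[OF PT_var0]]])
  have "xs c = ys c \<longleftrightarrow> int (length (xs c)) = int (length (ys c)) \<and>
      \<not> (\<exists>p\<in>set (zip (xs c) (ys c)). \<not> fst p = snd p)" for c
    by (auto simp: list_eq_iff_zip_eq)
  then show ?thesis using PT_conj[OF len PT_not[OF ex]] by simp
qed

lemma PT_member:
  assumes "PT I N \<rho> (\<lambda>c. EL (x c))" "PT I N \<rho> (\<lambda>c. EM (xs c))"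
  shows "PT I N \<rho> (\<lambda>c. Num (of_bool (x c \<in> set (xs c))))"
proof -
  have "PT I N \<rho> (\<lambda>c. Num (of_bool (\<exists>y\<in>set (xs c). x c = y)))"
    by (rule PT_ex[OF assms(2)], rule PT_eq_list[OF PT_outer[OF assms(1)] PT_var0]) simp
  then show ?thesis by simp
qed

lemma PT_remdups:
  assumes "PT I N \<rho> (\<lambda>c. EM (xs c))"
  shows "PT I N \<rho> (\<lambda>c. EM (remdups (xs c)))"
proof -
  have eq: "foldr (\<lambda>x acc. if x \<in> set acc then acc else x # acc) zs [] = remdups zs" for zs :: "int list list"
    by (induction zs) auto
  have size: "val_size (EM (remdups zs)) \<le> val_size (EM zs)" for zs by (induction zs) auto
  have if_enc: "EM (if b then u else v) = (if b then EM u else EM v)" for b u v by simp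
  have "PT I N \<rho> (\<lambda>c. EM (foldr (\<lambda>x acc. if x \<in> set acc then acc else x # acc) (xs c) []))"
  proof (rule PT_foldr[OF assms, where f = "\<lambda>_ x acc. if x \<in> set acc then acc else x # acc" and b = "\<lambda>_. []" and ey = EM])
    fix J assume b: "poly_bounded J N (\<lambda>c. val_size (EM (xs c)))"
    show "\<exists>T. poly_bounded J N T \<and> (\<forall>c\<in>J. \<forall>zs. suffix zs (xs c) \<longrightarrow>
        val_size (EM (foldr (\<lambda>x acc. if x \<in> set acc then acc else x # acc) zs [])) \<le> T c)"
      by (intro exI conjI, rule b)
         (auto simp: eq intro: order_trans[OF size] val_size_enc_list_suffix)
  qed (rule PT_Nil, unfold if_enc, intro PT_if PT_member PT_Cons PT_var0 PT_var1)
  then show ?thesis by (simp add: eq)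
qed

lemma PT_map2:
  assumes "PT I N \<rho> (\<lambda>c. enc_list ex (xs c))" "PT I N \<rho> (\<lambda>c. enc_list ey (ys c))"
    and "PT {q. fst q \<in> I \<and> snd q \<in> set (zip (xs (fst q)) (ys (fst q)))}
          (\<lambda>q. N (fst q)) (\<lambda>q. enc_pair ex ey (snd q) # \<rho> (fst q))
          (\<lambda>q. ez (f (fst q) (fst (snd q)) (snd (snd q))))"
  shows "PT I N \<rho> (\<lambda>c. enc_list ez (map2 (f c) (xs c) (ys c)))"
  unfolding case_prod_unfold
  by (rule PT_map[OF PT_zip[OF assms(1,2)]]) (rule assms(3))

lemmas PT_pair_var = PT_fst[OF PT_var0] PT_snd[OF PT_var0]

lemma PT_dot:
  assumes "PT I N \<rho> (\<lambda>c. EL (xs c))" "PT I N \<rho> (\<lambda>c. EL (ys c))"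
  shows "PT I N \<rho> (\<lambda>c. Num (dot (xs c) (ys c)))"
  unfolding dot_def
  by (rule PT_sum_list, rule PT_map2[OF assms], rule PT_mul[OF PT_pair_var])

section \<open>The algorithm in polynomial time\<close>

subsection \<open>Elimination\<close>

lemma PT_elim:
  assumes h: "PT I N \<rho> (\<lambda>c. EL (h c))" and \<delta>: "PT I N \<rho> (\<lambda>c. Num (\<delta> c))"
    and p: "PT I N \<rho> (\<lambda>c. EL (p c))" and x: "PT I N \<rho> (\<lambda>c. EL (x c))"
  shows "PT I N \<rho> (\<lambda>c. EL (elim (h c) (\<delta> c) (p c) (x c)))"
  unfolding elim_def elim_raw_def
  by (rule PT_map, rule PT_map2[OF x p],
      rule PT_sub[OF PT_mul[OF PT_outer[OF PT_dot[OF h p]] PT_fst[OF PT_var0]]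
        PT_mul[OF PT_outer[OF PT_dot[OF h x]] PT_snd[OF PT_var0]]], simp, simp,
      rule PT_div[OF PT_var0 PT_outer[OF \<delta>]]) simp

lemma PT_pick:
  assumes h: "PT I N \<rho> (\<lambda>c. EL (h c))" and cs: "PT I N \<rho> (\<lambda>c. EM (cs c))"
  shows "PT I N \<rho> (\<lambda>c. enc_pair EM EM (pick (h c) (cs c)))"
  unfolding pick_def
proof (rule PT_foldr[OF cs, where b = "\<lambda>_. ([], [])" and ey = "enc_pair EM EM" and
      f = "\<lambda>c x s. if fst s = [] \<and> dot (h c) x \<noteq> 0 then ([x], snd s) else (fst s, x # snd s)"])
  show "PT I N \<rho> (\<lambda>_. enc_pair EM EM ([], []))" by (intro PT_pair PT_Nil)
  have if_enc: "enc_pair EM EM (if b then u else v) = (if b then enc_pair EM EM u else enc_pair EM EM v)" for b u v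
    by simp
  let ?Q = "{q. fst q \<in> I \<and> (\<exists>ys. suffix (fst (snd q) # ys) (cs (fst q)) \<and>
      snd (snd q) = foldr (\<lambda>x s. if fst s = [] \<and> dot (h (fst q)) x \<noteq> 0 then ([x], snd s) else (fst s, x # snd s)) ys ([], []))}"
  let ?\<rho> = "\<lambda>q. EL (fst (snd q)) # enc_pair EM EM (snd (snd q)) # \<rho> (fst q)"
  have "PT ?Q (\<lambda>q. N (fst q)) ?\<rho> (\<lambda>q. Num (of_bool (\<not> fst (snd (snd q)) \<noteq> [] \<and> \<not> dot (h (fst q)) (fst (snd q)) = 0)))"
    by (rule PT_conj[OF PT_not[OF PT_nonempty[OF PT_fst[OF PT_var1]]] PT_not[OF PT_eq[OF PT_dot[OF PT_outer2[OF h] PT_var0] PT_Lit]]]) simp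
  then have b: "PT ?Q (\<lambda>q. N (fst q)) ?\<rho> (\<lambda>q. Num (of_bool (fst (snd (snd q)) = [] \<and> dot (h (fst q)) (fst (snd q)) \<noteq> 0)))"
    by simp
  show "PT ?Q (\<lambda>q. N (fst q)) ?\<rho> (\<lambda>q. enc_pair EM EM (if fst (snd (snd q)) = [] \<and> dot (h (fst q)) (fst (snd q)) \<noteq> 0
      then ([fst (snd q)], snd (snd (snd q))) else (fst (snd (snd q)), fst (snd q) # snd (snd (snd q)))))"
    unfolding if_enc
    by (rule PT_if[OF b]) (intro PT_pair PT_Cons PT_Nil PT_var0 PT_fst[OF PT_var1] PT_snd[OF PT_var1])+
  fix J assume b: "poly_bounded J N (\<lambda>c. val_size (EM (cs c)))"
  show "\<exists>T. poly_bounded J N T \<and> (\<forall>c\<in>J. \<forall>zs. suffix zs (cs c) \<longrightarrow>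
      val_size (enc_pair EM EM (foldr (\<lambda>x s. if fst s = [] \<and> dot (h c) x \<noteq> 0 then ([x], snd s)
        else (fst s, x # snd s)) zs ([], []))) \<le> T c)"
  proof (intro exI conjI ballI allI impI, rule poly_bounded_add[OF b poly_bounded_const])
    fix c zs assume zs: "suffix zs (cs c)"
    have "val_size (enc_pair EM EM (pick (h c) zs)) \<le> val_size (EM zs) + 3"
      by (induction zs) (auto simp: pick_def enc_pair_def int_bits_def)
    then show "val_size (enc_pair EM EM (foldr (\<lambda>x s. if fst s = [] \<and> dot (h c) x \<noteq> 0 then ([x], snd s)
        else (fst s, x # snd s)) zs ([], []))) \<le> val_size (EM (cs c)) + 3"
      using val_size_enc_list_suffix[OF zs, of EL] by (simp add: pick_def)
  qed
qed

abbreviation enc_state :: "elim_state \<Rightarrow> val" where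
  "enc_state \<equiv> enc_pair Num (enc_pair EM EM)"

lemma PT_insert_row:
  assumes h: "PT I N \<rho> (\<lambda>c. EL (h c))" and s: "PT I N \<rho> (\<lambda>c. enc_state (s c))"
  shows "PT I N \<rho> (\<lambda>c. enc_state (insert_row (h c) (s c)))"
proof -
  have if_enc: "enc_state (if b then u else v) = (if b then enc_state u else enc_state v)" for b u v
    by simp
  have pk: "PT I N \<rho> (\<lambda>c. enc_pair EM EM (pick (h c) (snd (snd (s c)))))"
    by (rule PT_pick[OF h PT_snd[OF PT_snd[OF s]]])
  have b: "PT I N \<rho> (\<lambda>c. Num (of_bool (fst (pick (h c) (snd (snd (s c)))) = [])))"
    using PT_not[OF PT_nonempty[OF PT_fst[OF pk]]] by simp
  let ?I = "{c \<in> I. fst (pick (h c) (snd (snd (s c)))) \<noteq> []}"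
  have p: "PT ?I N \<rho> (\<lambda>c. EL (hd (fst (pick (h c) (snd (snd (s c)))))))"
    by (rule PT_hd[OF PT_subset[OF PT_fst[OF pk]]]) auto
  have h': "PT ?I N \<rho> (\<lambda>c. EL (h c))" and s': "PT ?I N \<rho> (\<lambda>c. enc_state (s c))"
    and pk': "PT ?I N \<rho> (\<lambda>c. enc_pair EM EM (pick (h c) (snd (snd (s c)))))"
    by (rule PT_subset[OF h] PT_subset[OF s] PT_subset[OF pk]; simp)+
  have el: "PT ?I N \<rho> (\<lambda>c. EM (map (elim (h c) (fst (s c)) (hd (fst (pick (h c) (snd (snd (s c))))))) (xs c)))"
    if "PT ?I N \<rho> (\<lambda>c. EM (xs c))" for xs
    by (rule PT_map[OF that], rule PT_elim[OF PT_outer[OF h'] PT_outer[OF PT_fst[OF s']] PT_outer[OF p] PT_var0])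
       simp_all
  show ?thesis
    unfolding insert_row_def Let_def if_enc
    by (rule PT_if[OF b PT_subset[OF s]], simp)
       (intro PT_pair PT_Cons PT_dot h' p el PT_fst[OF PT_snd[OF s']] PT_snd[OF pk'])
qed

text \<open>All accumulators of \<open>eliminate\<close> have polynomial size only because they consist of minors, so the rule for
  elimination is restricted to square nonsingular matrices.\<close>

definition nonsingular :: "int list list \<Rightarrow> bool" where
  "nonsingular R \<longleftrightarrow> (\<forall>r\<in>set R. length r = length R) \<and> det (rowmat (length R) R) \<noteq> 0"

lemma fact_le_two_power: "(fact d :: int) \<le> 2 ^ (d * d)"
proof -
  have "(fact d :: int) \<le> int (d ^ d)" by (rule fact_le_power)
  also have "\<dots> \<le> int ((2 ^ d) ^ d)" unfolding of_nat_le_iff using less_exp[of d] by (intro power_mono) auto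
  also have "\<dots> = 2 ^ (d * d)" by (simp add: power_mult)
  finally show ?thesis .
qed

lemma elim_state_size:
  assumes R: "nonsingular R" and ks: "distinct ks" "length ks = length R" and ys: "suffix ys R"
  defines "s \<equiv> val_size (EM R)"
  shows "val_size (enc_state (foldr insert_row ys (1, [], ident ks)))
    \<le> 5 + (2 * s * s + 2) + 2 * (s * (2 + s * (1 + (2 * s * s + 2))) + 1)"
proof -
  define d where "d = length R"
  obtain pre where pre: "R = pre @ ys" using ys by (auto simp: suffix_def)
  obtain us where inv: "elim_inv d ks ys (foldr insert_row ys (1, [], ident ks)) us"
    using elim_inv_suffix[of ks d pre ys] ks R pre by (auto simp: d_def nonsingular_def)
  define st where "st = foldr insert_row ys (1, [], ident ks)"
  note inv = inv[folded st_def]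
  have d: "d \<le> s" unfolding d_def s_def by (rule length_le_val_size)
  have ent: "\<bar>x\<bar> \<le> 2 ^ s" if "r \<in> set ys" "x \<in> set r" for r x
  proof -
    have "int_bits x \<le> s"
      using that pre val_size_enc_list_mem[of x r Num] val_size_enc_list_mem[of r R EL]
      by (simp add: s_def)
    then have "(2::int) ^ (int_bits x - 1) \<le> 2 ^ s" by (intro power_increasing) auto
    then show ?thesis by (rule less_imp_le[OF less_le_trans[OF abs_less_two_power_int_bits]])
  qed
  have B: "fact d * (2 ^ s) ^ d < (2 :: int) ^ (2 * s * s + 1)"
  proof -
    have "fact d * (2 ^ s) ^ d \<le> (2 :: int) ^ (d * d) * 2 ^ (s * d)"
      using fact_le_two_power[of d] by (simp add: power_mult)
    also have "\<dots> = 2 ^ (d * d + s * d)" by (simp add: power_add)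
    also have "\<dots> < 2 ^ (2 * s * s + 1)"
    proof (rule power_strict_increasing)
      have "d * d \<le> s * s" "s * d \<le> s * s" using d by (simp_all add: mult_le_mono)
      then show "d * d + s * d < 2 * s * s + 1" by linarith
    qed simp
    finally show ?thesis .
  qed
  have b1: "int_bits (fst st) \<le> 2 * s * s + 2"
  proof -
    have "\<bar>fst st\<bar> \<le> fact d * (2 ^ s) ^ d" by (rule elim_inv_bound(1)[OF inv]) (auto intro: ent)
    from int_bits_le[OF le_less_trans[OF this B]] show ?thesis by simp
  qed
  have b2: "int_bits x \<le> 2 * s * s + 2" if "c \<in> set (fst (snd st) @ snd (snd st))" "x \<in> set c" for c x
  proof -
    have "\<bar>x\<bar> \<le> fact d * (2 ^ s) ^ d" by (rule elim_inv_bound(2)[OF inv _ _ that]) (auto intro: ent)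
    from int_bits_le[OF le_less_trans[OF this B]] show ?thesis by simp
  qed
  have len: "\<And>c. c \<in> set (fst (snd st) @ snd (snd st)) \<Longrightarrow> length c \<le> s"
    and len': "length (fst (snd st)) \<le> s" "length (snd (snd st)) \<le> s"
    using inv d by (auto simp: elim_inv_def)
  have c: "val_size (EL c) \<le> s * (1 + (2 * s * s + 2)) + 1"
    if "c \<in> set (fst (snd st) @ snd (snd st))" for c
    by (rule val_size_enc_list_le[OF len[OF that]]) (use b2[OF that] in simp)
  have "val_size (EM cs) \<le> s * (1 + (s * (1 + (2 * s * s + 2)) + 1)) + 1"
    if "set cs \<subseteq> set (fst (snd st) @ snd (snd st))" "length cs \<le> s" for cs
    by (rule val_size_enc_list_le[OF that(2)]) (use c that(1) in blast)
  from this[of "fst (snd st)"] this[of "snd (snd st)"] b1 len'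
  show ?thesis unfolding st_def[symmetric] by (simp add: enc_pair_def)
qed

lemma PT_ident:
  assumes "PT I N \<rho> (\<lambda>c. EL (ks c))"
  shows "PT I N \<rho> (\<lambda>c. EM (ident (ks c)))"
  unfolding ident_def
  by (rule PT_map[OF assms], rule PT_map[OF PT_outer[OF assms]], simp,
      rule PT_eq[OF PT_var1 PT_var0])

lemma PT_eliminate:
  assumes R: "PT I N \<rho> (\<lambda>c. EM (R c))" and ks: "PT I N \<rho> (\<lambda>c. EL (ks c))"
    and ns: "\<And>c. c \<in> I \<Longrightarrow> nonsingular (R c) \<and> distinct (ks c) \<and> length (ks c) = length (R c)"
  shows "PT I N \<rho> (\<lambda>c. enc_state (eliminate (R c) (ks c)))"
  unfolding eliminate_def
proof (rule PT_foldr[OF R, where f = "\<lambda>_. insert_row" and b = "\<lambda>c. (1, [], ident (ks c))" and ey = enc_state])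
  show "PT I N \<rho> (\<lambda>c. enc_state (1, [], ident (ks c)))"
    by (intro PT_pair PT_Lit PT_Nil PT_ident ks)
  fix J assume J: "J \<subseteq> I" and b: "poly_bounded J N (\<lambda>c. val_size (EM (R c)))"
  let ?s = "\<lambda>c. val_size (EM (R c))"
  show "\<exists>T. poly_bounded J N T \<and> (\<forall>c\<in>J. \<forall>ys. suffix ys (R c) \<longrightarrow>
      val_size (enc_state (foldr insert_row ys (1, [], ident (ks c)))) \<le> T c)"
  proof (intro exI conjI ballI allI impI)
    show "poly_bounded J N (\<lambda>c. 5 + (2 * ?s c * ?s c + 2) + 2 * (?s c * (2 + ?s c * (1 + (2 * ?s c * ?s c + 2))) + 1))"
      by (intro poly_bounded_rules b)
    fix c ys assume "c \<in> J" "suffix ys (R c)"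
    then show "val_size (enc_state (foldr insert_row ys (1, [], ident (ks c)))) \<le>
        5 + (2 * ?s c * ?s c + 2) + 2 * (?s c * (2 + ?s c * (1 + (2 * ?s c * ?s c + 2))) + 1)"
      using elim_state_size[of "R c" "ks c" ys] ns J by blast
  qed
qed (intro PT_insert_row PT_var0 PT_var1)


subsection \<open>Labels\<close>

definition add_mod :: "int \<Rightarrow> int \<Rightarrow> int list \<Rightarrow> int list \<Rightarrow> int list" where
  "add_mod \<delta> k x y = map2 (\<lambda>a b. (a + k * b) mod \<delta>) x y"

text \<open>The residues modulo \<open>\<delta>\<close> of the combination of the columns \<open>cs\<close> with coefficients \<open>w\<close>; \<open>z\<close> is the zero vector.\<close>

definition label :: "int \<Rightarrow> int list list \<Rightarrow> int list \<Rightarrow> int list \<Rightarrow> int list" where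
  "label \<delta> cs z w = foldr (\<lambda>p acc. add_mod \<delta> (fst p) acc (snd p)) (zip w cs) z"

text \<open>The labels of all arcs at once, as the input gives the weights row by row; \<open>tm\<close> only supplies the number
  of arcs.\<close>

definition arc_labels :: "int \<Rightarrow> int list list \<Rightarrow> int list \<Rightarrow> int list list \<Rightarrow> int list \<Rightarrow> int list list" where
  "arc_labels \<delta> cs z ww tm =
     foldr (\<lambda>p acc. map2 (\<lambda>l k. add_mod \<delta> k l (snd p)) acc (fst p)) (zip ww cs) (map (\<lambda>_. z) tm)"

lemma PT_add_mod:
  assumes \<delta>: "PT I N \<rho> (\<lambda>c. Num (\<delta> c))" and k: "PT I N \<rho> (\<lambda>c. Num (k c))"
    and x: "PT I N \<rho> (\<lambda>c. EL (x c))" and y: "PT I N \<rho> (\<lambda>c. EL (y c))"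
  shows "PT I N \<rho> (\<lambda>c. EL (add_mod (\<delta> c) (k c) (x c) (y c)))"
  unfolding add_mod_def
  by (rule PT_map2[OF x y], rule PT_mod[OF PT_add[OF PT_fst[OF PT_var0]
        PT_mul[OF PT_outer[OF k] PT_snd[OF PT_var0]]] PT_outer[OF \<delta>]]) auto

text \<open>Reducing modulo \<open>\<delta>\<close> at every step keeps the labels small.\<close>

definition reduced :: "int \<Rightarrow> nat \<Rightarrow> int list \<Rightarrow> bool" where
  "reduced \<delta> n x \<longleftrightarrow> length x \<le> n \<and> (\<forall>a\<in>set x. \<bar>a\<bar> \<le> \<bar>\<delta>\<bar>)"

lemma reduced_add_mod:
  assumes "\<delta> \<noteq> 0" "length x \<le> n"
  shows "reduced \<delta> n (add_mod \<delta> k x y)"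
proof -
  have "\<bar>a mod \<delta>\<bar> \<le> \<bar>\<delta>\<bar>" for a using assms(1) abs_mod_less[of \<delta> a] by simp
  then show ?thesis using assms(2) by (auto simp: reduced_def add_mod_def)
qed

lemma int_bits_le_nat_abs: "int_bits x \<le> nat \<bar>x\<bar> + 1"
  using int_bits_mono[of x "int (nat \<bar>x\<bar>)"] int_bits_le_self[of "nat \<bar>x\<bar>"] by simp

lemma reduced_size: "reduced \<delta> n x \<Longrightarrow> val_size (EL x) \<le> n * (2 + nat \<bar>\<delta>\<bar>) + 1"
proof -
  assume *: "reduced \<delta> n x"
  have "val_size (EL x) \<le> n * (1 + (nat \<bar>\<delta>\<bar> + 1)) + 1"
  proof (rule val_size_enc_list_le)
    fix a assume "a \<in> set x"
    then have "nat \<bar>a\<bar> \<le> nat \<bar>\<delta>\<bar>" using * by (auto simp: reduced_def)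
    then show "val_size (Num a) \<le> nat \<bar>\<delta>\<bar> + 1" using int_bits_le_nat_abs[of a] by simp
  qed (use * in \<open>simp add: reduced_def\<close>)
  then show ?thesis by simp
qed

lemma PT_label:
  assumes \<delta>: "PT I N \<rho> (\<lambda>c. Num (\<delta> c))" "poly_bounded I N (\<lambda>c. nat \<bar>\<delta> c\<bar>)" "\<And>c. c \<in> I \<Longrightarrow> \<delta> c \<noteq> 0"
    and cs: "PT I N \<rho> (\<lambda>c. EM (cs c))" and z: "PT I N \<rho> (\<lambda>c. EL (z c))"
    and z0: "\<And>c. c \<in> I \<Longrightarrow> set (z c) \<subseteq> {0}"
    and w: "PT I N \<rho> (\<lambda>c. EL (w c))"
  shows "PT I N \<rho> (\<lambda>c. EL (label (\<delta> c) (cs c) (z c) (w c)))"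
  unfolding label_def
proof (rule PT_foldr[OF PT_zip[OF w cs], where b = z and ey = EL and f = "\<lambda>c p acc. add_mod (\<delta> c) (fst p) acc (snd p)"])
  fix J assume J: "J \<subseteq> I" and b: "poly_bounded J N (\<lambda>c. val_size (EL (z c)))"
  show "\<exists>T. poly_bounded J N T \<and> (\<forall>c\<in>J. \<forall>ys. suffix ys (zip (w c) (cs c)) \<longrightarrow>
      val_size (EL (foldr (\<lambda>p acc. add_mod (\<delta> c) (fst p) acc (snd p)) ys (z c))) \<le> T c)"
  proof (intro exI conjI ballI allI impI)
    show "poly_bounded J N (\<lambda>c. val_size (EL (z c)) * (2 + nat \<bar>\<delta> c\<bar>) + 1)"
      by (intro poly_bounded_rules b poly_bounded_subset[OF \<delta>(2) J])
    fix c and ys :: "(int \<times> int list) list" assume c: "c \<in> J"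
    have "reduced (\<delta> c) (val_size (EL (z c))) (foldr (\<lambda>p acc. add_mod (\<delta> c) (fst p) acc (snd p)) ys (z c))"
    proof (induction ys)
      case Nil
      have "\<forall>a\<in>set (z c). a = 0" using z0[of c] c J by blast
      then show ?case using length_le_val_size[of "z c" Num] by (auto simp: reduced_def)
    next
      case (Cons p ys)
      then show ?case using \<delta>(3)[of c] c J by (auto intro!: reduced_add_mod simp: reduced_def[of "\<delta> c" _ "foldr _ _ _"])
    qed
    then show "val_size (EL (foldr (\<lambda>p acc. add_mod (\<delta> c) (fst p) acc (snd p)) ys (z c))) \<le>
        val_size (EL (z c)) * (2 + nat \<bar>\<delta> c\<bar>) + 1"
      by (rule reduced_size)
  qed
qed (rule z, rule PT_add_mod[OF PT_outer2[OF \<delta>(1)] PT_fst[OF PT_var0] PT_var1 PT_snd[OF PT_var0]], simp)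

lemma PT_arc_labels:
  assumes \<delta>: "PT I N \<rho> (\<lambda>c. Num (\<delta> c))" "poly_bounded I N (\<lambda>c. nat \<bar>\<delta> c\<bar>)" "\<And>c. c \<in> I \<Longrightarrow> \<delta> c \<noteq> 0"
    and cs: "PT I N \<rho> (\<lambda>c. EM (cs c))" and z: "PT I N \<rho> (\<lambda>c. EL (z c))"
    and z0: "\<And>c. c \<in> I \<Longrightarrow> set (z c) \<subseteq> {0}"
    and ww: "PT I N \<rho> (\<lambda>c. EM (ww c))" and tm: "PT I N \<rho> (\<lambda>c. EL (tm c))"
  shows "PT I N \<rho> (\<lambda>c. EM (arc_labels (\<delta> c) (cs c) (z c) (ww c) (tm c)))"
  unfolding arc_labels_def
proof (rule PT_foldr[OF PT_zip[OF ww cs], where b = "\<lambda>c. map (\<lambda>_. z c) (tm c)" and ey = EM and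
      f = "\<lambda>c p acc. map2 (\<lambda>l k. add_mod (\<delta> c) k l (snd p)) acc (fst p)"])
  show "PT I N \<rho> (\<lambda>c. EM (map (\<lambda>_. z c) (tm c)))"
    by (rule PT_map[OF tm], rule PT_outer[OF z]) simp
  let ?Q = "{q. fst q \<in> I \<and> (\<exists>ys. suffix (fst (snd q) # ys) (zip (ww (fst q)) (cs (fst q))) \<and>
      snd (snd q) = foldr (\<lambda>p acc. map2 (\<lambda>l k. add_mod (\<delta> (fst q)) k l (snd p)) acc (fst p)) ys (map (\<lambda>_. z (fst q)) (tm (fst q))))}"
  let ?\<rho> = "\<lambda>q. enc_pair EL EL (fst (snd q)) # EM (snd (snd q)) # \<rho> (fst q)"
  have \<delta>': "PT ?Q (\<lambda>q. N (fst q)) ?\<rho> (\<lambda>q. Num (\<delta> (fst q)))" by (rule PT_outer2[OF \<delta>(1)]) simp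
  have col': "PT ?Q (\<lambda>q. N (fst q)) ?\<rho> (\<lambda>q. EL (snd (fst (snd q))))" by (rule PT_snd[OF PT_var0])
  show "PT ?Q (\<lambda>q. N (fst q)) ?\<rho> (\<lambda>q. EM (map2 (\<lambda>l k. add_mod (\<delta> (fst q)) k l (snd (fst (snd q)))) (snd (snd q)) (fst (fst (snd q)))))"
    by (rule PT_map2[OF PT_var1 PT_fst[OF PT_var0]],
        rule PT_add_mod[OF PT_outer[OF \<delta>'] PT_snd[OF PT_var0] PT_fst[OF PT_var0] PT_outer[OF col']]) simp_all
  fix J assume J: "J \<subseteq> I" and b: "poly_bounded J N (\<lambda>c. val_size (EM (map (\<lambda>_. z c) (tm c))))"
  show "\<exists>T. poly_bounded J N T \<and> (\<forall>c\<in>J. \<forall>ys. suffix ys (zip (ww c) (cs c)) \<longrightarrow>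
      val_size (EM (foldr (\<lambda>p acc. map2 (\<lambda>l k. add_mod (\<delta> c) k l (snd p)) acc (fst p)) ys (map (\<lambda>_. z c) (tm c)))) \<le> T c)"
  proof (intro exI conjI ballI allI impI)
    let ?b = "\<lambda>c. val_size (EM (map (\<lambda>_. z c) (tm c)))"
    show "poly_bounded J N (\<lambda>c. ?b c * (1 + (?b c * (2 + nat \<bar>\<delta> c\<bar>) + 1)) + 1)"
      by (intro poly_bounded_rules b poly_bounded_subset[OF \<delta>(2) J])
    fix c and ys :: "(int list \<times> int list) list" assume c: "c \<in> J"
    let ?f = "\<lambda>ys. foldr (\<lambda>p acc. map2 (\<lambda>l k. add_mod (\<delta> c) k l (snd p)) acc (fst p)) ys (map (\<lambda>_. z c) (tm c))"
    have "length (?f ys) \<le> ?b c \<and> (\<forall>x\<in>set (?f ys). reduced (\<delta> c) (?b c) x)"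
    proof (induction ys)
      case Nil
      have "length (z c) \<le> ?b c" if "tm c \<noteq> []"
        using that length_le_val_size[of "z c" Num] by (cases "tm c") auto
      moreover have "\<forall>a\<in>set (z c). a = 0" using z0[of c] c J by blast
      ultimately show ?case using length_le_val_size[of "map (\<lambda>_. z c) (tm c)" EL]
        by (cases "tm c = []") (auto simp: reduced_def)
    next
      case (Cons p ys)
      have "reduced (\<delta> c) (?b c) (add_mod (\<delta> c) k l (snd p))" if "l \<in> set (?f ys)" for l k
        using Cons that \<delta>(3)[of c] c J by (intro reduced_add_mod) (auto simp: reduced_def)
      then show ?case using Cons by (auto dest: set_zip_leftD)
    qed
    then show "val_size (EM (?f ys)) \<le> ?b c * (1 + (?b c * (2 + nat \<bar>\<delta> c\<bar>) + 1)) + 1"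
      using reduced_size[of "\<delta> c" "?b c"] by (intro val_size_enc_list_le) blast+
  qed
qed

definition round_labels :: "int \<Rightarrow> int list list \<Rightarrow> int list list \<Rightarrow> int list list" where
  "round_labels \<delta> ws ls = remdups (ls @ concat (map (\<lambda>w. map (\<lambda>g. add_mod \<delta> 1 g w) ls) ws))"

lemma PT_round_labels:
  assumes \<delta>: "PT I N \<rho> (\<lambda>c. Num (\<delta> c))" and ws: "PT I N \<rho> (\<lambda>c. EM (ws c))" and ls: "PT I N \<rho> (\<lambda>c. EM (ls c))"
  shows "PT I N \<rho> (\<lambda>c. EM (round_labels (\<delta> c) (ws c) (ls c)))"
  unfolding round_labels_def
proof (rule PT_remdups, rule PT_append[OF ls], rule PT_concat_map[OF ws])
  let ?Q = "{q. fst q \<in> I \<and> snd q \<in> set (ws (fst q))}"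
  have 1: "PT ?Q (\<lambda>q. N (fst q)) (\<lambda>q. EL (snd q) # \<rho> (fst q)) (\<lambda>q. EM (ls (fst q)))"
    and 2: "PT ?Q (\<lambda>q. N (fst q)) (\<lambda>q. EL (snd q) # \<rho> (fst q)) (\<lambda>q. Num (\<delta> (fst q)))"
    by (rule PT_outer[OF ls] PT_outer[OF \<delta>]; simp)+
  show "PT ?Q (\<lambda>q. N (fst q)) (\<lambda>q. EL (snd q) # \<rho> (fst q))
      (\<lambda>q. EM (map (\<lambda>g. add_mod (\<delta> (fst q)) 1 g (snd q)) (ls (fst q))))"
    by (rule PT_map[OF 1], rule PT_add_mod[OF PT_outer[OF 2] PT_Lit PT_var0 PT_var1]) simp
qed

definition closure_labels :: "int \<Rightarrow> int list list \<Rightarrow> int list \<Rightarrow> nat \<Rightarrow> int list list" where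
  "closure_labels \<delta> ws z n = (round_labels \<delta> ws ^^ n) [z]"

lemma PT_closure_labels:
  assumes \<delta>: "PT I N \<rho> (\<lambda>c. Num (\<delta> c))" "poly_bounded I N (\<lambda>c. nat \<bar>\<delta> c\<bar>)"
    and ws: "PT I N \<rho> (\<lambda>c. EM (ws c))" and z: "PT I N \<rho> (\<lambda>c. EL (z c))"
    and T: "poly_bounded I N T" "\<And>c k. c \<in> I \<Longrightarrow> val_size (EM (closure_labels (\<delta> c) (ws c) (z c) k)) \<le> T c"
  shows "PT I N \<rho> (\<lambda>c. EM (closure_labels (\<delta> c) (ws c) (z c) (nat \<bar>\<delta> c\<bar>)))"
proof -
  have eq: "foldr (\<lambda>_. round_labels a b) xs [y] = closure_labels a b y (length xs)" for a b y and xs :: "int list"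
    unfolding closure_labels_def by (induction xs) auto
  have "PT I N \<rho> (\<lambda>c. if \<delta> c < 0 then Num (0 - \<delta> c) else Num (\<delta> c))"
    by (intro PT_if PT_less PT_sub PT_Lit PT_subset[OF \<delta>(1)] \<delta>(1)) auto
  then have "PT I N \<rho> (\<lambda>c. Num (int (nat \<bar>\<delta> c\<bar>)))" by (rule PT_cong) auto
  then have cd: "PT I N \<rho> (\<lambda>c. EL (countdown (nat \<bar>\<delta> c\<bar>)))" by (rule PT_countdown) (rule \<delta>(2))
  have "PT I N \<rho> (\<lambda>c. EM (foldr (\<lambda>_. round_labels (\<delta> c) (ws c)) (countdown (nat \<bar>\<delta> c\<bar>)) [z c]))"
  proof (rule PT_foldr[OF cd, where b = "\<lambda>c. [z c]" and ey = EM and f = "\<lambda>c _. round_labels (\<delta> c) (ws c)"])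
    fix J assume J: "J \<subseteq> I"
    show "\<exists>T. poly_bounded J N T \<and> (\<forall>c\<in>J. \<forall>ys. suffix ys (countdown (nat \<bar>\<delta> c\<bar>)) \<longrightarrow>
        val_size (EM (foldr (\<lambda>_. round_labels (\<delta> c) (ws c)) ys [z c])) \<le> T c)"
      unfolding eq by (rule exI[of _ T], rule conjI, rule poly_bounded_subset[OF T(1) J]) (use T(2) J in blast)
  qed (intro PT_Cons PT_Nil z,
       rule PT_round_labels[OF PT_outer2[OF \<delta>(1)] PT_outer2[OF ws] PT_var1], simp_all)
  then show ?thesis unfolding eq by simp
qed

subsection \<open>Building the formulation\<close>

text \<open>The keys of tail and head of every arc, read off the rows of the incidence matrix; \<open>ks\<close> are the keys of
  the rows.\<close>

definition arc_ends :: "int list \<Rightarrow> int list list \<Rightarrow> int list \<Rightarrow> (int \<times> int) list" where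
  "arc_ends ks D tm = foldr (\<lambda>p acc. map2 (\<lambda>e x. (if x = - 1 then fst p else fst e, if x = 1 then fst p else snd e))
     acc (snd p)) (zip ks D) (map (\<lambda>_. (0, 0)) tm)"

lemma PT_arc_ends:
  assumes ks: "PT I N \<rho> (\<lambda>c. EL (ks c))" and D: "PT I N \<rho> (\<lambda>c. EM (D c))" and tm: "PT I N \<rho> (\<lambda>c. EL (tm c))"
  shows "PT I N \<rho> (\<lambda>c. enc_list (enc_pair Num Num) (arc_ends (ks c) (D c) (tm c)))"
  unfolding arc_ends_def
proof (rule PT_foldr[OF PT_zip[OF ks D], where b = "\<lambda>c. map (\<lambda>_. (0, 0)) (tm c)" and ey = "enc_list (enc_pair Num Num)" and
      f = "\<lambda>c p acc. map2 (\<lambda>e x. (if x = - 1 then fst p else fst e, if x = 1 then fst p else snd e)) acc (snd p)"])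
  show "PT I N \<rho> (\<lambda>c. enc_list (enc_pair Num Num) (map (\<lambda>_. (0, 0)) (tm c)))"
    by (rule PT_map[OF tm]) (intro PT_pair PT_Lit)
  have if_num: "Num (if b then x else y) = (if b then Num x else Num y)" for b x y by simp
  let ?f = "\<lambda>p acc. map2 (\<lambda>e x. (if x = - 1 then fst p else fst e, if x = 1 then fst p else snd e)) acc (snd p)"
  let ?Q = "{q. fst q \<in> I \<and> (\<exists>ys. suffix (fst (snd q) # ys) (zip (ks (fst q)) (D (fst q))) \<and>
      snd (snd q) = foldr ?f ys (map (\<lambda>_. (0 :: int, 0 :: int)) (tm (fst q))))}"
  let ?\<rho> = "\<lambda>q. enc_pair Num EL (fst (snd q)) # enc_list (enc_pair Num Num) (snd (snd q)) # \<rho> (fst q)"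
  have k: "PT ?Q (\<lambda>q. N (fst q)) ?\<rho> (\<lambda>q. Num (fst (fst (snd q))))" by (rule PT_fst[OF PT_var0])
  show "PT ?Q (\<lambda>q. N (fst q)) ?\<rho> (\<lambda>q. enc_list (enc_pair Num Num) (?f (fst (snd q)) (snd (snd q))))"
  proof (rule PT_map2[OF PT_var1 PT_snd[OF PT_var0]])
    let ?R = "{qa. fst qa \<in> ?Q \<and> snd qa \<in> set (zip (snd (snd (fst qa))) (snd (fst (snd (fst qa)))))}"
    let ?\<rho>' = "\<lambda>qa. enc_pair (enc_pair Num Num) Num (snd qa) # ?\<rho> (fst qa)"
    have k': "PT ?R (\<lambda>q. N (fst (fst q))) ?\<rho>' (\<lambda>q. Num (fst (fst (snd (fst q)))))" by (rule PT_outer[OF k]) simp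
    show "PT ?R (\<lambda>q. N (fst (fst q))) ?\<rho>' (\<lambda>q. enc_pair Num Num (if snd (snd q) = - 1 then fst (fst (snd (fst q))) else fst (fst (snd q)),
        if snd (snd q) = 1 then fst (fst (snd (fst q))) else snd (fst (snd q))))"
    proof (rule PT_pair; unfold if_num, rule PT_if)
      show "PT ?R (\<lambda>q. N (fst (fst q))) ?\<rho>' (\<lambda>q. Num (of_bool (snd (snd q) = - 1)))"
        "PT ?R (\<lambda>q. N (fst (fst q))) ?\<rho>' (\<lambda>q. Num (of_bool (snd (snd q) = 1)))"
        by (intro PT_eq PT_snd[OF PT_var0] PT_Lit)+
    qed (rule PT_subset[OF k'] PT_fst[OF PT_fst[OF PT_var0]] PT_snd[OF PT_fst[OF PT_var0]]; auto)+
  qed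
  fix J assume b1: "poly_bounded J N (\<lambda>c. val_size (enc_list (enc_pair Num EL) (zip (ks c) (D c))))"
    and b2: "poly_bounded J N (\<lambda>c. val_size (enc_list (enc_pair Num Num) (map (\<lambda>_. (0, 0)) (tm c))))"
  let ?x = "\<lambda>c. val_size (enc_list (enc_pair Num EL) (zip (ks c) (D c)))"
  let ?b = "\<lambda>c. val_size (enc_list (enc_pair Num Num) (map (\<lambda>_. (0, 0)) (tm c)))"
  show "\<exists>T. poly_bounded J N T \<and> (\<forall>c\<in>J. \<forall>ys. suffix ys (zip (ks c) (D c)) \<longrightarrow>
      val_size (enc_list (enc_pair Num Num) (foldr ?f ys (map (\<lambda>_. (0, 0)) (tm c)))) \<le> T c)"
  proof (intro exI conjI ballI allI impI)
    show "poly_bounded J N (\<lambda>c. ?b c * (1 + (1 + (?x c + 1) + (?x c + 1))) + 1)" by (intro poly_bounded_rules b1 b2)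
    fix c ys assume ys: "suffix ys (zip (ks c) (D c))"
    let ?g = "\<lambda>ys. foldr ?f ys (map (\<lambda>_. (0 :: int, 0 :: int)) (tm c))"
    have "length (?g ys) \<le> ?b c \<and> (\<forall>e\<in>set (?g ys). int_bits (fst e) \<le> ?x c + 1 \<and> int_bits (snd e) \<le> ?x c + 1)"
      using ys
    proof (induction ys)
      case Nil
      then show ?case using length_le_val_size[of "map (\<lambda>_. (0 :: int, 0 :: int)) (tm c)" "enc_pair Num Num"]
        by (auto simp: int_bits_def)
    next
      case (Cons p ys)
      have "val_size (enc_pair Num EL p) \<le> ?x c"
        using val_size_enc_list_mem[of p "zip (ks c) (D c)" "enc_pair Num EL"] set_mono_suffix[OF Cons.prems] by auto
      then have p: "int_bits (fst p) \<le> ?x c + 1" by (simp add: enc_pair_def)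
      have IH: "length (?g ys) \<le> ?b c" "\<And>e. e \<in> set (?g ys) \<Longrightarrow> int_bits (fst e) \<le> ?x c + 1 \<and> int_bits (snd e) \<le> ?x c + 1"
        using Cons.IH[OF suffix_ConsD[OF Cons.prems]] by auto
      show ?case
      proof (intro conjI ballI)
        show "length (?g (p # ys)) \<le> ?b c" using IH(1) by simp
        fix e assume "e \<in> set (?g (p # ys))"
        then obtain e' x where e': "(e', x) \<in> set (zip (?g ys) (snd p))"
          "e = (if x = - 1 then fst p else fst e', if x = 1 then fst p else snd e')" by auto
        note e'(2) IH(2)[OF set_zip_leftD[OF e'(1)]] p
        then show "int_bits (fst e) \<le> ?x c + 1" "int_bits (snd e) \<le> ?x c + 1" by auto
      qed
    qed
    then show "val_size (enc_list (enc_pair Num Num) (?g ys)) \<le> ?b c * (1 + (1 + (?x c + 1) + (?x c + 1))) + 1"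
      by (intro val_size_enc_list_le) (auto simp: enc_pair_def intro!: add_mono)
  qed
qed

text \<open>An arc is given by its key, the keys of its tail and head, and its label. The variable of the edge
  \<open>(i, g, a)\<close> is given by the key of \<open>a\<close>, its own key, and the nodes to which and from which the edge leads.\<close>

type_synonym arc = "int \<times> (int \<times> int) \<times> int list"
type_synonym zvar = "int list \<times> int list \<times> int list \<times> int list"
type_synonym row = "int \<times> int \<times> int \<times> int \<times> int list"

abbreviation enc_arc :: "arc \<Rightarrow> val" where
  "enc_arc \<equiv> enc_pair Num (enc_pair (enc_pair Num Num) EL)"
abbreviation enc_zvar :: "zvar \<Rightarrow> val" where
  "enc_zvar \<equiv> enc_pair EL (enc_pair EL (enc_pair EL EL))"
abbreviation enc_row :: "row \<Rightarrow> val" where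
  "enc_row \<equiv> enc_pair Num (enc_pair Num (enc_pair Num (enc_pair Num EL)))"

definition node_key :: "int \<Rightarrow> int \<Rightarrow> int list \<Rightarrow> int list" where
  "node_key i u g = (if u = i then 0 # 0 # g else i # u # g)"

definition zvar :: "int \<Rightarrow> int \<Rightarrow> int list \<Rightarrow> arc \<Rightarrow> zvar" where
  "zvar \<delta> i g a = ([fst a], i # fst a # g,
     node_key i (snd (fst (snd a))) (add_mod \<delta> 1 g (snd (snd a))), node_key i (fst (fst (snd a))) g)"

definition zvars :: "int \<Rightarrow> int list \<Rightarrow> int list list \<Rightarrow> arc list \<Rightarrow> zvar list" where
  "zvars \<delta> ks ls as = concat (map (\<lambda>i. concat (map (\<lambda>g. map (zvar \<delta> i g) as) ls)) ks)"

definition node_keys :: "int list \<Rightarrow> int list \<Rightarrow> int list list \<Rightarrow> int list list" where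
  "node_keys ks us ls = concat (map (\<lambda>i. concat (map (\<lambda>u. map (\<lambda>g. i # u # g) ls) us)) ks)"

text \<open>A row \<open>(\<alpha>, \<beta>, \<gamma>, \<rho>, key)\<close> is one inequality with right-hand side \<open>\<rho>\<close>. The key selects an arc if \<open>\<alpha>\<close> is
  nonzero (the equation between \<open>x\<close> and the flow, in two inequalities), a variable if \<open>\<beta>\<close> is nonzero
  (nonnegativity), and a node if \<open>\<gamma>\<close> is nonzero (conservation).\<close>

definition rows :: "arc list \<Rightarrow> zvar list \<Rightarrow> int list list \<Rightarrow> int list \<Rightarrow> int list \<Rightarrow> row list" where
  "rows as zs ns lf z = map (\<lambda>a. (1, 0, 0, 0, [fst a])) as @ map (\<lambda>a. (- 1, 0, 0, 0, [fst a])) as @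
     map (\<lambda>v. (0, - 1, 0, 0, fst (snd v))) zs @
     map (\<lambda>n. (0, 0, 1, of_bool (n = 0 # 0 # lf) - of_bool (n = 0 # 0 # z), n)) ns"

definition rhs :: "row \<Rightarrow> int" where
  "rhs r = fst (snd (snd (snd r)))"

definition row_key :: "row \<Rightarrow> int list" where
  "row_key r = snd (snd (snd (snd r)))"

definition coef_x :: "row \<Rightarrow> arc \<Rightarrow> int" where
  "coef_x r a = (0 - fst r) * of_bool ([fst a] = row_key r)"

definition coef_z :: "row \<Rightarrow> zvar \<Rightarrow> int" where
  "coef_z r v = fst r * of_bool (fst v = row_key r) + fst (snd r) * of_bool (fst (snd v) = row_key r) +
     fst (snd (snd r)) * (of_bool (fst (snd (snd v)) = row_key r) - of_bool (snd (snd (snd v)) = row_key r))"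

definition enc_output :: "arc list \<Rightarrow> zvar list \<Rightarrow> row list \<Rightarrow> val" where
  "enc_output as zs rs = enc_list id
     [EM (map (\<lambda>r. map (coef_x r) as) rs), EM (map (\<lambda>r. map (coef_z r) zs) rs), EL (map rhs rs)]"

lemma PT_node_key:
  assumes "PT I N \<rho> (\<lambda>c. Num (i c))" "PT I N \<rho> (\<lambda>c. Num (u c))" "PT I N \<rho> (\<lambda>c. EL (g c))"
  shows "PT I N \<rho> (\<lambda>c. EL (node_key (i c) (u c) (g c)))"
proof -
  have if_enc: "EL (if b then x else y) = (if b then EL x else EL y)" for b x y by simp
  show ?thesis unfolding node_key_def if_enc
    by (rule PT_if[OF PT_eq[OF assms(2,1)]]) (intro PT_Cons PT_Lit PT_subset[OF assms(1)] PT_subset[OF assms(2)]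
      PT_subset[OF assms(3)]; simp)+
qed

lemma PT_zvar:
  assumes \<delta>: "PT I N \<rho> (\<lambda>c. Num (\<delta> c))" and i: "PT I N \<rho> (\<lambda>c. Num (i c))"
    and g: "PT I N \<rho> (\<lambda>c. EL (g c))" and a: "PT I N \<rho> (\<lambda>c. enc_arc (a c))"
  shows "PT I N \<rho> (\<lambda>c. enc_zvar (zvar (\<delta> c) (i c) (g c) (a c)))"
  unfolding zvar_def
  by (intro PT_pair PT_Cons PT_Nil PT_node_key PT_add_mod PT_Lit \<delta> i g PT_fst[OF a]
      PT_snd[OF PT_fst[OF PT_snd[OF a]]] PT_fst[OF PT_fst[OF PT_snd[OF a]]] PT_snd[OF PT_snd[OF a]])

lemma PT_zvars:
  assumes \<delta>: "PT I N \<rho> (\<lambda>c. Num (\<delta> c))" and ks: "PT I N \<rho> (\<lambda>c. EL (ks c))"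
    and ls: "PT I N \<rho> (\<lambda>c. EM (ls c))" and as: "PT I N \<rho> (\<lambda>c. enc_list enc_arc (as c))"
  shows "PT I N \<rho> (\<lambda>c. enc_list enc_zvar (zvars (\<delta> c) (ks c) (ls c) (as c)))"
  unfolding zvars_def
proof (rule PT_concat_map[OF ks])
  let ?I1 = "{q. fst q \<in> I \<and> snd q \<in> set (ks (fst q))}" and ?\<rho>1 = "\<lambda>q. Num (snd q) # \<rho> (fst q)"
  have 1: "PT ?I1 (\<lambda>q. N (fst q)) ?\<rho>1 (\<lambda>q. Num (\<delta> (fst q)))"
    "PT ?I1 (\<lambda>q. N (fst q)) ?\<rho>1 (\<lambda>q. EM (ls (fst q)))"
    "PT ?I1 (\<lambda>q. N (fst q)) ?\<rho>1 (\<lambda>q. enc_list enc_arc (as (fst q)))"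
    by (rule PT_outer[OF \<delta>] PT_outer[OF ls] PT_outer[OF as]; simp)+
  show "PT ?I1 (\<lambda>q. N (fst q)) ?\<rho>1 (\<lambda>q. enc_list enc_zvar (concat (map (\<lambda>g. map (zvar (\<delta> (fst q)) (snd q) g) (as (fst q))) (ls (fst q)))))"
  proof (rule PT_concat_map[OF 1(2)])
    let ?I2 = "{q. fst q \<in> ?I1 \<and> snd q \<in> set (ls (fst (fst q)))}" and ?\<rho>2 = "\<lambda>q. EL (snd q) # ?\<rho>1 (fst q)"
    have 2: "PT ?I2 (\<lambda>q. N (fst (fst q))) ?\<rho>2 (\<lambda>q. Num (\<delta> (fst (fst q))))"
      "PT ?I2 (\<lambda>q. N (fst (fst q))) ?\<rho>2 (\<lambda>q. enc_list enc_arc (as (fst (fst q))))"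
      by (rule PT_outer[OF 1(1)] PT_outer[OF 1(3)]; simp)+
    show "PT ?I2 (\<lambda>q. N (fst (fst q))) ?\<rho>2 (\<lambda>q. enc_list enc_zvar (map (zvar (\<delta> (fst (fst q))) (snd (fst q)) (snd q)) (as (fst (fst q)))))"
      by (rule PT_map[OF 2(2)], rule PT_zvar[OF PT_outer[OF 2(1)] PT_var2 PT_var1 PT_var0]) simp
  qed
qed

lemma PT_node_keys:
  assumes ks: "PT I N \<rho> (\<lambda>c. EL (ks c))" and us: "PT I N \<rho> (\<lambda>c. EL (us c))"
    and ls: "PT I N \<rho> (\<lambda>c. EM (ls c))"
  shows "PT I N \<rho> (\<lambda>c. EM (node_keys (ks c) (us c) (ls c)))"
  unfolding node_keys_def
proof (rule PT_concat_map[OF ks])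
  let ?I1 = "{q. fst q \<in> I \<and> snd q \<in> set (ks (fst q))}" and ?\<rho>1 = "\<lambda>q. Num (snd q) # \<rho> (fst q)"
  have 1: "PT ?I1 (\<lambda>q. N (fst q)) ?\<rho>1 (\<lambda>q. EL (us (fst q)))"
    "PT ?I1 (\<lambda>q. N (fst q)) ?\<rho>1 (\<lambda>q. EM (ls (fst q)))"
    by (rule PT_outer[OF us] PT_outer[OF ls]; simp)+
  show "PT ?I1 (\<lambda>q. N (fst q)) ?\<rho>1 (\<lambda>q. EM (concat (map (\<lambda>u. map (\<lambda>g. snd q # u # g) (ls (fst q))) (us (fst q)))))"
  proof (rule PT_concat_map[OF 1(1)])
    let ?I2 = "{q. fst q \<in> ?I1 \<and> snd q \<in> set (us (fst (fst q)))}" and ?\<rho>2 = "\<lambda>q. Num (snd q) # ?\<rho>1 (fst q)"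
    have 2: "PT ?I2 (\<lambda>q. N (fst (fst q))) ?\<rho>2 (\<lambda>q. EM (ls (fst (fst q))))"
      by (rule PT_outer[OF 1(2)]) simp
    show "PT ?I2 (\<lambda>q. N (fst (fst q))) ?\<rho>2 (\<lambda>q. EM (map (\<lambda>g. snd (fst q) # snd q # g) (ls (fst (fst q)))))"
      by (rule PT_map[OF 2], intro PT_Cons PT_var0 PT_var1 PT_var2)
  qed
qed

lemma PT_rows:
  assumes as: "PT I N \<rho> (\<lambda>c. enc_list enc_arc (as c))" and zs: "PT I N \<rho> (\<lambda>c. enc_list enc_zvar (zs c))"
    and ns: "PT I N \<rho> (\<lambda>c. EM (ns c))" and lf: "PT I N \<rho> (\<lambda>c. EL (lf c))" and z: "PT I N \<rho> (\<lambda>c. EL (z c))"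
  shows "PT I N \<rho> (\<lambda>c. enc_list enc_row (rows (as c) (zs c) (ns c) (lf c) (z c)))"
  unfolding rows_def
proof (intro PT_append)
  show "PT I N \<rho> (\<lambda>c. enc_list enc_row (map (\<lambda>a. (1, 0, 0, 0, [fst a])) (as c)))"
    "PT I N \<rho> (\<lambda>c. enc_list enc_row (map (\<lambda>a. (- 1, 0, 0, 0, [fst a])) (as c)))"
    by (rule PT_map[OF as], intro PT_pair PT_Cons PT_Nil PT_Lit PT_fst[OF PT_var0])+
  show "PT I N \<rho> (\<lambda>c. enc_list enc_row (map (\<lambda>v. (0, - 1, 0, 0, fst (snd v))) (zs c)))"
    by (rule PT_map[OF zs], intro PT_pair PT_Lit, rule PT_fst[OF PT_snd[OF PT_var0]])
  let ?I1 = "{q. fst q \<in> I \<and> snd q \<in> set (ns (fst q))}" and ?\<rho>1 = "\<lambda>q. EL (snd q) # \<rho> (fst q)"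
  have 1: "PT ?I1 (\<lambda>q. N (fst q)) ?\<rho>1 (\<lambda>q. EL (lf (fst q)))"
    "PT ?I1 (\<lambda>q. N (fst q)) ?\<rho>1 (\<lambda>q. EL (z (fst q)))"
    by (rule PT_outer[OF lf] PT_outer[OF z]; simp)+
  show "PT I N \<rho> (\<lambda>c. enc_list enc_row (map (\<lambda>n. (0, 0, 1, of_bool (n = 0 # 0 # lf c) - of_bool (n = 0 # 0 # z c), n)) (ns c)))"
    by (rule PT_map[OF ns], intro PT_pair PT_Lit PT_sub PT_eq_list PT_Cons PT_var0 1)
qed

lemma PT_row_key: "PT I N \<rho> (\<lambda>c. enc_row (r c)) \<Longrightarrow> PT I N \<rho> (\<lambda>c. EL (row_key (r c)))"
  unfolding row_key_def by (intro PT_snd)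

lemma PT_enc_output:
  assumes as: "PT I N \<rho> (\<lambda>c. enc_list enc_arc (as c))" and zs: "PT I N \<rho> (\<lambda>c. enc_list enc_zvar (zs c))"
    and rs: "PT I N \<rho> (\<lambda>c. enc_list enc_row (rs c))"
  shows "PT I N \<rho> (\<lambda>c. enc_output (as c) (zs c) (rs c))"
proof -
  let ?I1 = "{q. fst q \<in> I \<and> snd q \<in> set (rs (fst q))}" and ?\<rho>1 = "\<lambda>q. enc_row (snd q) # \<rho> (fst q)"
  have 1: "PT ?I1 (\<lambda>q. N (fst q)) ?\<rho>1 (\<lambda>q. enc_list enc_arc (as (fst q)))"
    "PT ?I1 (\<lambda>q. N (fst q)) ?\<rho>1 (\<lambda>q. enc_list enc_zvar (zs (fst q)))"
    by (rule PT_outer[OF as] PT_outer[OF zs]; simp)+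
  have x: "PT I N \<rho> (\<lambda>c. EM (map (\<lambda>r. map (coef_x r) (as c)) (rs c)))"
    by (rule PT_map[OF rs], rule PT_map[OF 1(1)], unfold coef_x_def,
        intro PT_mul PT_sub PT_Lit PT_eq_list PT_Cons PT_Nil PT_row_key PT_var1,
        rule PT_fst[OF PT_var1], rule PT_fst[OF PT_var0])
  have z: "PT I N \<rho> (\<lambda>c. EM (map (\<lambda>r. map (coef_z r) (zs c)) (rs c)))"
    by (rule PT_map[OF rs], rule PT_map[OF 1(2)], unfold coef_z_def,
        intro PT_mul PT_sub PT_add PT_eq_list PT_row_key PT_var1,
        (rule PT_fst[OF PT_var1] PT_fst[OF PT_snd[OF PT_var1]] PT_fst[OF PT_snd[OF PT_snd[OF PT_var1]]]
          PT_fst[OF PT_var0] PT_fst[OF PT_snd[OF PT_var0]] PT_fst[OF PT_snd[OF PT_snd[OF PT_var0]]]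
          PT_snd[OF PT_snd[OF PT_snd[OF PT_var0]]])+)
  have e: "PT I N \<rho> (\<lambda>c. EL (map rhs (rs c)))"
    by (rule PT_map[OF rs], unfold rhs_def, rule PT_fst[OF PT_snd[OF PT_snd[OF PT_snd[OF PT_var0]]]])
  show ?thesis unfolding enc_output_def using PT_Cell[OF x PT_Cell[OF z PT_Cell[OF e PT_Lit]]] by simp
qed


subsection \<open>The algorithm\<close>

definition template :: "int list list \<Rightarrow> int list" where
  "template D = (if D = [] then [] else hd D)"

definition zero_label :: "int list \<Rightarrow> int list" where
  "zero_label f = map (\<lambda>_. 0) f"

definition inverse_data :: "int list list \<Rightarrow> int list \<Rightarrow> elim_state" where
  "inverse_data H f = eliminate H (countdown (length f))"

definition modulus :: "int list list \<Rightarrow> int list \<Rightarrow> int" where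
  "modulus H f = fst (inverse_data H f)"

definition columns :: "int list list \<Rightarrow> int list \<Rightarrow> int list list" where
  "columns H f = fst (snd (inverse_data H f))"

definition target_label :: "int list list \<Rightarrow> int list \<Rightarrow> int list" where
  "target_label H f = label (modulus H f) (columns H f) (zero_label f) f"

definition arc_weights :: "int list list \<Rightarrow> int list list \<Rightarrow> int list list \<Rightarrow> int list \<Rightarrow> int list list" where
  "arc_weights D H W f = arc_labels (modulus H f) (columns H f) (zero_label f) W (template D)"

definition arc_data :: "int list list \<Rightarrow> int list list \<Rightarrow> int list list \<Rightarrow> int list \<Rightarrow> arc list" where
  "arc_data D H W f = (let es = arc_ends (countdown (length D)) D (template D) in
     zip (countdown (length es)) (zip es (arc_weights D H W f)))"

definition label_list :: "int list list \<Rightarrow> int list list \<Rightarrow> int list list \<Rightarrow> int list \<Rightarrow> int list list" where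
  "label_list D H W f = closure_labels (modulus H f) (arc_weights D H W f) (zero_label f) (nat \<bar>modulus H f\<bar>)"

text \<open>Only nodes that are the end of an arc count, so that isolated nodes do not enlarge the formulation. The
  detour through singleton lists makes the duplicate removal for labels applicable.\<close>

definition vertex_keys :: "arc list \<Rightarrow> int list" where
  "vertex_keys as = 0 # map sum_list (remdups (map (\<lambda>a. [fst (fst (snd a))]) as @ map (\<lambda>a. [snd (fst (snd a))]) as))"

definition copies :: "int \<Rightarrow> int list \<Rightarrow> int list" where
  "copies \<delta> us = (if \<delta> * \<delta> = 1 then [0] else us)"

definition var_data :: "int list list \<Rightarrow> int list list \<Rightarrow> int list list \<Rightarrow> int list \<Rightarrow> zvar list" where
  "var_data D H W f = (let as = arc_data D H W f in
     zvars (modulus H f) (copies (modulus H f) (vertex_keys as)) (label_list D H W f) as)"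

definition row_data :: "int list list \<Rightarrow> int list list \<Rightarrow> int list list \<Rightarrow> int list \<Rightarrow> row list" where
  "row_data D H W f = (let as = arc_data D H W f; us = vertex_keys as in
     rows as (var_data D H W f) (node_keys (copies (modulus H f) us) us (label_list D H W f))
       (target_label H f) (zero_label f))"

definition formulation :: "int list list \<Rightarrow> int list list \<Rightarrow> int list list \<Rightarrow> int list \<Rightarrow> val" where
  "formulation D H W f = enc_output (arc_data D H W f) (var_data D H W f) (row_data D H W f)"

lemma PT_formulation:
  assumes D: "PT I N \<rho> (\<lambda>c. EM (D c))" and H: "PT I N \<rho> (\<lambda>c. EM (H c))"
    and W: "PT I N \<rho> (\<lambda>c. EM (W c))" and f: "PT I N \<rho> (\<lambda>c. EL (f c))"
    and ns: "\<And>c. c \<in> I \<Longrightarrow> nonsingular (H c) \<and> length (f c) = length (H c)"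
    and \<delta>: "poly_bounded I N (\<lambda>c. nat \<bar>modulus (H c) (f c)\<bar>)" "\<And>c. c \<in> I \<Longrightarrow> modulus (H c) (f c) \<noteq> 0"
    and dims: "poly_bounded I N (\<lambda>c. length (D c))" "poly_bounded I N (\<lambda>c. length (f c))"
      "poly_bounded I N (\<lambda>c. length (arc_ends (countdown (length (D c))) (D c) (template (D c))))"
    and T: "poly_bounded I N T" "\<And>c k. c \<in> I \<Longrightarrow>
      val_size (EM (closure_labels (modulus (H c) (f c)) (arc_weights (D c) (H c) (W c) (f c)) (zero_label (f c)) k)) \<le> T c"
  shows "PT I N \<rho> (\<lambda>c. formulation (D c) (H c) (W c) (f c))"
proof -
  have if_enc: "EL (if b then x else y) = (if b then EL x else EL y)" for b x y by simp
  have tm: "PT I N \<rho> (\<lambda>c. EL (template (D c)))"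
  proof -
    have "PT I N \<rho> (\<lambda>c. Num (of_bool (D c = [])))" using PT_not[OF PT_nonempty[OF D]] by simp
    then show ?thesis unfolding template_def if_enc
    proof (rule PT_if)
      show "PT {c \<in> I. D c \<noteq> []} N \<rho> (\<lambda>c. EL (hd (D c)))"
        by (rule PT_hd[OF PT_subset[OF D]]) auto
    qed (rule PT_Nil)
  qed
  have z: "PT I N \<rho> (\<lambda>c. EL (zero_label (f c)))"
    unfolding zero_label_def by (rule PT_map[OF f]) (rule PT_Lit)
  have st: "PT I N \<rho> (\<lambda>c. enc_state (inverse_data (H c) (f c)))"
    unfolding inverse_data_def
    by (rule PT_eliminate[OF H PT_countdown[OF PT_length[OF f] dims(2)]]) (simp add: ns distinct_countdown)
  have m: "PT I N \<rho> (\<lambda>c. Num (modulus (H c) (f c)))" unfolding modulus_def by (rule PT_fst[OF st])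
  have cs: "PT I N \<rho> (\<lambda>c. EM (columns (H c) (f c)))" unfolding columns_def by (rule PT_fst[OF PT_snd[OF st]])
  have z0: "set (zero_label (f c)) \<subseteq> {0}" for c by (auto simp: zero_label_def)
  have lf: "PT I N \<rho> (\<lambda>c. EL (target_label (H c) (f c)))"
    unfolding target_label_def by (rule PT_label[OF m \<delta> cs z z0 f])
  have ws: "PT I N \<rho> (\<lambda>c. EM (arc_weights (D c) (H c) (W c) (f c)))"
    unfolding arc_weights_def by (rule PT_arc_labels[OF m \<delta> cs z z0 W tm])
  have es: "PT I N \<rho> (\<lambda>c. enc_list (enc_pair Num Num) (arc_ends (countdown (length (D c))) (D c) (template (D c))))"
    by (rule PT_arc_ends[OF PT_countdown[OF PT_length[OF D] dims(1)] D tm])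
  have as: "PT I N \<rho> (\<lambda>c. enc_list enc_arc (arc_data (D c) (H c) (W c) (f c)))"
    unfolding arc_data_def Let_def
    by (rule PT_zip[OF PT_countdown[OF PT_length[OF es] dims(3)] PT_zip[OF es ws]])
  have ls: "PT I N \<rho> (\<lambda>c. EM (label_list (D c) (H c) (W c) (f c)))"
    unfolding label_list_def by (rule PT_closure_labels[OF m \<delta>(1) ws z T])
  have us: "PT I N \<rho> (\<lambda>c. EL (vertex_keys (arc_data (D c) (H c) (W c) (f c))))"
    unfolding vertex_keys_def
  proof (rule PT_Cons, rule PT_Lit, rule PT_map[OF PT_remdups[OF PT_append]])
    show "PT I N \<rho> (\<lambda>c. EM (map (\<lambda>a. [fst (fst (snd a))]) (arc_data (D c) (H c) (W c) (f c))))"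
      by (rule PT_map[OF as], intro PT_Cons PT_Nil, rule PT_fst[OF PT_fst[OF PT_snd[OF PT_var0]]])
    show "PT I N \<rho> (\<lambda>c. EM (map (\<lambda>a. [snd (fst (snd a))]) (arc_data (D c) (H c) (W c) (f c))))"
      by (rule PT_map[OF as], intro PT_Cons PT_Nil, rule PT_snd[OF PT_fst[OF PT_snd[OF PT_var0]]])
  qed (rule PT_sum_list[OF PT_var0])
  have ks: "PT I N \<rho> (\<lambda>c. EL (copies (modulus (H c) (f c)) (vertex_keys (arc_data (D c) (H c) (W c) (f c)))))"
    unfolding copies_def if_enc
    by (rule PT_if[OF PT_eq[OF PT_mul[OF m m] PT_Lit]]) (intro PT_Cons PT_Lit PT_Nil, rule PT_subset[OF us], simp)
  have zs: "PT I N \<rho> (\<lambda>c. enc_list enc_zvar (var_data (D c) (H c) (W c) (f c)))"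
    unfolding var_data_def Let_def by (rule PT_zvars[OF m ks ls as])
  have rs: "PT I N \<rho> (\<lambda>c. enc_list enc_row (row_data (D c) (H c) (W c) (f c)))"
    unfolding row_data_def Let_def by (rule PT_rows[OF as zs PT_node_keys[OF ks us ls] lf z])
  show ?thesis unfolding formulation_def by (rule PT_enc_output[OF as zs rs])
qed


section \<open>Correctness\<close>

lemma det_nonzero_of_invertible:
  fixes H :: "int mat"
  assumes H: "H \<in> carrier_mat d d" and inv: "invertible_mat (map_mat real_of_int H)"
  shows "det H \<noteq> 0"
proof -
  let ?A = "map_mat real_of_int H"
  obtain B where B: "?A * B = 1\<^sub>m d" "B * ?A = 1\<^sub>m (dim_row B)"
    using inv H by (auto simp: invertible_mat_def inverts_mat_def)
  have "dim_col B = d" using arg_cong[OF B(1), of dim_col] by simp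
  moreover have "dim_row B = d" using arg_cong[OF B(2), of dim_col] H by simp
  ultimately have Bc: "B \<in> carrier_mat d d" by auto
  have "det ?A * det B = 1" using det_mult[of ?A d B] B(1) Bc H by simp
  then have "det ?A \<noteq> 0" by auto
  then show ?thesis using of_int_hom.hom_det[of H, where 'a = real] by auto
qed

lemma foldr_add_mod:
  assumes "\<And>p. p \<in> set ps \<Longrightarrow> length (snd p) = d" "length z = d" "\<And>j. j < d \<Longrightarrow> z ! j = 0"
  shows "foldr (\<lambda>p acc. add_mod \<delta> (fst p) acc (snd p)) ps z =
    map (\<lambda>j. (\<Sum>p\<leftarrow>ps. fst p * snd p ! j) mod \<delta>) [0..<d]"
  using assms(1)
proof (induction ps)
  case Nil
  show ?case using assms(2,3) by (intro nth_equalityI) auto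
next
  case (Cons p ps)
  then have IH: "foldr (\<lambda>p acc. add_mod \<delta> (fst p) acc (snd p)) ps z =
      map (\<lambda>j. (\<Sum>p\<leftarrow>ps. fst p * snd p ! j) mod \<delta>) [0..<d]" and l: "length (snd p) = d" by auto
  have "foldr (\<lambda>p acc. add_mod \<delta> (fst p) acc (snd p)) (p # ps) z =
      add_mod \<delta> (fst p) (map (\<lambda>j. (\<Sum>p\<leftarrow>ps. fst p * snd p ! j) mod \<delta>) [0..<d]) (snd p)"
    by (simp add: IH)
  then show ?case using l
    by (auto simp: add_mod_def mod_simps add.commute intro!: nth_equalityI)
qed

text \<open>A loop that updates a list pointwise is a list of loops.\<close>

lemma foldr_map2_map:
  "foldr (\<lambda>i acc. map2 (\<lambda>l k. h i k l) acc (map (g i) as)) is (map b as) =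
    map (\<lambda>a. foldr (\<lambda>i. h i (g i a)) is (b a)) as"
  by (induction "is") (auto simp: zip_map_map zip_same_conv_map)

text \<open>An instance as in the theorem, with the lists that encode it.\<close>

locale encoded_instance =
  fixes G :: "('v, 'a) pre_digraph" and vl :: "'v list" and al :: "'a list" and d :: nat
    and H :: "int mat" and W :: "nat \<Rightarrow> 'a \<Rightarrow> int" and f :: "int vec" and \<Delta> :: nat
  assumes fin_G: "fin_digraph G" and loopfree: "loopfree_digraph G"
    and vl: "distinct vl" "set vl = verts G" and al: "distinct al" "set al = arcs G"
    and H: "H \<in> carrier_mat d d" and invertible: "invertible_mat (map_mat real_of_int H)"
    and \<Delta>: "int \<Delta> = \<bar>det H\<bar>" and f: "f \<in> carrier_vec d"
begin

definition Dl :: "int list list" where "Dl = map (\<lambda>v. map (incidence G v) al) vl"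
definition Hl :: "int list list" where "Hl = map (\<lambda>i. map (\<lambda>j. H $$ (i, j)) [0..<d]) [0..<d]"
definition Wl :: "int list list" where "Wl = map (\<lambda>i. map (W i) al) [0..<d]"
definition fl :: "int list" where "fl = map (\<lambda>i. f $ i) [0..<d]"

lemma enc_list_map: "enc_list g (map h xs) = enc_list (\<lambda>x. g (h x)) xs"
  by (induction xs) auto

lemma enc_instance_eq: "enc_instance vl al G d H W f = enc_list id [EM Dl, EM Hl, EM Wl, EL fl]"
  by (simp add: enc_instance_def enc_matrix_def enc_vector_def Dl_def Hl_def Wl_def fl_def enc_list_map)

lemma det_H: "det H \<noteq> 0"
  by (rule det_nonzero_of_invertible[OF H invertible])

lemma \<Delta>_pos: "0 < \<Delta>"
  using \<Delta> det_H by linarith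

lemma rowmat_Hl: "rowmat d Hl = H"
  using H by (intro eq_matI) (auto simp: rowmat_def Hl_def)

lemma nonsingular_Hl: "nonsingular Hl" and length_fl [simp]: "length fl = d" and length_Hl: "length Hl = d"
  using det_H rowmat_Hl by (auto simp: nonsingular_def Hl_def fl_def)

subsection \<open>Labels of classes\<close>

definition \<delta> :: int where "\<delta> = modulus Hl fl"
definition cs :: "int list list" where "cs = columns Hl fl"

lemma inverse:
  "length cs = d" "\<And>c. c \<in> set cs \<Longrightarrow> length c = d" "H * colmat d cs = \<delta> \<cdot>\<^sub>m 1\<^sub>m d"
  "\<bar>\<delta>\<bar> = int \<Delta>" "\<delta> \<noteq> 0"
proof -
  obtain us where inv: "elim_inv d (countdown d) Hl (inverse_data Hl fl) us"
    using elim_inv_suffix[of "countdown d" d "[]" Hl] nonsingular_Hl length_Hl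
    by (auto simp: inverse_data_def eliminate_def nonsingular_def distinct_countdown)
  note i = inv[unfolded elim_inv_def]
  have us: "us = []" using i length_Hl by auto
  have td: "snd (snd (inverse_data Hl fl)) = []" using i us by auto
  show l: "length cs = d" using i length_Hl by (simp add: cs_def columns_def)
  show lc: "\<And>c. c \<in> set cs \<Longrightarrow> length c = d" using i td by (simp add: cs_def columns_def)
  have "rowmat d Hl * colmat d cs = \<delta> \<cdot>\<^sub>m 1\<^sub>m d"
    by (rule biorthogonal_mat)
       (use i us td length_Hl l lc in \<open>simp_all add: cs_def columns_def \<delta>_def modulus_def\<close>)
  then show "H * colmat d cs = \<delta> \<cdot>\<^sub>m 1\<^sub>m d" by (simp add: rowmat_Hl)
  show "\<bar>\<delta>\<bar> = int \<Delta>" "\<delta> \<noteq> 0" using i us \<Delta> by (simp_all add: rowmat_Hl \<delta>_def modulus_def)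
qed

definition lab :: "(nat \<Rightarrow> int) \<Rightarrow> int list" where
  "lab u = map (\<lambda>j. (\<Sum>i<d. u i * cs ! i ! j) mod \<delta>) [0..<d]"

lemma length_lab [simp]: "length (lab u) = d"
  by (simp add: lab_def)

lemma label_eq: "label \<delta> cs (zero_label fl) (map u [0..<d]) = lab u"
proof -
  have "label \<delta> cs (zero_label fl) (map u [0..<d]) =
      map (\<lambda>j. (\<Sum>p\<leftarrow>zip (map u [0..<d]) cs. fst p * snd p ! j) mod \<delta>) [0..<d]"
    unfolding label_def
    by (rule foldr_add_mod) (auto simp: zero_label_def dest!: set_zip_rightD inverse(2))
  also have "\<dots> = lab u"
    by (simp add: lab_def sum_list_sum_nth inverse(1) lessThan_atLeast0)
  finally show ?thesis .
qed

lemma target_label_eq: "target_label Hl fl = lab (\<lambda>i. f $ i)"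
  using label_eq[of "\<lambda>i. f $ i"] by (simp add: target_label_def \<delta>_def cs_def fl_def)

lemma zero_label_eq: "zero_label fl = lab (\<lambda>_. 0)"
  by (simp add: zero_label_def lab_def map_replicate_const)

lemma template_Dl: "length (template Dl) = length al" "template Dl = [] \<longleftrightarrow> al = []"
proof -
  have "vl = [] \<Longrightarrow> al = []"
    using vl(2) al(2) fin_G fin_digraph.axioms(1)[OF fin_G] wf_digraph.tail_in_verts[of G]
    by (cases al) auto
  moreover have "Dl = [] \<longleftrightarrow> vl = []" by (simp add: Dl_def)
  moreover have "vl \<noteq> [] \<Longrightarrow> hd Dl = map (incidence G (hd vl)) al" by (simp add: Dl_def hd_map)
  ultimately show "length (template Dl) = length al"
    unfolding template_def by (metis length_map list.size(3))
  then show "template Dl = [] \<longleftrightarrow> al = []" by auto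
qed

lemma arc_weights_eq: "arc_weights Dl Hl Wl fl = map (\<lambda>a. lab (\<lambda>i. W i a)) al"
proof -
  let ?z = "zero_label fl"
  have "map (\<lambda>_. ?z) (template Dl) = map (\<lambda>_. ?z) al"
    using template_Dl(1) by (simp add: map_replicate_const)
  moreover have "zip Wl cs = map (\<lambda>i. (map (W i) al, cs ! i)) [0..<d]"
    using inverse(1) by (intro nth_equalityI) (auto simp: Wl_def)
  ultimately have "arc_weights Dl Hl Wl fl =
      foldr (\<lambda>i acc. map2 (\<lambda>l k. add_mod \<delta> k l (cs ! i)) acc (map (W i) al)) [0..<d] (map (\<lambda>_. ?z) al)"
    by (simp add: arc_weights_def arc_labels_def \<delta>_def[symmetric] cs_def[symmetric] foldr_map comp_def)
  also have "\<dots> = map (\<lambda>a. foldr (\<lambda>i l. add_mod \<delta> (W i a) l (cs ! i)) [0..<d] ?z) al"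
    by (rule foldr_map2_map)
  also have "\<dots> = map (\<lambda>a. lab (\<lambda>i. W i a)) al"
  proof (rule map_cong[OF refl])
    fix a
    have "zip (map (\<lambda>i. W i a) [0..<d]) cs = map (\<lambda>i. (W i a, cs ! i)) [0..<d]"
      using inverse(1) by (intro nth_equalityI) auto
    then show "foldr (\<lambda>i l. add_mod \<delta> (W i a) l (cs ! i)) [0..<d] ?z = lab (\<lambda>i. W i a)"
      using label_eq[of "\<lambda>i. W i a"] by (simp add: label_def foldr_map comp_def)
  qed
  finally show ?thesis .
qed

lemma add_mod_lab: "add_mod \<delta> 1 (lab u) (lab v) = lab (\<lambda>i. u i + v i)"
  by (rule nth_equalityI) (auto simp: add_mod_def lab_def mod_simps sum.distrib distrib_right)

lemma lab_period: "lab (\<lambda>i. u i + int \<Delta> * w i) = lab u"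
proof -
  obtain s where s: "int \<Delta> = \<delta> * s" using inverse(4) by (metis dvd_abs_iff dvd_def dvd_refl)
  have "(\<Sum>i<d. (u i + int \<Delta> * w i) * cs ! i ! j) = (\<Sum>i<d. u i * cs ! i ! j) + \<delta> * (s * (\<Sum>i<d. w i * cs ! i ! j))" for j
    by (simp add: s distrib_right sum.distrib sum_distrib_left mult.assoc mult.left_commute)
  then show ?thesis by (simp add: lab_def)
qed

lemma lab_trivial:
  assumes "\<Delta> = 1"
  shows "lab u = lab v"
proof -
  have "\<delta> = 1 \<or> \<delta> = - 1" using assms inverse(4) by linarith
  then show ?thesis by (auto simp: lab_def)
qed

lemma lab_vec:
  assumes "j < d"
  shows "lab u ! j = (colmat d cs *\<^sub>v vec d u) $ j mod \<delta>"
proof -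
  have "(colmat d cs *\<^sub>v vec d u) $ j = (\<Sum>i = 0..<d. cs ! i ! j * u i)"
    using assms mult_mat_vec_sum[of "colmat d cs" d d "vec d u" j] by (simp add: colmat_def)
  then show ?thesis using assms by (simp add: lab_def mult.commute lessThan_atLeast0)
qed

lemma lattice_cong_lab: "lattice_cong H (vec d u) (vec d v) \<longleftrightarrow> lab u = lab v"
proof -
  have "lattice_cong H (vec d u) (vec d v) \<longleftrightarrow> (\<forall>i<d. lab u ! i = lab v ! i)"
    using lattice_cong_iff[OF H colmat_carrier inverse(3) det_H inverse(5), of "vec d u" "vec d v"]
    by (simp add: lab_vec)
  also have "\<dots> \<longleftrightarrow> lab u = lab v" by (auto intro: nth_equalityI)
  finally show ?thesis .
qed

lemma card_labels: "finite (range lab)" "card (range lab) \<le> \<Delta>"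
proof -
  obtain R where R: "finite R" "int (card R) \<le> \<bar>det H\<bar>"
    "\<And>w. w \<in> carrier_vec d \<Longrightarrow> \<exists>r\<in>R. r \<in> carrier_vec d \<and> (\<exists>z\<in>carrier_vec d. w - r = H *\<^sub>v z)"
    using lattice_representatives[OF H det_H] by blast
  have sub: "range lab \<subseteq> (\<lambda>r. lab (\<lambda>i. r $ i)) ` R"
  proof
    fix g assume "g \<in> range lab"
    then obtain u where u: "g = lab u" by blast
    obtain r where r: "r \<in> R" "r \<in> carrier_vec d" "lattice_cong H (vec d u) r"
      using R(3)[of "vec d u"] H by (auto simp: lattice_cong_def)
    have "vec d (\<lambda>i. r $ i) = r" using r(2) by auto
    then have "lab u = lab (\<lambda>i. r $ i)" using r(3) lattice_cong_lab[of u "\<lambda>i. r $ i"] by simp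
    then show "g \<in> (\<lambda>r. lab (\<lambda>i. r $ i)) ` R" using r(1) u by blast
  qed
  show "finite (range lab)" using sub R(1) finite_surj by blast
  have "card (range lab) \<le> card R" using sub R(1) by (meson card_image_le card_mono finite_imageI order_trans)
  then show "card (range lab) \<le> \<Delta>" using R(2) \<Delta> by linarith
qed

lemma round_labels_set:
  "set (round_labels \<delta> (map (\<lambda>a. lab (\<lambda>i. W i a)) al) ls) =
    set ls \<union> (\<Union>a\<in>arcs G. (\<lambda>g. add_mod \<delta> 1 g (lab (\<lambda>i. W i a))) ` set ls)"
  by (auto simp: round_labels_def al)

definition ls :: "nat \<Rightarrow> int list list" where
  "ls k = closure_labels \<delta> (arc_weights Dl Hl Wl fl) (zero_label fl) k"

lemma ls_Suc: "set (ls (Suc k)) = set (ls k) \<union> (\<Union>a\<in>arcs G. (\<lambda>g. add_mod \<delta> 1 g (lab (\<lambda>i. W i a))) ` set (ls k))"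
  by (simp add: ls_def closure_labels_def arc_weights_eq round_labels_set)

lemma ls_range: "set (ls k) \<subseteq> range lab"
proof (induction k)
  case 0
  show ?case by (simp add: ls_def closure_labels_def zero_label_eq)
next
  case (Suc k)
  then show ?case unfolding ls_Suc by (auto simp: add_mod_lab dest!: subsetD)
qed

lemma ls_distinct: "distinct (ls k)"
  by (induction k) (auto simp: ls_def closure_labels_def round_labels_def)

lemma ls_length: "length (ls k) \<le> \<Delta>"
  using distinct_card[OF ls_distinct[of k]] card_mono[OF card_labels(1) ls_range[of k]] card_labels(2) by linarith

lemma ls_zero: "lab (\<lambda>_. 0) \<in> set (ls k)"
proof (induction k)
  case 0
  show ?case by (simp add: ls_def closure_labels_def zero_label_eq)
qed (simp add: ls_Suc)

text \<open>Before the list is closed it grows by an entry in every round, and it never has more than \<open>\<Delta>\<close>.\<close>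

lemma ls_closed: "set (ls (Suc \<Delta>)) = set (ls \<Delta>)"
proof (rule ccontr)
  assume ne: "set (ls (Suc \<Delta>)) \<noteq> set (ls \<Delta>)"
  have fix_step: "set (ls (Suc (Suc k))) = set (ls (Suc k))" if "set (ls (Suc k)) = set (ls k)" for k
    using ls_Suc[of "Suc k"] ls_Suc[of k] that by simp
  have diff: "set (ls (Suc k)) \<noteq> set (ls k)" if "k \<le> \<Delta>" for k
  proof
    assume eq: "set (ls (Suc k)) = set (ls k)"
    have "set (ls (Suc (k + j))) = set (ls (k + j))" for j
      by (induction j) (use eq fix_step in auto)
    from this[of "\<Delta> - k"] ne that show False by simp
  qed
  have "Suc k \<le> card (set (ls k))" if "k \<le> Suc \<Delta>" for k
    using that
  proof (induction k)
    case 0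
    have "card (set (ls 0)) \<noteq> 0" using ls_zero[of 0] by (auto simp: card_eq_0_iff)
    then show ?case by linarith
  next
    case (Suc k)
    have "set (ls k) \<subset> set (ls (Suc k))" using diff[of k] Suc.prems ls_Suc[of k] by blast
    then have "card (set (ls k)) < card (set (ls (Suc k)))" by (intro psubset_card_mono) auto
    then show ?case using Suc by simp
  qed
  from this[of "Suc \<Delta>"] show False
    using ls_length[of "Suc \<Delta>"] distinct_card[OF ls_distinct[of "Suc \<Delta>"]] by simp
qed

lemma label_list_eq: "label_list Dl Hl Wl fl = ls \<Delta>"
  using inverse(4) by (simp add: label_list_def ls_def \<delta>_def)

subsection \<open>Keys\<close>

definition vkey :: "'v \<Rightarrow> int" where
  "vkey v = (case map_of (zip vl (countdown (length vl))) v of None \<Rightarrow> 0 | Some k \<Rightarrow> k)"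

definition akey :: "'a \<Rightarrow> int" where
  "akey a = the (map_of (zip al (countdown (length al))) a)"

lemma vkey_nth: "p < length vl \<Longrightarrow> vkey (vl ! p) = countdown (length vl) ! p"
  using vl(1) by (simp add: vkey_def map_of_zip_nth)

lemma akey_nth: "p < length al \<Longrightarrow> akey (al ! p) = countdown (length al) ! p"
  using al(1) by (simp add: akey_def map_of_zip_nth)

lemma inj_on_vkey: "inj_on vkey (verts G)"
proof (rule inj_onI)
  fix v w assume "v \<in> verts G" "w \<in> verts G" and eq: "vkey v = vkey w"
  then obtain p q where "p < length vl" "q < length vl" "v = vl ! p" "w = vl ! q"
    unfolding vl(2)[symmetric] by (auto simp: in_set_conv_nth)
  then show "v = w" using eq distinct_countdown[of "length vl"] by (simp add: vkey_nth nth_eq_iff_index_eq)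
qed

lemma inj_on_akey: "inj_on akey (arcs G)"
proof (rule inj_onI)
  fix v w assume "v \<in> arcs G" "w \<in> arcs G" and eq: "akey v = akey w"
  then obtain p q where "p < length al" "q < length al" "v = al ! p" "w = al ! q"
    unfolding al(2)[symmetric] by (auto simp: in_set_conv_nth)
  then show "v = w" using eq distinct_countdown[of "length al"] by (simp add: akey_nth nth_eq_iff_index_eq)
qed

lemma vkey_nonzero: "v \<in> verts G \<Longrightarrow> vkey v \<noteq> 0"
proof -
  assume "v \<in> verts G"
  then obtain p where p: "p < length vl" "v = vl ! p"
    unfolding vl(2)[symmetric] by (auto simp: in_set_conv_nth)
  then have "vkey v \<in> set (countdown (length vl))" by (simp add: vkey_nth)
  then show ?thesis by (simp add: set_countdown)
qed

lemma ends: "a \<in> arcs G \<Longrightarrow> tail G a \<in> verts G" "a \<in> arcs G \<Longrightarrow> head G a \<in> verts G"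
  "a \<in> arcs G \<Longrightarrow> tail G a \<noteq> head G a"
  using fin_digraph.axioms(1)[OF fin_G] loopfree_digraph.no_loops[OF loopfree]
  by (auto simp: wf_digraph.tail_in_verts wf_digraph.head_in_verts)

lemma arc_ends_eq: "arc_ends (countdown (length Dl)) Dl (template Dl) = map (\<lambda>a. (vkey (tail G a), vkey (head G a))) al"
proof -
  let ?f = "\<lambda>p acc. map2 (\<lambda>e x. (if x = - 1 then fst p else fst e, if x = 1 then fst p else snd e)) acc (snd p)"
  let ?k = "\<lambda>vs ks v. case map_of (zip vs ks) v of None \<Rightarrow> 0 | Some k \<Rightarrow> (k :: int)"
  have "foldr ?f (zip ks (map (\<lambda>v. map (incidence G v) al) vs)) (map (\<lambda>_. (0, 0)) al) =
      map (\<lambda>a. (?k vs ks (tail G a), ?k vs ks (head G a))) al" if "length ks = length vs" for ks vs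
    using that
  proof (induction ks vs rule: list_induct2)
    case (Cons k ks v vs)
    show ?case
    proof (rule nth_equalityI)
      fix q assume "q < length (foldr ?f (zip (k # ks) (map (\<lambda>v. map (incidence G v) al) (v # vs))) (map (\<lambda>_. (0, 0)) al))"
      then have q: "q < length al" by (simp add: Cons.IH)
      then have "tail G (al ! q) \<noteq> head G (al ! q)" using ends(3) al(2) nth_mem by blast
      then show "foldr ?f (zip (k # ks) (map (\<lambda>v. map (incidence G v) al) (v # vs))) (map (\<lambda>_. (0, 0)) al) ! q =
          map (\<lambda>a. (?k (v # vs) (k # ks) (tail G a), ?k (v # vs) (k # ks) (head G a))) al ! q"
        using q by (auto simp: Cons.IH incidence_def)
    qed (simp add: Cons.IH)
  qed simp
  from this[of "countdown (length vl)" vl] show ?thesis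
    using template_Dl(1) by (simp add: arc_ends_def Dl_def[symmetric] vkey_def map_replicate_const)
       (simp add: Dl_def)
qed

definition arc_rec :: "'a \<Rightarrow> arc" where
  "arc_rec a = (akey a, (vkey (tail G a), vkey (head G a)), lab (\<lambda>i. W i a))"

lemma arc_data_eq: "arc_data Dl Hl Wl fl = map arc_rec al"
  unfolding arc_data_def Let_def arc_ends_eq arc_weights_eq
  by (intro nth_equalityI) (auto simp: arc_rec_def akey_nth)

abbreviation us :: "int list" where "us \<equiv> vertex_keys (map arc_rec al)"
abbreviation ks :: "int list" where "ks \<equiv> copies \<delta> us"

lemma set_us: "set us = insert 0 ((\<lambda>a. vkey (tail G a)) ` arcs G \<union> (\<lambda>a. vkey (head G a)) ` arcs G)"
  by (auto simp: vertex_keys_def arc_rec_def al image_Un image_image)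

lemma distinct_us: "distinct us"
proof -
  have "vkey (tail G a) \<noteq> 0" "vkey (head G a) \<noteq> 0" if "a \<in> arcs G" for a
    using that by (simp_all add: vkey_nonzero ends)
  then show ?thesis
    by (auto simp: vertex_keys_def arc_rec_def al distinct_map intro!: inj_onI)
qed

lemma distinct_ks: "distinct ks"
  using distinct_us by (simp add: copies_def)

lemma \<delta>_square: "\<delta> * \<delta> = 1 \<longleftrightarrow> \<Delta> = 1"
proof -
  have "\<delta> * \<delta> = int \<Delta> * int \<Delta>" using inverse(4) by (metis abs_mult_self_eq)
  then show ?thesis by (metis mult_1 of_nat_1 of_nat_eq_iff of_nat_mult nat_mult_eq_1_iff)
qed

sublocale net: labelled_network "arcs G" "\<lambda>a. vkey (tail G a)" "\<lambda>a. vkey (head G a)" W lab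
  "\<lambda>a g. add_mod \<delta> 1 g (lab (\<lambda>i. W i a))" "set (ls \<Delta>)" "set ks" "\<lambda>i. f $ i" \<Delta>
proof
  show "finite (arcs G)" using fin_G by (simp add: fin_digraph.finite_arcs)
  show "vkey (tail G a) \<noteq> 0 \<and> vkey (head G a) \<noteq> 0" if "a \<in> arcs G" for a
    using that by (simp add: vkey_nonzero ends)
  show "add_mod \<delta> 1 g (lab (\<lambda>i. W i a)) \<in> set (ls \<Delta>)" if "a \<in> arcs G" "g \<in> set (ls \<Delta>)" for a g
    using ls_Suc[of \<Delta>] ls_closed that by blast
  show "0 \<in> set ks" by (simp add: copies_def set_us)
  show "(\<forall>a\<in>arcs G. vkey (tail G a) \<in> set ks) \<or> (\<forall>u. lab u = lab (\<lambda>_. 0))"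
  proof (cases "\<Delta> = 1")
    case False
    then show ?thesis by (simp add: copies_def \<delta>_square set_us)
  qed (use lab_trivial in blast)
qed (simp_all add: add_mod_lab ls_zero \<Delta>_pos lab_period)

lemma Y_eq: "net.Y = congruency_circulations G d H W f"
proof -
  have ends_key: "(vkey (head G a) = vkey v) = (v = head G a)" "(vkey (tail G a) = vkey v) = (v = tail G a)"
    if "a \<in> arcs G" "v \<in> verts G" for a v
    using that ends[of a] inj_on_vkey by (auto simp: inj_on_eq_iff)
  have net: "net_inflow (arcs G) (\<lambda>a. vkey (tail G a)) (\<lambda>a. vkey (head G a)) (\<lambda>a. int (y a)) (vkey v) =
      (\<Sum>a\<in>arcs G. incidence G v a * int (y a))" if "v \<in> verts G" for y v
    unfolding net_inflow_def incidence_def using that by (intro sum.cong) (auto simp: ends_key)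
  have circ: "(\<forall>u. net_inflow (arcs G) (\<lambda>a. vkey (tail G a)) (\<lambda>a. vkey (head G a)) (\<lambda>a. int (y a)) u = 0) \<longleftrightarrow>
      (\<forall>v\<in>verts G. (\<Sum>a\<in>arcs G. incidence G v a * int (y a)) = 0)" for y
  proof (intro iffI allI ballI)
    fix u assume *: "\<forall>v\<in>verts G. (\<Sum>a\<in>arcs G. incidence G v a * int (y a)) = 0"
    show "net_inflow (arcs G) (\<lambda>a. vkey (tail G a)) (\<lambda>a. vkey (head G a)) (\<lambda>a. int (y a)) u = 0"
    proof (cases "u \<in> vkey ` verts G")
      case False
      then show ?thesis unfolding net_inflow_def using ends by (intro sum.neutral) auto
    qed (use * net in auto)
  qed (simp add: net[symmetric])
  have "vec d (\<lambda>i. f $ i) = f" using f by auto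
  then have "lattice_cong H (vec d (\<lambda>i. \<Sum>a\<in>arcs G. W i a * int (y a))) f \<longleftrightarrow> lab (net.weight y) = lab (\<lambda>i. f $ i)" for y
    using lattice_cong_lab[of "net.weight y" "\<lambda>i. f $ i"] by (simp add: net.weight_def)
  then show ?thesis
    unfolding net.Y_def net.circulations_def congruency_circulations_def using circ by auto
qed

subsection \<open>The output\<close>

definition node_list :: "int \<times> int \<times> int list \<Rightarrow> int list" where
  "node_list n = fst n # fst (snd n) # snd (snd n)"

lemma node_list_eq_iff [simp]: "node_list m = node_list n \<longleftrightarrow> m = n"
  by (auto simp: node_list_def prod_eq_iff)

lemma node_key_eq: "node_key i u g = node_list (node i u g)"
  by (simp add: node_key_def node_def node_list_def)

definition edge_list :: "(int \<times> int list \<times> 'a) list" where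
  "edge_list = concat (map (\<lambda>i. concat (map (\<lambda>g. map (\<lambda>a. (i, g, a)) al) (ls \<Delta>))) ks)"

definition edge_rec :: "int \<times> int list \<times> 'a \<Rightarrow> zvar" where
  "edge_rec e = ([akey (snd (snd e))], fst e # akey (snd (snd e)) # fst (snd e),
     node_list (net.etrg e), node_list (net.esrc e))"

lemma edge_list_product: "edge_list = List.product ks (List.product (ls \<Delta>) al)"
  by (simp add: edge_list_def product_concat_map map_concat comp_def)

lemma edge_list: "set edge_list = net.E" "distinct edge_list" "length edge_list = length ks * (length (ls \<Delta>) * length al)"
  using distinct_ks ls_distinct al
  by (simp_all add: edge_list_product net.E_def distinct_product length_product)

lemma var_data_eq: "var_data Dl Hl Wl fl = map edge_rec edge_list"
  unfolding var_data_def Let_def zvars_def arc_data_eq label_list_eq edge_list_def \<delta>_def[symmetric]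
  by (simp add: map_concat comp_def zvar_def arc_rec_def edge_rec_def node_key_eq net.etrg_def net.esrc_def)

lemma row_data_eq: "row_data Dl Hl Wl fl = rows (map arc_rec al) (map edge_rec edge_list) (node_keys ks us (ls \<Delta>))
    (lab (\<lambda>i. f $ i)) (lab (\<lambda>_. 0))"
  unfolding row_data_def Let_def arc_data_eq label_list_eq \<delta>_def[symmetric] var_data_eq target_label_eq zero_label_eq ..

definition R :: "row list" where "R = row_data Dl Hl Wl fl"

lemma set_node_keys: "set (node_keys ks us (ls \<Delta>)) = node_list ` net.nodes"
  by (force simp: node_keys_def net.nodes_def node_list_def set_us)

text \<open>The rows in terms of the abstract network: nodes, edges and arcs in place of their keys.\<close>

lemma set_R: "set R = (\<lambda>a. (1, 0, 0, 0, [akey a])) ` arcs G \<union> (\<lambda>a. (- 1, 0, 0, 0, [akey a])) ` arcs G \<union>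
    (\<lambda>e. (0, - 1, 0, 0, fst e # akey (snd (snd e)) # fst (snd e))) ` net.E \<union>
    (\<lambda>n. (0, 0, 1, of_bool (net.hub (\<lambda>i. f $ i) = n) - of_bool (net.hub (\<lambda>_. 0) = n), node_list n)) ` net.nodes"
proof -
  have hub: "0 # 0 # lab u = node_list (net.hub u)" for u by (simp add: node_list_def net.hub_def)
  show ?thesis
    unfolding R_def row_data_eq rows_def set_append set_map set_node_keys edge_list(1) image_image hub
    by (simp add: al arc_rec_def edge_rec_def Un_assoc eq_commute)
qed

definition B :: "nat \<Rightarrow> 'a \<Rightarrow> int" where "B i a = coef_x (R ! i) (arc_rec a)"
definition C :: "nat \<Rightarrow> nat \<Rightarrow> int" where "C i j = coef_z (R ! i) (edge_rec (edge_list ! j))"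
definition rhs_vec :: "nat \<Rightarrow> int" where "rhs_vec i = rhs (R ! i)"

lemma formulation_eq: "formulation Dl Hl Wl fl = enc_formulation al (length R) (length edge_list) B C rhs_vec"
proof -
  have 1: "map (\<lambda>r. map (coef_x r) (map arc_rec al)) R = map (\<lambda>i. map (B i) al) [0..<length R]"
    by (rule nth_equalityI) (auto simp: B_def)
  have 2: "map (\<lambda>r. map (coef_z r) (map edge_rec edge_list)) R = map (\<lambda>i. map (C i) [0..<length edge_list]) [0..<length R]"
    by (rule nth_equalityI) (auto simp: C_def intro!: nth_equalityI)
  have 3: "map rhs R = map rhs_vec [0..<length R]" by (rule nth_equalityI) (auto simp: rhs_vec_def)
  show ?thesis
    unfolding formulation_def enc_output_def arc_data_eq var_data_eq R_def[symmetric] 1 2 3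
    by (simp add: enc_formulation_def enc_matrix_def enc_vector_def enc_list_map)
qed

lemma row_conditions:
  fixes x :: "'a \<Rightarrow> real"
  shows "(\<forall>r\<in>set R. (\<Sum>a\<in>arcs G. real_of_int (coef_x r (arc_rec a)) * x a) +
      (\<Sum>e\<in>net.E. real_of_int (coef_z r (edge_rec e)) * \<zeta> e) \<le> real_of_int (rhs r)) \<longleftrightarrow> net.solution x \<zeta>"
    (is "(\<forall>r\<in>set R. ?P r) \<longleftrightarrow> _")
proof -
  have fin: "finite (arcs G)" using fin_G by (simp add: fin_digraph.finite_arcs)
  have ak: "akey a = akey b \<longleftrightarrow> a = b" if "a \<in> arcs G" "b \<in> arcs G" for a b
    using inj_on_akey that by (auto simp: inj_on_eq_iff)
  have sx: "(\<Sum>a\<in>arcs G. of_bool (akey a = akey b) * x a) = x b" if b: "b \<in> arcs G" for b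
  proof -
    have "(\<Sum>a\<in>arcs G. of_bool (akey a = akey b) * x a) = (\<Sum>a\<in>arcs G. if a = b then x b else 0)"
      using ak b by (intro sum.cong) auto
    then show ?thesis using fin b by simp
  qed
  have sz: "(\<Sum>e\<in>net.E. of_bool (akey (snd (snd e)) = akey b) * \<zeta> e) = (\<Sum>i\<in>set ks. \<Sum>g\<in>set (ls \<Delta>). \<zeta> (i, g, b))"
    if b: "b \<in> arcs G" for b
  proof -
    have "(\<Sum>e\<in>net.E. of_bool (akey (snd (snd e)) = akey b) * \<zeta> e) =
        (\<Sum>i\<in>set ks. \<Sum>g\<in>set (ls \<Delta>). \<Sum>a\<in>arcs G. of_bool (akey a = akey b) * \<zeta> (i, g, a))"
      unfolding net.E_def sum.cartesian_product by (simp add: split_def)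
    also have "\<dots> = (\<Sum>i\<in>set ks. \<Sum>g\<in>set (ls \<Delta>). \<Sum>a\<in>arcs G. if a = b then \<zeta> (i, g, b) else 0)"
      using ak b by (intro sum.cong refl) auto
    finally show ?thesis using fin b by simp
  qed
  have e1: "?P (1, 0, 0, 0, [akey b]) \<longleftrightarrow> (\<Sum>i\<in>set ks. \<Sum>g\<in>set (ls \<Delta>). \<zeta> (i, g, b)) \<le> x b"
    and e2: "?P (- 1, 0, 0, 0, [akey b]) \<longleftrightarrow> x b \<le> (\<Sum>i\<in>set ks. \<Sum>g\<in>set (ls \<Delta>). \<zeta> (i, g, b))"
    if "b \<in> arcs G" for b
    using sx[OF that] sz[OF that]
    by (simp_all add: coef_x_def coef_z_def row_key_def rhs_def arc_rec_def edge_rec_def sum_negf)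
  have e3: "?P (0, - 1, 0, 0, fst e # akey (snd (snd e)) # fst (snd e)) \<longleftrightarrow> 0 \<le> \<zeta> e" if e: "e \<in> net.E" for e
  proof -
    have "(\<Sum>e'\<in>net.E. of_bool (fst e' = fst e \<and> akey (snd (snd e')) = akey (snd (snd e)) \<and> fst (snd e') = fst (snd e)) * \<zeta> e') =
        (\<Sum>e'\<in>net.E. if e' = e then \<zeta> e else 0)"
      using e ak by (intro sum.cong) (auto simp: net.E_def)
    also have "\<dots> = \<zeta> e" using e net.finite_E by simp
    finally show ?thesis
      by (simp add: coef_x_def coef_z_def row_key_def rhs_def arc_rec_def edge_rec_def sum_negf)
  qed
  have e4: "?P (0, 0, 1, of_bool (net.hub (\<lambda>i. f $ i) = n) - of_bool (net.hub (\<lambda>_. 0) = n), node_list n) \<longleftrightarrow>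
      net_inflow net.E net.esrc net.etrg \<zeta> n \<le> of_bool (net.hub (\<lambda>i. f $ i) = n) - of_bool (net.hub (\<lambda>_. 0) = n)" for n
    by (simp add: coef_x_def coef_z_def row_key_def rhs_def arc_rec_def edge_rec_def net_inflow_def)
  have "(\<forall>r\<in>set R. ?P r) \<longleftrightarrow>
      (\<forall>b\<in>arcs G. ?P (1, 0, 0, 0, [akey b])) \<and> (\<forall>b\<in>arcs G. ?P (- 1, 0, 0, 0, [akey b])) \<and>
      (\<forall>e\<in>net.E. ?P (0, - 1, 0, 0, fst e # akey (snd (snd e)) # fst (snd e))) \<and>
      (\<forall>n\<in>net.nodes. ?P (0, 0, 1, of_bool (net.hub (\<lambda>i. f $ i) = n) - of_bool (net.hub (\<lambda>_. 0) = n), node_list n))"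
    unfolding set_R ball_Un ball_simps(9) by blast
  also have "\<dots> \<longleftrightarrow> (\<forall>b\<in>arcs G. (\<Sum>i\<in>set ks. \<Sum>g\<in>set (ls \<Delta>). \<zeta> (i, g, b)) \<le> x b) \<and>
      (\<forall>b\<in>arcs G. x b \<le> (\<Sum>i\<in>set ks. \<Sum>g\<in>set (ls \<Delta>). \<zeta> (i, g, b))) \<and> (\<forall>e\<in>net.E. 0 \<le> \<zeta> e) \<and>
      (\<forall>n\<in>net.nodes. net_inflow net.E net.esrc net.etrg \<zeta> n \<le>
        of_bool (net.hub (\<lambda>i. f $ i) = n) - of_bool (net.hub (\<lambda>_. 0) = n))"
    by (intro arg_cong2[of _ _ _ _ "(\<and>)"] ball_cong refl e1 e2 e3 e4)
  also have "\<dots> \<longleftrightarrow> net.solution x \<zeta>"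
    unfolding net.solution_def by (auto intro: antisym)
  finally show ?thesis .
qed

theorem is_extended_formulation:
  "extended_formulation (arcs G) (circulation_hull G d H W f) (length R) (length edge_list)
    (\<lambda>i a. real_of_int (B i a)) (\<lambda>i j. real_of_int (C i j)) (\<lambda>i. real_of_int (rhs_vec i))"
proof -
  let ?n = "length edge_list"
  have bij: "bij_betw ((!) edge_list) {..<?n} net.E"
    using bij_betw_nth[OF edge_list(2), of "{..<?n}" net.E] edge_list(1) by simp
  have rowsum: "(\<Sum>j<?n. real_of_int (C i j) * \<zeta> (edge_list ! j)) = (\<Sum>e\<in>net.E. real_of_int (coef_z (R ! i) (edge_rec e)) * \<zeta> e)" for i \<zeta>
    unfolding C_def by (rule sum.reindex_bij_betw[OF bij])
  have sol: "net.solution x \<zeta> \<longleftrightarrow> (\<forall>i<length R. (\<Sum>a\<in>arcs G. real_of_int (B i a) * x a) +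
      (\<Sum>j<?n. real_of_int (C i j) * \<zeta> (edge_list ! j)) \<le> real_of_int (rhs_vec i))" for x \<zeta>
    unfolding row_conditions[symmetric] rowsum B_def rhs_vec_def all_set_conv_all_nth ..
  have iff: "(\<exists>\<zeta>. net.solution x \<zeta>) \<longleftrightarrow> (\<exists>z :: nat \<Rightarrow> real. \<forall>i<length R. (\<Sum>a\<in>arcs G. real_of_int (B i a) * x a) +
      (\<Sum>j<?n. real_of_int (C i j) * z j) \<le> real_of_int (rhs_vec i))" for x
  proof
    assume "\<exists>\<zeta>. net.solution x \<zeta>"
    then obtain \<zeta> where "net.solution x \<zeta>" ..
    then show "\<exists>z :: nat \<Rightarrow> real. \<forall>i<length R. (\<Sum>a\<in>arcs G. real_of_int (B i a) * x a) +
      (\<Sum>j<?n. real_of_int (C i j) * z j) \<le> real_of_int (rhs_vec i)"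
      unfolding sol by (rule exI[of _ "\<lambda>j. \<zeta> (edge_list ! j)"])
  next
    assume "\<exists>z :: nat \<Rightarrow> real. \<forall>i<length R. (\<Sum>a\<in>arcs G. real_of_int (B i a) * x a) +
      (\<Sum>j<?n. real_of_int (C i j) * z j) \<le> real_of_int (rhs_vec i)"
    then obtain z :: "nat \<Rightarrow> real" where z: "\<forall>i<length R. (\<Sum>a\<in>arcs G. real_of_int (B i a) * x a) +
      (\<Sum>j<?n. real_of_int (C i j) * z j) \<le> real_of_int (rhs_vec i)" by blast
    define \<zeta> where "\<zeta> e = z (inv_into {..<?n} ((!) edge_list) e)" for e
    have "\<zeta> (edge_list ! j) = z j" if "j < ?n" for j
      using bij that by (simp add: \<zeta>_def bij_betw_def inv_into_f_f)
    then have "net.solution x \<zeta>" unfolding sol using z by simp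
    then show "\<exists>\<zeta>. net.solution x \<zeta>" by blast
  qed
  have "{x. (\<forall>a. a \<notin> arcs G \<longrightarrow> x a = 0) \<and> (\<exists>\<zeta>. net.solution x \<zeta>)} =
      {x. (\<forall>a. a \<notin> arcs G \<longrightarrow> x a = 0) \<and> (\<exists>z :: nat \<Rightarrow> real. \<forall>i<length R. (\<Sum>a\<in>arcs G. real_of_int (B i a) * x a) +
      (\<Sum>j<?n. real_of_int (C i j) * z j) \<le> real_of_int (rhs_vec i))}"
    unfolding iff ..
  then show ?thesis
    unfolding extended_formulation_def circulation_hull_def net.solutions_eq_hull Y_eq[symmetric] by simp
qed

lemma length_R: "length R = 2 * length al + length ks * (length (ls \<Delta>) * length al) + length ks * (length us * length (ls \<Delta>))"
proof -
  have "length (node_keys ks us (ls \<Delta>)) = length (List.product ks (List.product us (ls \<Delta>)))"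
    unfolding node_keys_def product_concat_map by (simp add: length_concat comp_def)
  then have "length (node_keys ks us (ls \<Delta>)) = length ks * (length us * length (ls \<Delta>))"
    by (simp add: length_product)
  then show ?thesis unfolding R_def row_data_eq rows_def using edge_list(3) by simp
qed

text \<open>There are at most \<open>\<Delta>\<close> labels, and at most \<open>2 |A|\<close> keys of nodes besides \<open>0\<close>. With one copy if \<open>\<Delta> = 1\<close> and at
  most \<open>|V| + 1\<close> copies otherwise, the number of rows is of order \<open>|A|\<close> and \<open>\<Delta> |V| |A|\<close>, respectively.\<close>

theorem size_bound:
  assumes ne: "arcs G \<noteq> {}"
  shows "length R \<le> 10 * (\<Delta> ^ (\<Delta> + 1) * card (arcs G) * card (verts G) ^ (\<Delta> - 1))"
proof -
  define m n where "m = card (arcs G)" and "n = card (verts G)"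
  have al_m: "length al = m" using al distinct_card[OF al(1)] by (simp add: m_def)
  have fin: "finite (arcs G)" "finite (verts G)"
    using fin_G by (simp_all add: fin_digraph.finite_arcs fin_digraph.finite_verts)
  obtain a where a: "a \<in> arcs G" using ne by blast
  have m: "1 \<le> m" unfolding m_def using a fin by (simp add: Suc_le_eq card_gt_0_iff) blast
  have n: "1 \<le> n" unfolding n_def using ends(1)[OF a] fin by (simp add: Suc_le_eq card_gt_0_iff) blast
  define V where "V = (\<lambda>a. vkey (tail G a)) ` arcs G \<union> (\<lambda>a. vkey (head G a)) ` arcs G"
  have us: "length us = card (insert 0 V)" using distinct_card[OF distinct_us] by (simp add: set_us V_def)
  have "card V \<le> 2 * m"
    using card_Un_le[of "(\<lambda>a. vkey (tail G a)) ` arcs G" "(\<lambda>a. vkey (head G a)) ` arcs G"]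
      card_image_le[OF fin(1), of "\<lambda>a. vkey (tail G a)"] card_image_le[OF fin(1), of "\<lambda>a. vkey (head G a)"]
    by (simp add: V_def m_def)
  moreover have "V \<subseteq> vkey ` verts G" using ends by (auto simp: V_def)
  then have "card V \<le> n" using card_mono[of "vkey ` verts G" V] card_image_le[OF fin(2), of vkey] fin by (simp add: n_def)
  moreover have "card (insert 0 V) \<le> card V + 1" using fin by (simp add: V_def card_insert_if)
  ultimately have us_le: "length us \<le> 2 * m + 1" "length us \<le> n + 1" using us by simp_all
  have L: "length (ls \<Delta>) \<le> \<Delta>" by (rule ls_length)
  show ?thesis
  proof (cases "\<Delta> = 1")
    case True
    then have "length ks = 1" by (simp add: copies_def \<delta>_square)
    then have "length R = 2 * m + length (ls \<Delta>) * m + length us * length (ls \<Delta>)"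
      by (simp add: length_R al_m)
    also have "\<dots> \<le> 2 * m + 1 * m + (2 * m + 1) * 1"
      using L True us_le by (intro add_mono mult_le_mono) auto
    also have "\<dots> \<le> 10 * m" using m by simp
    finally show ?thesis using True by (simp add: m_def)
  next
    case False
    then have \<Delta>2: "2 \<le> \<Delta>" using \<Delta>_pos by simp
    have ks: "length ks \<le> 2 * n" using False us_le n by (simp add: copies_def \<delta>_square)
    have "length R \<le> 2 * m + 2 * n * (\<Delta> * m) + 2 * n * ((2 * m + 1) * \<Delta>)"
      unfolding length_R al_m using ks L us_le by (intro add_mono mult_le_mono) auto
    also have "\<dots> \<le> 2 * (\<Delta> * m * n) + 2 * (\<Delta> * m * n) + 6 * (\<Delta> * m * n)"
    proof (intro add_mono)
      have "m * 1 * 1 \<le> m * \<Delta> * n" using n \<Delta>_pos by (intro mult_le_mono) auto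
      then show "2 * m \<le> 2 * (\<Delta> * m * n)" by (simp add: mult.commute)
      have "(2 * m + 1) * (n * \<Delta>) \<le> (3 * m) * (n * \<Delta>)" using m by (intro mult_le_mono1) simp
      then show "2 * n * ((2 * m + 1) * \<Delta>) \<le> 6 * (\<Delta> * m * n)" by (simp add: algebra_simps)
    qed (simp add: algebra_simps)
    also have "\<dots> = 10 * (\<Delta> * m * n)" by simp
    also have "\<dots> \<le> 10 * (\<Delta> ^ (\<Delta> + 1) * m * n ^ (\<Delta> - 1))"
    proof (intro mult_le_mono le_refl)
      show "\<Delta> \<le> \<Delta> ^ (\<Delta> + 1)" using \<Delta>_pos by (intro self_le_power) auto
      show "n \<le> n ^ (\<Delta> - 1)" using n \<Delta>2 by (intro self_le_power) auto
    qed
    finally show ?thesis by (simp add: m_def n_def)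
  qed
qed

subsection \<open>Bounds for the running time\<close>

abbreviation "inp \<equiv> enc_instance vl al G d H W f"

lemma input_bounds: "length Dl \<le> val_size inp" "d \<le> val_size inp" "length al \<le> val_size inp"
proof -
  have "length Dl \<le> val_size (EM Dl)" "length fl \<le> val_size (EL fl)" "length (template Dl) \<le> val_size (EL (template Dl))"
    by (rule length_le_val_size)+
  moreover have "val_size (EL (template Dl)) \<le> val_size (EM Dl)"
    by (cases "Dl = []") (auto simp: template_def intro: val_size_enc_list_mem)
  ultimately show "length Dl \<le> val_size inp" "d \<le> val_size inp" "length al \<le> val_size inp"
    using template_Dl(1) by (simp_all add: enc_instance_eq)
qed

lemma ls_size: "val_size (EM (ls k)) \<le> \<Delta> * (1 + (d * (2 + \<Delta>) + 1)) + 1"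
proof (rule val_size_enc_list_le[OF ls_length])
  fix g assume "g \<in> set (ls k)"
  then obtain u where u: "g = lab u" using ls_range by blast
  have "reduced \<delta> d g"
    using abs_mod_less[OF inverse(5)] by (auto simp: u reduced_def lab_def intro: less_imp_le)
  from reduced_size[OF this] show "val_size (EL g) \<le> d * (2 + \<Delta>) + 1" using inverse(4) by simp
qed

end

text \<open>The parameter is the size of the input plus \<open>\<Delta>\<close>. Hence the exponent does not depend on \<open>\<Delta>\<close>; only
  the base of the bound does.\<close>

theorem formulation_in_polynomial_time:
  "\<exists>fs main k. \<forall>(G :: ('v, 'a) pre_digraph) vl al d H W f \<Delta>. encoded_instance G vl al d H f \<Delta> \<longrightarrow>
    computes_within fs main (enc_instance vl al G d H W f) (formulation (encoded_instance.Dl G vl al) (encoded_instance.Hl d H) (encoded_instance.Wl al d W) (encoded_instance.fl d f))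
      ((val_size (enc_instance vl al G d H W f) + \<Delta> + 2) ^ k)"
proof -
  define I where "I = {(G :: ('v, 'a) pre_digraph, vl, al, d, H, W :: nat \<Rightarrow> 'a \<Rightarrow> int, f, \<Delta>). encoded_instance G vl al d H f \<Delta>}"
  define inp where "inp = (\<lambda>(G :: ('v, 'a) pre_digraph, vl, al, d, H, W, f, \<Delta> :: nat). enc_instance vl al G d H W f)"
  define N where "N = (\<lambda>(G :: ('v, 'a) pre_digraph, vl :: 'v list, al :: 'a list, d :: nat, H :: int mat, W :: nat \<Rightarrow> 'a \<Rightarrow> int, f :: int vec, \<Delta> :: nat).
    val_size (enc_instance vl al G d H W f) + \<Delta>)"
  define D where "D = (\<lambda>(G :: ('v, 'a) pre_digraph, vl, al, d :: nat, H :: int mat, W :: nat \<Rightarrow> 'a \<Rightarrow> int, f :: int vec, \<Delta> :: nat). encoded_instance.Dl G vl al)"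
  define Hh where "Hh = (\<lambda>(G :: ('v, 'a) pre_digraph, vl :: 'v list, al :: 'a list, d, H, W :: nat \<Rightarrow> 'a \<Rightarrow> int, f :: int vec, \<Delta> :: nat). encoded_instance.Hl d H)"
  define Ww where "Ww = (\<lambda>(G :: ('v, 'a) pre_digraph, vl :: 'v list, al :: 'a list, d, H :: int mat, W, f :: int vec, \<Delta> :: nat). encoded_instance.Wl al d W)"
  define ff where "ff = (\<lambda>(G :: ('v, 'a) pre_digraph, vl :: 'v list, al :: 'a list, d, H :: int mat, W :: nat \<Rightarrow> 'a \<Rightarrow> int, f, \<Delta> :: nat). encoded_instance.fl d f)"
  note defs = I_def inp_def N_def D_def Hh_def Ww_def ff_def
  let ?\<rho> = "\<lambda>c. [inp c]"
  let ?m = "\<lambda>c. nat \<bar>modulus (Hh c) (ff c)\<bar>"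
  have inp: "inp c = Cell (EM (D c)) (Cell (EM (Hh c)) (Cell (EM (Ww c)) (Cell (EL (ff c)) (Num 0))))" if "c \<in> I" for c
    using that by (auto simp: defs encoded_instance.enc_instance_eq)
  have facts: "nonsingular (Hh c) \<and> length (ff c) = length (Hh c) \<and> modulus (Hh c) (ff c) \<noteq> 0 \<and> ?m c \<le> N c \<and>
    length (D c) \<le> N c \<and> length (ff c) \<le> N c \<and>
    length (arc_ends (countdown (length (D c))) (D c) (template (D c))) \<le> N c \<and>
    val_size (EM (closure_labels (modulus (Hh c) (ff c)) (arc_weights (D c) (Hh c) (Ww c) (ff c)) (zero_label (ff c)) k))
      \<le> N c * (1 + (N c * (2 + N c) + 1)) + 1" if c: "c \<in> I" for c k
  proof -
    obtain G vl al d H W f \<Delta> where ce: "c = (G, vl, al, d, H, W, f, \<Delta>)"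
      by (rule that[of "fst c" "fst (snd c)" "fst (snd (snd c))" "fst (snd (snd (snd c)))" "fst (snd (snd (snd (snd c))))" "fst (snd (snd (snd (snd (snd c)))))" "fst (snd (snd (snd (snd (snd (snd c))))))" "snd (snd (snd (snd (snd (snd (snd c))))))"]) simp
    interpret encoded_instance G vl al d H W f \<Delta> using c by (simp add: ce defs)
    have m: "modulus (encoded_instance.Hl d H) (encoded_instance.fl d f) = \<delta>" by (simp add: \<delta>_def)
    have "\<Delta> * (1 + (d * (2 + \<Delta>) + 1)) + 1 \<le> N c * (1 + (N c * (2 + N c) + 1)) + 1"
      using input_bounds(2) by (intro add_mono mult_le_mono) (auto simp: ce N_def)
    with ls_size[of k] show ?thesis
      using nonsingular_Hl length_Hl length_fl inverse(4,5) input_bounds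
      unfolding ce D_def Hh_def Ww_def ff_def N_def prod.case m ls_def[folded \<delta>_def] arc_ends_eq
      by (auto simp: ls_def)
  qed
  have "PT I N ?\<rho> (\<lambda>c. Cell (EM (D c)) (Cell (EM (Hh c)) (Cell (EM (Ww c)) (Cell (EL (ff c)) (Num 0)))))"
    by (rule PT_cong[OF PT_var0]) (rule inp)
  note p0 = this
  have sec: "PT I N ?\<rho> (\<lambda>c. Cell (F c) (F' c)) \<Longrightarrow> PT I N ?\<rho> F'" and fst: "PT I N ?\<rho> (\<lambda>c. Cell (F c) (F' c)) \<Longrightarrow> PT I N ?\<rho> F" for F F'
    by (rule PTI, rule run_Second run_First, erule PTD; assumption)+
  have "PT I N ?\<rho> (\<lambda>c. formulation (D c) (Hh c) (Ww c) (ff c))"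
  proof (rule PT_formulation[OF fst[OF p0] fst[OF sec[OF p0]] fst[OF sec[OF sec[OF p0]]] fst[OF sec[OF sec[OF sec[OF p0]]]]])
    show "poly_bounded I N (\<lambda>c. N c * (1 + (N c * (2 + N c) + 1)) + 1)" by (intro poly_bounded_rules)
  qed (use facts in \<open>blast intro: poly_bounded_mono[OF poly_bounded_param order_refl]\<close>)+
  moreover have "env_ok I N ?\<rho>"
    by (intro env_ok_Cons env_ok_Nil poly_bounded_mono[OF poly_bounded_param order_refl]) (auto simp: inp_def N_def)
  ultimately have run: "run I N ?\<rho> (\<lambda>c. formulation (D c) (Hh c) (Ww c) (ff c))" using PTD by blast
  obtain fs main T where T: "poly_bounded I N T" "\<And>c pre post. c \<in> I \<Longrightarrow> length pre = 0 \<Longrightarrow>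
      \<exists>t\<le>T c. eval (pre @ fs @ post) [inp c] main (formulation (D c) (Hh c) (Ww c) (ff c)) t"
    by (rule runE[OF run, where n = 0]) (rule that)
  obtain k where k: "\<And>c. c \<in> I \<Longrightarrow> T c + val_size (formulation (D c) (Hh c) (Ww c) (ff c)) \<le> (N c + 2) ^ k"
    using poly_boundedE[OF poly_bounded_add[OF T(1) run_size[OF run]]] by blast
  have "computes_within fs main (inp c) (formulation (D c) (Hh c) (Ww c) (ff c)) ((N c + 2) ^ k)" if c: "c \<in> I" for c
  proof -
    obtain t where "t \<le> T c" "eval fs [inp c] main (formulation (D c) (Hh c) (Ww c) (ff c)) t"
      using T(2)[OF c, of "[]" "[]"] by auto
    then show ?thesis unfolding computes_within_def using k[OF c] by (intro exI[of _ t]) simp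
  qed
  then show ?thesis
    by (intro exI[of _ fs] exI[of _ main] exI[of _ k] allI impI) (force simp: defs)
qed

theorem lemma6:
  shows "\<exists>(fs :: expr list) (main :: expr) (c :: nat). \<forall>\<Delta> :: nat. \<exists>p :: nat poly.
    \<forall>(G :: ('v, 'a) pre_digraph) (vl :: 'v list) (al :: 'a list)
     (d :: nat) (H :: int mat) (W :: nat \<Rightarrow> 'a \<Rightarrow> int) (f :: int vec).
      fin_digraph G \<and> loopfree_digraph G \<and>
      distinct vl \<and> set vl = verts G \<and> distinct al \<and> set al = arcs G \<and>
      H \<in> carrier_mat d d \<and> invertible_mat (map_mat real_of_int H) \<and> int \<Delta> = \<bar>det H\<bar> \<and>
      f \<in> carrier_vec d \<longrightarrow>
      (\<exists>(l :: nat) (k :: nat) (B :: nat \<Rightarrow> 'a \<Rightarrow> int) (C :: nat \<Rightarrow> nat \<Rightarrow> int) (e :: nat \<Rightarrow> int).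
        extended_formulation (arcs G) (circulation_hull G d H W f) l k
          (\<lambda>i a. real_of_int (B i a)) (\<lambda>i j. real_of_int (C i j)) (\<lambda>i. real_of_int (e i)) \<and>
        (arcs G \<noteq> {} \<longrightarrow>
          l \<le> c * (\<Delta> ^ (\<Delta> + 1) * card (arcs G) * card (verts G) ^ (\<Delta> - 1))) \<and>
        computes_within fs main (enc_instance vl al G d H W f) (enc_formulation al l k B C e)
          (poly p (val_size (enc_instance vl al G d H W f))))"
    (is "\<exists>fs main c. \<forall>\<Delta>. \<exists>p. ?claim fs main c \<Delta> p")
proof -
  obtain fs main k where run: "\<And>(G :: ('v, 'a) pre_digraph) vl al d H W f \<Delta>. encoded_instance G vl al d H f \<Delta> \<Longrightarrow>
    computes_within fs main (enc_instance vl al G d H W f) (formulation (encoded_instance.Dl G vl al) (encoded_instance.Hl d H) (encoded_instance.Wl al d W) (encoded_instance.fl d f))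
      ((val_size (enc_instance vl al G d H W f) + \<Delta> + 2) ^ k)"
    using formulation_in_polynomial_time by blast
  show ?thesis
  proof (rule exI[of _ fs], rule exI[of _ main], rule exI[of _ 10], rule allI)
    fix \<Delta> :: nat
    show "\<exists>p. ?claim fs main 10 \<Delta> p"
    proof (rule exI[of _ "[:\<Delta> + 2, 1:] ^ k"], intro allI impI)
      fix G :: "('v, 'a) pre_digraph" and vl al d and H :: "int mat" and W :: "nat \<Rightarrow> 'a \<Rightarrow> int" and f :: "int vec"
      assume "fin_digraph G \<and> loopfree_digraph G \<and>
        distinct vl \<and> set vl = verts G \<and> distinct al \<and> set al = arcs G \<and>
        H \<in> carrier_mat d d \<and> invertible_mat (map_mat real_of_int H) \<and> int \<Delta> = \<bar>det H\<bar> \<and>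
        f \<in> carrier_vec d"
      then interpret encoded_instance G vl al d H W f \<Delta> by (intro encoded_instance.intro) auto
      have "computes_within fs main inp (enc_formulation al (length R) (length edge_list) B C rhs_vec)
          (poly ([:\<Delta> + 2, 1:] ^ k) (val_size inp))"
        using run[OF encoded_instance_axioms, of W] by (simp add: formulation_eq poly_power add.commute add.left_commute)
      then show "\<exists>(l :: nat) (k' :: nat) (B :: nat \<Rightarrow> 'a \<Rightarrow> int) (C :: nat \<Rightarrow> nat \<Rightarrow> int) (e :: nat \<Rightarrow> int).
          extended_formulation (arcs G) (circulation_hull G d H W f) l k'
            (\<lambda>i a. real_of_int (B i a)) (\<lambda>i j. real_of_int (C i j)) (\<lambda>i. real_of_int (e i)) \<and>
          (arcs G \<noteq> {} \<longrightarrow>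
            l \<le> 10 * (\<Delta> ^ (\<Delta> + 1) * card (arcs G) * card (verts G) ^ (\<Delta> - 1))) \<and>
          computes_within fs main inp (enc_formulation al l k' B C e)
            (poly ([:\<Delta> + 2, 1:] ^ k) (val_size inp))"
        using is_extended_formulation size_bound by blast
    qed
  qed
qed

end
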